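(* Let $\alpha>0$ and let $E_\alpha(S)=\int_{\mathcal{M}}\|DS(x)\|^2-\alpha\|S(x)\|^2\,dx$. There exists $S_*\in\mathcal{A}_g^1(\mathcal{M})$ such that $$E_\alpha(S_* )=\inf_{S\in\mathcal{A}_g^1(\mathcal{M})}E_\alpha(S).$$
   Context: $\mathcal{M}\subset\mathbb{R}^2$ is a simply-connected bounded open set, $c\in\mathbb{N}$, $c\ge 2$. $\Delta_c=\{p\in\mathbb{R}^c: p_j\ge 0\ \forall j,\ \sum_{j}p_j=1\}$ is the probability simplex. $H^1(\mathcal{M};\mathbb{R}^c)$ is the Sobolev space of vector-valued functions with components in $H^1(\mathcal{M})=W^{1,2}(\mathcal{M})$, and $H^1_0(\mathcal{M};\mathbb{R}^c)$ is the closure of the compactly supported smooth functions in it. $DS$ is the weak derivative (Jacobian) of $S$, $\|DS(x)\|$ its Frobenius norm and $\|S(x)\|$ the Euclidean norm. $\mathcal{D}^1(\mathcal{M})=\{S\in H^1(\mathcal{M};\mathbb{R}^c): S(x)\in\Delta_c\text{ for a.e. }x\in\mathcal{M}\}$. $g\in H^1(\mathcal{M};\mathbb{R}^c)$ is a fixed function prescribing simplex-valued boundary values in the trace sense, meaning that $g-h\in H_0^1(\mathcal{M};\mathbb{R}^c)$ for some $h\in\mathcal{D}^1(\mathcal{M})$. The feasible set is $$\mathcal{A}_g^1(\mathcal{M})=\{S\in\mathcal{D}^1(\mathcal{M}): S-g\in H_0^1(\mathcal{M};\mathbb{R}^c)\}.$$ *)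

theory Defs
  imports "HOL-Analysis.Analysis"
begin

text \<open>
  Elements of the function spaces below are total functions standing for representatives of
  a.e.-equivalence classes on \<open>M\<close>; every notion depends only on the values on \<open>M\<close>, up to null sets.
  Functions of class \<open>C\<^sup>k\<close> and test functions are the exception: they are honest functions on the
  whole space.
\<close>

primrec times_cont_differentiable ::
    "nat \<Rightarrow> ('a::real_normed_vector \<Rightarrow> 'b::real_normed_vector) \<Rightarrow> bool" where
  "times_cont_differentiable 0 f \<longleftrightarrow> continuous_on UNIV f"
| "times_cont_differentiable (Suc k) f \<longleftrightarrow>
     (\<forall>x. f differentiable (at x)) \<and>
     (\<forall>v. times_cont_differentiable k (\<lambda>x. frechet_derivative f (at x) v))"

definition smooth :: "('a::real_normed_vector \<Rightarrow> 'b::real_normed_vector) \<Rightarrow> bool" where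
  "smooth f \<longleftrightarrow> (\<forall>k. times_cont_differentiable k f)"

definition test_functions :: "'a::euclidean_space set \<Rightarrow> ('a \<Rightarrow> 'b::real_normed_vector) set" where
  "test_functions M =
     {\<phi>. smooth \<phi> \<and> compact (closure {x. \<phi> x \<noteq> 0}) \<and> closure {x. \<phi> x \<noteq> 0} \<subseteq> M}"

definition L2 :: "'a::euclidean_space set \<Rightarrow> ('a \<Rightarrow> real) set" where
  "L2 M = {f \<in> borel_measurable (lebesgue_on M). integrable (lebesgue_on M) (\<lambda>x. (f x)\<^sup>2)}"

definition locally_integrable :: "'a::euclidean_space set \<Rightarrow> ('a \<Rightarrow> real) \<Rightarrow> bool" where
  "locally_integrable M f \<longleftrightarrow> (\<forall>K. compact K \<and> K \<subseteq> M \<longrightarrow> integrable (lebesgue_on K) f)"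

definition has_weak_partial ::
    "(real^'n) set \<Rightarrow> 'n::finite \<Rightarrow> (real^'n \<Rightarrow> real) \<Rightarrow> (real^'n \<Rightarrow> real) \<Rightarrow> bool" where
  "has_weak_partial M j f f' \<longleftrightarrow>
     locally_integrable M f \<and> locally_integrable M f' \<and>
     (\<forall>\<phi>\<in>test_functions M.
        (\<integral>x. f x * frechet_derivative \<phi> (at x) (axis j 1) \<partial>lebesgue_on M) =
        - (\<integral>x. f' x * \<phi> x \<partial>lebesgue_on M))"

text \<open>
  For open \<open>M\<close> the weak partial derivative is unique up to a null set, so the choice made here is
  immaterial. The value is unspecified if no weak derivative exists.
\<close>

definition weak_partial ::
    "(real^'n) set \<Rightarrow> 'n::finite \<Rightarrow> (real^'n \<Rightarrow> real) \<Rightarrow> (real^'n \<Rightarrow> real)" where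
  "weak_partial M j f = (SOME f'. has_weak_partial M j f f')"

definition H1_scalar :: "(real^'n::finite) set \<Rightarrow> (real^'n \<Rightarrow> real) set" where
  "H1_scalar M = {f \<in> L2 M. \<forall>j. \<exists>f'\<in>L2 M. has_weak_partial M j f f'}"

definition H1 :: "(real^'n::finite) set \<Rightarrow> (real^'n \<Rightarrow> real^'c::finite) set" where
  "H1 M = {S. \<forall>i. (\<lambda>x. S x $ i) \<in> H1_scalar M}"

text \<open>
  The norm that the library puts on \<open>real^'n^'c\<close> (the Euclidean norm of the vector of the Euclidean
  norms of the rows) is the Frobenius norm.
\<close>

definition weak_jacobian ::
    "(real^'n::finite) set \<Rightarrow> (real^'n \<Rightarrow> real^'c::finite) \<Rightarrow> real^'n \<Rightarrow> real^'n^'c" where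
  "weak_jacobian M S x = (\<chi> i j. weak_partial M j (\<lambda>y. S y $ i) x)"

definition H1_norm :: "(real^'n::finite) set \<Rightarrow> (real^'n \<Rightarrow> real^'c::finite) \<Rightarrow> real" where
  "H1_norm M S =
     sqrt (\<integral>x. (norm (S x))\<^sup>2 + (norm (weak_jacobian M S x))\<^sup>2 \<partial>lebesgue_on M)"

text \<open>The closure of the test functions in \<open>H1 M\<close> with respect to \<open>H1_norm M\<close>.\<close>

definition H1_0 :: "(real^'n::finite) set \<Rightarrow> (real^'n \<Rightarrow> real^'c::finite) set" where
  "H1_0 M =
     {S \<in> H1 M. \<forall>\<epsilon>>0. \<exists>\<phi>\<in>test_functions M. H1_norm M (\<lambda>x. \<phi> x - S x) < \<epsilon>}"

definition prob_simplex :: "(real^'c::finite) set" where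
  "prob_simplex = {p. (\<forall>j. 0 \<le> p $ j) \<and> (\<Sum>j\<in>UNIV. p $ j) = 1}"

definition simplex_valued :: "(real^'n::finite) set \<Rightarrow> (real^'n \<Rightarrow> real^'c::finite) set" where
  "simplex_valued M = {S \<in> H1 M. AE x in lebesgue_on M. S x \<in> prob_simplex}"

definition feasible ::
    "(real^'n::finite) set \<Rightarrow> (real^'n \<Rightarrow> real^'c::finite) \<Rightarrow> (real^'n \<Rightarrow> real^'c) set" where
  "feasible M g = {S \<in> simplex_valued M. (\<lambda>x. S x - g x) \<in> H1_0 M}"

definition energy ::
    "(real^'n::finite) set \<Rightarrow> real \<Rightarrow> (real^'n \<Rightarrow> real^'c::finite) \<Rightarrow> real" where
  "energy M \<alpha> S =
     (\<integral>x. (norm (weak_jacobian M S x))\<^sup>2 - \<alpha> * (norm (S x))\<^sup>2 \<partial>lebesgue_on M)"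

end

theory Submission
  imports Defs "HOL-Complex_Analysis.Great_Picard" "HOL-Computational_Algebra.Polynomial"
begin

text \<open>
  Along a minimizing sequence the energies and the constraint \<open>S x \<in> prob_simplex\<close> bound the \<open>H\<^sup>1\<close> norm.
  Since all competitors differ from \<open>g\<close> by elements of \<open>H1_0 M\<close>, a Rellich argument gives a subsequence
  that is Cauchy in \<open>L\<^sup>2\<close>. The feasible set is convex, so the parallelogram law for midpoints,
  \<open>\<parallel>DS - DT\<parallel>\<^sup>2 = 2 E(S) + 2 E(T) - 4 E((S + T) / 2) + \<alpha> \<parallel>S - T\<parallel>\<^sup>2\<close> (in \<open>L\<^sup>2\<close> norms), together with
  \<open>E((S + T) / 2) \<ge> inf E\<close> upgrades this to a Cauchy sequence in \<open>H\<^sup>1\<close>. No weak compactness is needed: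
  the strong limit is feasible and the energy is continuous along it.

  Rellich compactness for test functions rests on two facts. Replacing \<open>\<phi>\<close> by its averages over balls of
  radius \<open>\<delta>\<close> changes it by at most \<open>\<delta> \<parallel>D\<phi>\<parallel>\<close> in \<open>L\<^sup>2\<close>, and on a bounded set these averages are
  controlled by finitely many of them.
\<close>

subsection \<open>Smooth functions and test functions\<close>

text \<open>The term -\<alpha> |S|^2 destroys convexity of the energy, but the defect at a midpoint
  is a multiple of the squared L2 distance, a quantity of lower order. Compactness in L2 is
  therefore the whole price of nonconvexity. The obstacle is the boundary: for a bounded open set
  with a rough boundary, \<open>H1 M\<close> need not embed compactly into L2. Elements of
  \<open>H1_0 M\<close> escape this, since test functions extend by zero to the whole space, where
  translation invariance holds and balls may leave \<open>M\<close> freely. This is why compactness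
  is only ever applied to differences with \<open>g\<close>. A second obstacle is formal:
  \<open>weak_partial\<close> is a choice, so identities between weak Jacobians hold only almost
  everywhere, and only once uniqueness of weak derivatives is known. Uniqueness needs a supply of
  test functions, hence the explicit construction of bumps.\<close>

lemma times_cont_differentiable_bounded_linear:
  assumes "bounded_linear L" and "times_cont_differentiable k f"
  shows "times_cont_differentiable k (\<lambda>x. L (f x))"
  using assms(2)
proof (induction k arbitrary: f)
  case 0
  then show ?case
    by (simp add: bounded_linear.continuous_on[OF assms(1)])
next
  case (Suc k)
  have D: "((\<lambda>x. L (f x)) has_derivative (\<lambda>v. L (frechet_derivative f (at x) v))) (at x)" for x
    using Suc.prems
    by (intro bounded_linear.has_derivative[OF assms(1)]) (simp add: frechet_derivative_works)
  have "frechet_derivative (\<lambda>x. L (f x)) (at x) = (\<lambda>v. L (frechet_derivative f (at x) v))" for x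
    using frechet_derivative_at[OF D] by simp
  with Suc D show ?case
    by (auto simp: differentiable_def)
qed

lemma times_cont_differentiable_add:
  assumes "times_cont_differentiable k f" and "times_cont_differentiable k g"
  shows "times_cont_differentiable k (\<lambda>x. f x + g x)"
  using assms
proof (induction k arbitrary: f g)
  case 0
  then show ?case
    by (simp add: continuous_on_add)
next
  case (Suc k)
  have D: "((\<lambda>x. f x + g x) has_derivative
      (\<lambda>v. frechet_derivative f (at x) v + frechet_derivative g (at x) v)) (at x)" for x
    using Suc.prems by (intro has_derivative_add) (simp_all add: frechet_derivative_works)
  have "frechet_derivative (\<lambda>x. f x + g x) (at x) =
      (\<lambda>v. frechet_derivative f (at x) v + frechet_derivative g (at x) v)" for x
    using frechet_derivative_at[OF D] by simp
  with Suc D show ?case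
    by (auto simp: differentiable_def)
qed

lemma smooth_bounded_linear:
  assumes "bounded_linear L" and "smooth f"
  shows "smooth (\<lambda>x. L (f x))"
  using assms times_cont_differentiable_bounded_linear unfolding smooth_def by blast

lemma smooth_add: "smooth f \<Longrightarrow> smooth g \<Longrightarrow> smooth (\<lambda>x. f x + g x)"
  using times_cont_differentiable_add unfolding smooth_def by blast

lemma smooth_continuous_on: "smooth f \<Longrightarrow> continuous_on UNIV f"
  unfolding smooth_def by (metis times_cont_differentiable.simps(1))

lemma smooth_differentiable: "smooth f \<Longrightarrow> f differentiable (at x)"
  unfolding smooth_def by (metis times_cont_differentiable.simps(2))

lemma smooth_has_derivative: "smooth f \<Longrightarrow> (f has_derivative frechet_derivative f (at x)) (at x)"
  using smooth_differentiable by (simp add: frechet_derivative_works)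

lemma smooth_frechet_derivative:
  "smooth f \<Longrightarrow> smooth (\<lambda>x. frechet_derivative f (at x) v)"
  unfolding smooth_def by (metis times_cont_differentiable.simps(2))

lemma test_functionsD:
  assumes "\<phi> \<in> test_functions M"
  shows "smooth \<phi>" and "compact (closure {x. \<phi> x \<noteq> 0})" and "closure {x. \<phi> x \<noteq> 0} \<subseteq> M"
  using assms by (auto simp: test_functions_def)

lemma not_in_closure_support: "x \<notin> closure {x. \<phi> x \<noteq> 0} \<Longrightarrow> \<phi> x = 0"
  using closure_subset[of "{x. \<phi> x \<noteq> 0}"] by auto

text \<open>Any compact subset of \<open>M\<close> outside which \<open>\<phi>\<close> vanishes can
  serve as witness: the closed support is a closed subset of it, hence itself compact.\<close>

lemma test_functionsI:
  assumes "smooth \<phi>" and "compact K" and "K \<subseteq> M" and "\<And>x. x \<notin> K \<Longrightarrow> \<phi> x = 0"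
  shows "\<phi> \<in> test_functions M"
proof -
  have "closure {x. \<phi> x \<noteq> 0} \<subseteq> K"
    using assms by (intro closure_minimal compact_imp_closed) auto
  moreover from this have "closure {x. \<phi> x \<noteq> 0} \<subseteq> M"
    using assms(3) by (rule order_trans)
  moreover have "compact (K \<inter> closure {x. \<phi> x \<noteq> 0})"
    using assms(2) closed_closure by (rule compact_Int_closed)
  ultimately show ?thesis
    using assms(1) by (simp add: test_functions_def Int_absorb1)
qed

lemma test_functions_bounded_linear:
  assumes "bounded_linear L" and \<phi>: "\<phi> \<in> test_functions M"
  shows "(\<lambda>x. L (\<phi> x)) \<in> test_functions M"
proof (rule test_functionsI[OF _ test_functionsD(2,3)[OF \<phi>]])
  show "smooth (\<lambda>x. L (\<phi> x))"
    by (rule smooth_bounded_linear[OF assms(1) test_functionsD(1)[OF \<phi>]])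
  show "L (\<phi> x) = 0" if "x \<notin> closure {x. \<phi> x \<noteq> 0}" for x
    using not_in_closure_support[OF that] linear_0[OF bounded_linear.linear[OF assms(1)]]
    by simp
qed

lemma test_functions_add:
  assumes \<phi>: "\<phi> \<in> test_functions M" and \<psi>: "\<psi> \<in> test_functions M"
  shows "(\<lambda>x. \<phi> x + \<psi> x) \<in> test_functions M"
proof (rule test_functionsI)
  show "smooth (\<lambda>x. \<phi> x + \<psi> x)"
    by (rule smooth_add[OF test_functionsD(1)[OF \<phi>] test_functionsD(1)[OF \<psi>]])
  show "compact (closure {x. \<phi> x \<noteq> 0} \<union> closure {x. \<psi> x \<noteq> 0})"
    by (rule compact_Un[OF test_functionsD(2)[OF \<phi>] test_functionsD(2)[OF \<psi>]])
  show "closure {x. \<phi> x \<noteq> 0} \<union> closure {x. \<psi> x \<noteq> 0} \<subseteq> M"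
    by (rule Un_least[OF test_functionsD(3)[OF \<phi>] test_functionsD(3)[OF \<psi>]])
  show "\<phi> x + \<psi> x = 0" if "x \<notin> closure {x. \<phi> x \<noteq> 0} \<union> closure {x. \<psi> x \<noteq> 0}" for x
    using that not_in_closure_support[of x \<phi>] not_in_closure_support[of x \<psi>] by simp
qed

lemma test_functions_lincomb:
  assumes "\<phi> \<in> test_functions M" and "\<psi> \<in> test_functions M"
  shows "(\<lambda>x. a *\<^sub>R \<phi> x + b *\<^sub>R \<psi> x) \<in> test_functions M"
  by (intro test_functions_add test_functions_bounded_linear[OF bounded_linear_scaleR_right] assms)

text \<open>The complement of the closed support is open, so \<open>\<phi>\<close> agrees with the
  zero function near each of its points. One compact set thus serves for the function and for all
  its directional derivatives.\<close>

lemma test_functions_support: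
  assumes "\<phi> \<in> test_functions M"
  obtains K where "compact K" and "K \<subseteq> M" and "\<And>x. x \<notin> K \<Longrightarrow> \<phi> x = 0"
    and "\<And>x v. x \<notin> K \<Longrightarrow> frechet_derivative \<phi> (at x) v = 0"
proof (rule that[OF test_functionsD(2,3)[OF assms]])
  let ?K = "closure {x. \<phi> x \<noteq> 0}"
  show "\<phi> x = 0" if "x \<notin> ?K" for x
    by (rule not_in_closure_support[OF that])
  show "frechet_derivative \<phi> (at x) v = 0" if "x \<notin> ?K" for x v
  proof -
    have "((\<lambda>x. 0) has_derivative (\<lambda>v. 0)) (at x)" "open (- ?K)" "x \<in> - ?K"
      using that open_Compl[OF closed_closure] by simp_all
    moreover have "0 = \<phi> y" if "y \<in> - ?K" for y
      by (rule sym, rule not_in_closure_support) (rule ComplD[OF that])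
    ultimately have "(\<phi> has_derivative (\<lambda>v. 0)) (at x)"
      by (rule has_derivative_transform_within_open)
    then show ?thesis
      by (metis frechet_derivative_at)
  qed
qed

lemma test_functions_frechet_derivative:
  assumes \<phi>: "\<phi> \<in> test_functions M"
  shows "(\<lambda>x. frechet_derivative \<phi> (at x) v) \<in> test_functions M"
proof (rule test_functions_support[OF \<phi>])
  fix K assume K: "compact K" "K \<subseteq> M" and "\<And>x v. x \<notin> K \<Longrightarrow> frechet_derivative \<phi> (at x) v = 0"
  then show ?thesis
    by (intro test_functionsI[OF smooth_frechet_derivative[OF test_functionsD(1)[OF \<phi>]] K])
qed

subsection \<open>Bump functions\<close>

text \<open>With \<open>p = 1\<close> this is the classical smooth function exp(-1/t), extended by
  zero. The polynomial in 1/t makes the family closed under differentiation, so all orders can be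
  treated at once.\<close>

definition flat :: "real poly \<Rightarrow> real \<Rightarrow> real" where
  "flat p t = (if t > 0 then poly p (1/t) * exp (- (1/t)) else 0)"

lemma poly_times_exp_minus_tendsto_0: "((\<lambda>s::real. poly p s * exp (- s)) \<longlongrightarrow> 0) at_top"
proof -
  have "((\<lambda>s::real. \<Sum>i\<le>degree p. coeff p i * (s ^ i / exp s)) \<longlongrightarrow> (\<Sum>i\<le>degree p. coeff p i * 0)) at_top"
    by (intro tendsto_intros tendsto_power_div_exp_0)
  then show ?thesis
    by (simp add: poly_altdef sum_distrib_right exp_minus divide_inverse mult.assoc)
qed

text \<open>For t > 0 the product and chain rules give (1/t)^2 (p - p')(1/t) exp(-1/t), and
  \<open>monom 1 2\<close> is the factor X^2. The only delicate point is t = 0, where exponential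
  decay beats every power of 1/t.\<close>

lemma flat_has_derivative:
  "(flat p has_real_derivative flat (monom 1 2 * (p - pderiv p)) t) (at t)"
proof -
  consider "t > 0" | "t < 0" | "t = 0" by linarith
  then show ?thesis
  proof cases
    case 1
    have I: "((\<lambda>t. 1/t) has_real_derivative - (1/t)\<^sup>2) (at t)"
      using 1 by (auto intro!: derivative_eq_intros simp: power2_eq_square)
    have E: "((\<lambda>t. exp (- (1/t))) has_real_derivative exp (- (1/t)) * (1/t)\<^sup>2) (at t)"
      using DERIV_chain2[OF DERIV_exp DERIV_minus[OF I]] by simp
    have "((\<lambda>t. poly p (1/t) * exp (- (1/t))) has_real_derivative
        poly (pderiv p) (1/t) * - (1/t)\<^sup>2 * exp (- (1/t)) +
        exp (- (1/t)) * (1/t)\<^sup>2 * poly p (1/t)) (at t)"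
      by (rule DERIV_mult[OF DERIV_chain2[OF poly_DERIV I] E])
    also have "poly (pderiv p) (1/t) * - (1/t)\<^sup>2 * exp (- (1/t)) +
        exp (- (1/t)) * (1/t)\<^sup>2 * poly p (1/t) = flat (monom 1 2 * (p - pderiv p)) t"
      using 1 by (simp add: flat_def poly_monom algebra_simps)
    finally have "((\<lambda>t. poly p (1/t) * exp (- (1/t))) has_real_derivative
        flat (monom 1 2 * (p - pderiv p)) t) (at t)" .
    then show ?thesis
      by (rule has_field_derivative_transform_within_open[where S = "{0<..}"])
        (use 1 in \<open>auto simp: flat_def\<close>)
  next
    case 2
    have "((\<lambda>t. 0) has_real_derivative flat (monom 1 2 * (p - pderiv p)) t) (at t)"
      using 2 by (simp add: flat_def)
    then show ?thesis
      by (rule has_field_derivative_transform_within_open[where S = "{..<0}"])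
        (use 2 in \<open>auto simp: flat_def\<close>)
  next
    case 3
    \<comment> \<open>With s = 1/h the quotient \<open>flat p h / h\<close> becomes s p(s) exp(-s);
      the extra factor s is the reason for \<open>pCons 0 p\<close>.\<close>
    have "((\<lambda>s. poly (pCons 0 p) s * exp (- s)) \<longlongrightarrow> 0) at_top"
      by (rule poly_times_exp_minus_tendsto_0)
    from filterlim_compose[OF this filterlim_inverse_at_top_right]
    have R: "((\<lambda>h. flat p h / h) \<longlongrightarrow> 0) (at_right 0)"
      by (rule Lim_transform_eventually)
        (auto simp: eventually_at_right_less flat_def field_simps
          intro!: eventually_mono[OF eventually_at_right_less[of 0]])
    have L: "((\<lambda>h. flat p h / h) \<longlongrightarrow> 0) (at_left 0)"
      by (rule Lim_transform_eventually[OF tendsto_const])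
        (auto simp: flat_def eventually_at_filter)
    have "((\<lambda>h. flat p h / h) \<longlongrightarrow> 0) (at 0)"
      using L R filterlim_split_at by blast
    then show ?thesis
      using 3 by (simp add: DERIV_def flat_def)
  qed
qed

text \<open>A class made to be stable under directional differentiation. Smoothness of the bumps,
  which are products of composed functions, then follows without product and chain rules for
  \<open>times_cont_differentiable\<close> at every order.\<close>

inductive flat_algebra :: "(real^'n \<Rightarrow> real) \<Rightarrow> bool" where
  const: "flat_algebra (\<lambda>x. c)"
| flat: "flat_algebra (\<lambda>x. flat p (a * x $ i + b))"
| add: "flat_algebra f \<Longrightarrow> flat_algebra g \<Longrightarrow> flat_algebra (\<lambda>x. f x + g x)"
| mult: "flat_algebra f \<Longrightarrow> flat_algebra g \<Longrightarrow> flat_algebra (\<lambda>x. f x * g x)"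

text \<open>For a fixed direction \<open>v\<close> the chain rule factor \<open>a * v $ i\<close> is
  a constant of the algebra, and the product rule stays inside it.\<close>

lemma flat_algebra_derivative:
  fixes f :: "real^'n::finite \<Rightarrow> real"
  assumes "flat_algebra f"
  shows "\<exists>f'. (\<forall>x. (f has_derivative f' x) (at x)) \<and> (\<forall>v. flat_algebra (\<lambda>x. f' x v))"
  using assms
proof induction
  case (const c)
  show ?case
    by (rule exI[of _ "\<lambda>x v. 0"]) (auto intro: flat_algebra.const)
next
  case (flat p a i b)
  let ?q = "monom 1 2 * (p - pderiv p)"
  have "((\<lambda>x::real^'n. flat p (a * x $ i + b)) has_derivative
      (\<lambda>v. (a * v $ i) * flat ?q (a * x $ i + b))) (at x)" for x
  proof -
    have L: "((\<lambda>x::real^'n. a * x $ i + b) has_derivative (\<lambda>v. a * v $ i)) (at x)"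
      by (auto intro!: derivative_eq_intros bounded_linear_imp_has_derivative bounded_linear_vec_nth)
    have "(flat p has_derivative (\<lambda>s. flat ?q (a * x $ i + b) * s)) (at (a * x $ i + b))"
      using flat_has_derivative has_field_derivative_def by blast
    from has_derivative_compose[OF L this] show ?thesis
      by (simp only: mult.commute[of "flat ?q (a * x $ i + b)"])
  qed
  moreover have "flat_algebra (\<lambda>x. (a * v $ i) * flat ?q (a * x $ i + b))" for v :: "real^'n"
    by (intro flat_algebra.intros)
  ultimately show ?case
    by (intro exI[of _ "\<lambda>x v. (a * v $ i) * flat ?q (a * x $ i + b)"]) auto
next
  case (add f g)
  then obtain f' g' where
    "\<forall>x. (f has_derivative f' x) (at x)" "\<forall>v. flat_algebra (\<lambda>x. f' x v)"
    "\<forall>x. (g has_derivative g' x) (at x)" "\<forall>v. flat_algebra (\<lambda>x. g' x v)"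
    by blast
  then show ?case
    by (intro exI[of _ "\<lambda>x v. f' x v + g' x v"]) (auto intro: flat_algebra.intros has_derivative_add)
next
  case (mult f g)
  then obtain f' g' where
    "\<forall>x. (f has_derivative f' x) (at x)" "\<forall>v. flat_algebra (\<lambda>x. f' x v)"
    "\<forall>x. (g has_derivative g' x) (at x)" "\<forall>v. flat_algebra (\<lambda>x. g' x v)"
    by blast
  moreover from this mult.hyps
  have "flat_algebra (\<lambda>x. f x * g' x v + f' x v * g x)" for v
    by (intro flat_algebra.add flat_algebra.mult) auto
  ultimately show ?case
    by (intro exI[of _ "\<lambda>x v. f x * g' x v + f' x v * g x"]) (auto intro: has_derivative_mult)
qed

lemma flat_algebra_smooth:
  fixes f :: "real^'n::finite \<Rightarrow> real"
  assumes "flat_algebra f"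
  shows "smooth f"
proof -
  have "times_cont_differentiable k f" if "flat_algebra f" for k and f :: "real^'n::finite \<Rightarrow> real"
    using that
  proof (induction k arbitrary: f)
    case 0
    then show ?case
      using flat_algebra_derivative[OF 0]
      by (metis continuous_at_imp_continuous_on has_derivative_continuous
          times_cont_differentiable.simps(1))
  next
    case (Suc k)
    from flat_algebra_derivative[OF Suc.prems] obtain f' where
      f': "\<And>x. (f has_derivative f' x) (at x)" "\<And>v. flat_algebra (\<lambda>x. f' x v)"
      by blast
    then have "frechet_derivative f (at x) = f' x" for x
      by (metis frechet_derivative_at)
    with Suc f' show ?case
      by (auto simp: differentiable_def)
  qed
  with assms show ?thesis
    by (simp add: smooth_def)
qed

text \<open>As \<open>k\<close> grows these bumps converge boundedly to the indicator of the open box.\<close>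

definition box_bump :: "real^'n \<Rightarrow> real^'n \<Rightarrow> nat \<Rightarrow> real^'n::finite \<Rightarrow> real" where
  "box_bump a b k x =
     (\<Prod>i\<in>UNIV. flat 1 (real (Suc k) * (x $ i - a $ i)) * flat 1 (real (Suc k) * (b $ i - x $ i)))"

lemma flat_1_bounds: "0 \<le> flat 1 t" "flat 1 t \<le> 1"
  by (auto simp: flat_def)

lemma flat_algebra_prod:
  assumes "\<And>i. i \<in> I \<Longrightarrow> flat_algebra (f i)"
  shows "flat_algebra (\<lambda>x. \<Prod>i\<in>I. f i x)"
  using assms
proof (induction I rule: infinite_finite_induct)
  case (insert j J)
  then have "flat_algebra (\<lambda>x. f j x * (\<Prod>i\<in>J. f i x))"
    by (intro flat_algebra.mult) auto
  with insert show ?case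
    by simp
qed (simp_all add: flat_algebra.const)

lemma box_bump_smooth: "smooth (box_bump a b k)"
proof -
  have "flat_algebra (\<lambda>x::real^'a. flat 1 (c * (x $ i - d)))" for c i d
    using flat_algebra.flat[of 1 c i "- c * d"] by (simp add: algebra_simps)
  moreover have "flat_algebra (\<lambda>x::real^'a. flat 1 (c * (d - x $ i)))" for c i d
    using flat_algebra.flat[of 1 "- c" i "c * d"] by (simp add: algebra_simps)
  ultimately show ?thesis
    unfolding box_bump_def by (intro flat_algebra_smooth flat_algebra_prod flat_algebra.mult)
qed

lemma box_bump_bounds: "0 \<le> box_bump a b k x" "box_bump a b k x \<le> 1"
proof -
  have *: "0 \<le> flat 1 s * flat 1 t \<and> flat 1 s * flat 1 t \<le> 1" for s t
    by (intro conjI mult_nonneg_nonneg mult_le_one flat_1_bounds)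
  show "0 \<le> box_bump a b k x"
    unfolding box_bump_def by (rule prod_nonneg) (rule conjunct1[OF *])
  show "box_bump a b k x \<le> 1"
    unfolding box_bump_def by (rule prod_le_1) (rule *)
qed

lemma box_bump_outside: "x \<notin> box a b \<Longrightarrow> box_bump a b k x = 0"
proof -
  assume "x \<notin> box a b"
  then obtain i where "\<not> (a $ i < x $ i \<and> x $ i < b $ i)"
    by (auto simp: mem_box_cart)
  then have "flat 1 (real (Suc k) * (x $ i - a $ i)) * flat 1 (real (Suc k) * (b $ i - x $ i)) = 0"
    by (auto simp: flat_def zero_less_mult_iff)
  then show ?thesis
    unfolding box_bump_def by (intro prod_zero) auto
qed

lemma flat_1_tendsto:
  assumes "s > 0"
  shows "(\<lambda>k. flat 1 (real (Suc k) * s)) \<longlonglongrightarrow> 1"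
proof -
  have "(\<lambda>k. exp (- (inverse (real (Suc k)) * inverse s))) \<longlonglongrightarrow> exp (- (0 * inverse s))"
    by (intro tendsto_intros LIMSEQ_inverse_real_of_nat)
  moreover have "flat 1 (real (Suc k) * s) = exp (- (inverse (real (Suc k)) * inverse s))" for k
    using assms by (simp add: flat_def divide_inverse del: of_nat_Suc)
  ultimately show ?thesis
    by simp
qed

lemma box_bump_tendsto: "(\<lambda>k. box_bump a b k x) \<longlonglongrightarrow> indicator (box a b) x"
proof (cases "x \<in> box a b")
  case True
  then have "(\<lambda>k. box_bump a b k x) \<longlonglongrightarrow> (\<Prod>i\<in>(UNIV::'a set). 1 * 1)"
    unfolding box_bump_def by (intro tendsto_intros flat_1_tendsto) (auto simp: mem_box_cart)
  with True show ?thesis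
    by simp
qed (simp add: box_bump_outside)

text \<open>The bump vanishes off the open box, but its closed support may reach the boundary; hence
  the closed box has to lie in \<open>M\<close>.\<close>

lemma box_bump_test_function:
  assumes "cbox a b \<subseteq> M"
  shows "box_bump a b k \<in> test_functions M"
proof (rule test_functionsI[OF box_bump_smooth compact_cbox assms])
  show "box_bump a b k x = 0" if "x \<notin> cbox a b" for x
    using that box_subset_cbox[of a b] by (intro box_bump_outside) auto
qed

subsection \<open>Weak derivatives\<close>

lemma integrable_lebesgue_on_subset:
  fixes f :: "'a::euclidean_space \<Rightarrow> 'b::{banach, second_countable_topology}"
  assumes "integrable (lebesgue_on A) f" and "B \<subseteq> A" and "A \<in> sets lebesgue" and "B \<in> sets lebesgue"
  shows "integrable (lebesgue_on B) f"
  using assms set_integrable_subset[of lebesgue A f B]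
  by (simp add: integrable_restrict_space set_integrable_def)

lemma integrable_lebesgue_on_support:
  fixes g :: "'a::euclidean_space \<Rightarrow> 'b::{banach, second_countable_topology}"
  assumes "M \<in> sets lebesgue" and "\<And>x. x \<notin> M \<Longrightarrow> g x = 0"
  shows "integrable (lebesgue_on M) g \<longleftrightarrow> integrable lebesgue g"
    and "integral\<^sup>L (lebesgue_on M) g = integral\<^sup>L lebesgue g"
proof -
  have *: "(\<lambda>x. indicator M x *\<^sub>R g x) = g"
  proof
    show "indicator M x *\<^sub>R g x = g x" for x
      by (cases "x \<in> M") (simp_all add: assms(2)[of x])
  qed
  show "integrable (lebesgue_on M) g \<longleftrightarrow> integrable lebesgue g"
    and "integral\<^sup>L (lebesgue_on M) g = integral\<^sup>L lebesgue g"
    using integrable_restrict_space[of M lebesgue g] integral_restrict_space[of M lebesgue g] assms(1)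
    unfolding * by simp_all
qed

text \<open>On \<open>K\<close> the factor \<open>\<phi>\<close> is bounded and \<open>f\<close> is
  integrable. Off \<open>K\<close> the product is zero, so integrability passes from
  \<open>K\<close> to the whole space and from there to \<open>M\<close>.\<close>

lemma locally_integrable_times_continuous:
  fixes \<phi> :: "'a::euclidean_space \<Rightarrow> real"
  assumes "M \<in> sets lebesgue" and f: "locally_integrable M f" and K: "compact K" "K \<subseteq> M"
    and \<phi>: "continuous_on UNIV \<phi>" and zero: "\<And>x. x \<notin> K \<Longrightarrow> \<phi> x = 0"
  shows "integrable (lebesgue_on M) (\<lambda>x. f x * \<phi> x)"
proof -
  have KL: "K \<in> sets lebesgue"
    using K(1) by (simp add: lmeasurable_compact fmeasurableD)
  have f': "integrable (lebesgue_on K) f"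
    using f K by (auto simp: locally_integrable_def)
  have \<phi>': "continuous_on K \<phi>"
    using \<phi> by (rule continuous_on_subset) simp
  then have m: "\<phi> \<in> borel_measurable (lebesgue_on K)"
    using KL by (rule continuous_imp_measurable_on_sets_lebesgue)
  obtain B where B: "\<And>x. x \<in> K \<Longrightarrow> norm (\<phi> x) \<le> B"
    using compact_imp_bounded[OF compact_continuous_image[OF \<phi>' K(1)]]
    by (auto simp: bounded_iff)
  have "integrable (lebesgue_on K) (\<lambda>x. f x * \<phi> x)"
  proof (rule Bochner_Integration.integrable_bound)
    show "integrable (lebesgue_on K) (\<lambda>x. B * f x)"
      using f' by simp
    show "(\<lambda>x. f x * \<phi> x) \<in> borel_measurable (lebesgue_on K)"
      using f' m by (intro borel_measurable_times) auto
    show "AE x in lebesgue_on K. norm (f x * \<phi> x) \<le> norm (B * f x)"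
    proof (intro AE_I2)
      fix x assume "x \<in> space (lebesgue_on K)"
      then have "\<bar>\<phi> x\<bar> \<le> \<bar>B\<bar>"
        using B[of x] by auto
      then show "norm (f x * \<phi> x) \<le> norm (B * f x)"
        by (simp add: abs_mult mult_left_mono mult.commute[of _ "\<bar>f x\<bar>"])
    qed
  qed
  moreover have "f x * \<phi> x = 0" if "x \<notin> K" for x
    using zero[OF that] by simp
  moreover have "f x * \<phi> x = 0" if "x \<notin> M" for x
    using zero[of x] that K by auto
  ultimately show ?thesis
    using integrable_lebesgue_on_support(1)[OF KL, of "\<lambda>x. f x * \<phi> x"]
      integrable_lebesgue_on_support(1)[OF assms(1), of "\<lambda>x. f x * \<phi> x"] by blast
qed

lemma locally_integrable_times_test_function:
  fixes \<phi> :: "'a::euclidean_space \<Rightarrow> real"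
  assumes "M \<in> sets lebesgue" and "locally_integrable M f" and \<phi>: "\<phi> \<in> test_functions M"
  shows "integrable (lebesgue_on M) (\<lambda>x. f x * \<phi> x)"
  by (rule locally_integrable_times_continuous[OF assms(1,2) test_functionsD(2,3)[OF \<phi>]
        smooth_continuous_on[OF test_functionsD(1)[OF \<phi>]] not_in_closure_support[of _ \<phi>]])

lemma locally_integrable_lincomb:
  assumes "locally_integrable M f" and "locally_integrable M g"
  shows "locally_integrable M (\<lambda>x. a * f x + b * g x)"
  using assms by (simp add: locally_integrable_def)

text \<open>
  Testing with the bumps shows that \<open>f\<close> has mean zero over every small box, and the averages over
  shrinking boxes recover \<open>f\<close> almost everywhere.
\<close>

lemma fundamental_lemma_calculus_of_variations:
  fixes f :: "real^'n::finite \<Rightarrow> real"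
  assumes M: "open M" and f: "locally_integrable M f"
    and zero: "\<And>\<phi>. \<phi> \<in> test_functions M \<Longrightarrow> (\<integral>x. f x * \<phi> x \<partial>lebesgue_on M) = 0"
  shows "AE x in lebesgue_on M. f x = 0"
proof -
  have Ms: "M \<in> sets lebesgue"
    using M by simp
  have box0: "integral (cbox a b) f = 0" if ab: "cbox a b \<subseteq> M" for a b
  proof -
    have fi: "integrable (lebesgue_on (cbox a b)) f"
      using f ab by (auto simp: locally_integrable_def)
    let ?w = "\<lambda>x. indicator (cbox a b) x * \<bar>f x\<bar>"
    have w: "integrable lebesgue ?w"
      using integrable_restrict_space[of "cbox a b" lebesgue "\<lambda>x. \<bar>f x\<bar>"] fi by simp
    have fm: "(\<lambda>x. indicator (cbox a b) x * f x) \<in> borel_measurable lebesgue"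
      using integrable_restrict_space[of "cbox a b" lebesgue f] fi by simp
    \<comment> \<open>Only the restriction of \<open>f\<close> to compact subsets of
      \<open>M\<close> is known to be measurable. Inserting the indicator of the closed box changes
      nothing, because the bump vanishes off the open box, and it yields a factor measurable on the
      whole space.\<close>
    have eq: "f x * box_bump a b k x = (indicator (cbox a b) x * f x) * box_bump a b k x" for k x
      using box_bump_outside[of x a b k] box_subset_cbox[of a b] by (auto simp: indicator_def)
    have bm: "box_bump a b k \<in> borel_measurable lebesgue" for k
      using continuous_imp_measurable_on_sets_lebesgue[OF smooth_continuous_on[OF box_bump_smooth]]
      by (simp add: lebesgue_on_UNIV_eq)
    have "(\<lambda>k. \<integral>x. f x * box_bump a b k x \<partial>lebesgue) \<longlonglongrightarrow>
        (\<integral>x. f x * indicator (box a b) x \<partial>lebesgue)"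
    proof (rule integral_dominated_convergence[OF _ _ w])
      show "(\<lambda>x. f x * indicator (box a b) x) \<in> borel_measurable lebesgue"
      proof -
        have "(\<lambda>x. f x * indicator (box a b) x) =
            (\<lambda>x. (indicator (cbox a b) x * f x) * indicator (box a b) x)"
          using box_subset_cbox[of a b] by (auto simp: indicator_def fun_eq_iff)
        also have "\<dots> \<in> borel_measurable lebesgue"
          using fm by (rule borel_measurable_times) (simp add: borel_measurable_indicator)
        finally show ?thesis .
      qed
      show "(\<lambda>x. f x * box_bump a b k x) \<in> borel_measurable lebesgue" for k
        unfolding eq using fm bm by (rule borel_measurable_times)
      show "AE x in lebesgue. (\<lambda>k. f x * box_bump a b k x) \<longlonglongrightarrow> f x * indicator (box a b) x"
        by (intro AE_I2 tendsto_mult_left box_bump_tendsto)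
      show "AE x in lebesgue. norm (f x * box_bump a b k x) \<le> ?w x" for k
        unfolding eq using box_bump_bounds[of a b k]
        by (intro AE_I2) (simp add: abs_mult mult_left_le indicator_def)
    qed
    moreover have "(\<integral>x. f x * box_bump a b k x \<partial>lebesgue) = 0" for k
    proof -
      have "f x * box_bump a b k x = 0" if "x \<notin> M" for x
        using box_bump_outside[of x a b k] box_subset_cbox[of a b] that ab by auto
      then show ?thesis
        using integrable_lebesgue_on_support(2)[OF Ms, of "\<lambda>x. f x * box_bump a b k x"]
          zero[OF box_bump_test_function[OF ab, of k]] by simp
    qed
    ultimately have "(\<integral>x. f x * indicator (box a b) x \<partial>lebesgue) = 0"
      by (simp add: LIMSEQ_const_iff)
    moreover have "integral\<^sup>L (lebesgue_on (box a b)) f = (\<integral>x. f x * indicator (box a b) x \<partial>lebesgue)"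
      using integral_restrict_space[of "box a b" lebesgue f] by (simp add: mult.commute)
    moreover have "integrable (lebesgue_on (box a b)) f"
      using fi box_subset_cbox[of a b] by (rule integrable_lebesgue_on_subset) simp_all
    ultimately have "integral (box a b) f = 0"
      by (simp add: lebesgue_integral_eq_integral)
    then show ?thesis
      by (simp add: integral_open_interval)
  qed
  have null_box: "negligible {x \<in> cbox a b. f x \<noteq> 0}" if ab: "cbox a b \<subseteq> M" for a b
  proof -
    \<comment> \<open>The differentiation theorem applied below asks for integrability on every box,
      so \<open>f\<close> is cut off outside \<open>cbox a b\<close>.\<close>
    define F where "F x = (if x \<in> cbox a b then f x else 0)" for x
    have "integrable (lebesgue_on (cbox a b)) f"
      using f ab by (auto simp: locally_integrable_def)
    then have "f integrable_on cbox a b"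
      by (simp add: integrable_on_lebesgue_on)
    then have "F integrable_on UNIV"
      unfolding F_def by (simp add: integrable_restrict_UNIV)
    then have "F integrable_on cbox c d" for c d
      by (rule integrable_on_subcbox) simp
    from integrable_ccontinuous_explicit[OF this] obtain N where N: "negligible N"
      "\<And>x e. \<lbrakk>x \<notin> N; 0 < e\<rbrakk> \<Longrightarrow> \<exists>d>0. \<forall>h. 0 < h \<and> h < d \<longrightarrow>
          norm (integral (cbox x (x + h *\<^sub>R One)) F /\<^sub>R h ^ DIM(real^'n) - F x) < e"
      by blast
    have "f x = 0" if x: "x \<in> box a b" "x \<notin> N" for x
    proof (rule ccontr)
      assume "f x \<noteq> 0"
      then obtain d where d: "d > 0" "\<And>h. 0 < h \<and> h < d \<Longrightarrow>
          norm (integral (cbox x (x + h *\<^sub>R One)) F /\<^sub>R h ^ DIM(real^'n) - F x) < \<bar>f x\<bar>"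
        using N(2)[OF x(2), of "\<bar>f x\<bar>"] by auto
      obtain r where r: "r > 0" "ball x r \<subseteq> box a b"
        using open_contains_ball[of "box a b"] x(1) open_box by blast
      \<comment> \<open>Small enough for the box of side \<open>h\<close> with corner
        \<open>x\<close> to stay inside \<open>ball x r\<close>: its diagonal has length h |One|.
        The \<open>+ 1\<close> keeps the denominator positive and makes the inclusion
        strict.\<close>
      define h where "h = min (d/2) (r / (2 * norm (One::real^'n) + 1))"
      have h: "h > 0" "h < d" "h * (2 * norm (One::real^'n) + 1) \<le> r"
      proof -
        have p: "2 * norm (One::real^'n) + 1 > 0"
          using norm_ge_zero[of "One::real^'n"] by linarith
        show "h > 0" "h < d"
          using d(1) r(1) p by (auto simp: h_def)
        have "h \<le> r / (2 * norm (One::real^'n) + 1)"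
          by (simp add: h_def)
        then show "h * (2 * norm (One::real^'n) + 1) \<le> r"
          using p by (simp add: pos_le_divide_eq)
      qed
      have sub: "cbox x (x + h *\<^sub>R One) \<subseteq> ball x r"
      proof
        fix y assume y: "y \<in> cbox x (x + h *\<^sub>R One)"
        have "norm (y - x) \<le> norm (h *\<^sub>R (One::real^'n))"
          using y by (intro norm_le_componentwise) (auto simp: mem_box algebra_simps inner_add_left)
        also have "\<dots> < r"
        proof -
          have "h * (2 * norm (One::real^'n) + 1) = 2 * (h * norm (One::real^'n)) + h"
            by (simp add: distrib_left)
          moreover have "h * norm (One::real^'n) \<ge> 0"
            using h(1) by simp
          ultimately show ?thesis
            using h(1,3) unfolding norm_scaleR abs_of_pos[OF h(1)] by linarith
        qed
        finally show "y \<in> ball x r"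
          by (simp add: dist_norm norm_minus_commute)
      qed
      then have "cbox x (x + h *\<^sub>R One) \<subseteq> cbox a b"
        using r(2) box_subset_cbox[of a b] by blast
      then have "integral (cbox x (x + h *\<^sub>R One)) F = integral (cbox x (x + h *\<^sub>R One)) f"
        by (intro Henstock_Kurzweil_Integration.integral_cong) (auto simp: F_def)
      also have "\<dots> = 0"
        using \<open>cbox x (x + h *\<^sub>R One) \<subseteq> cbox a b\<close> ab by (intro box0) auto
      finally have "norm (0 - F x) < \<bar>f x\<bar>"
        using d(2)[of h] h by simp
      then show False
        using x(1) box_subset_cbox[of a b] by (auto simp: F_def)
    qed
    \<comment> \<open>The small boxes fit only around points of the open box; the remaining faces
      are negligible.\<close>
    then have "{x \<in> cbox a b. f x \<noteq> 0} \<subseteq> N \<union> (cbox a b - box a b)"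
      by blast
    then show ?thesis
      using N(1) negligible_frontier_interval negligible_subset negligible_Un by blast
  qed
  \<comment> \<open>Countability of the cover by closed boxes lets the null sets of the individual
    boxes add up to one null set.\<close>
  obtain \<D> where \<D>: "countable \<D>" "\<D> \<subseteq> Pow M" "\<And>X. X \<in> \<D> \<Longrightarrow> \<exists>a b. X = cbox a b" "\<Union>\<D> = M"
    using open_countable_Union_open_cbox[OF M] by blast
  have "negligible (\<Union>X\<in>\<D>. {x \<in> X. f x \<noteq> 0})"
  proof (rule negligible_countable_Union)
    show "countable ((\<lambda>X. {x \<in> X. f x \<noteq> 0}) ` \<D>)"
      using \<D>(1) by simp
    fix S assume "S \<in> (\<lambda>X. {x \<in> X. f x \<noteq> 0}) ` \<D>"
    then obtain X where X: "X \<in> \<D>" "S = {x \<in> X. f x \<noteq> 0}"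
      by blast
    with \<D>(2,3) obtain a b where "X = cbox a b" "cbox a b \<subseteq> M"
      by blast
    with X null_box show "negligible S"
      by simp
  qed
  then have "negligible {x \<in> M. f x \<noteq> 0}"
    using \<D>(4) by (rule_tac negligible_subset) auto
  then have "AE x in lebesgue. x \<notin> {x \<in> M. f x \<noteq> 0}"
    by (intro AE_not_in) (simp add: negligible_iff_null_sets)
  then show ?thesis
    using Ms by (simp add: AE_restrict_space_iff)
qed

text \<open>Both candidates have the same integral against every test function, so the fundamental
  lemma applies to their difference.\<close>

lemma has_weak_partial_unique:
  fixes f :: "real^'n::finite \<Rightarrow> real"
  assumes M: "open M" and f1: "has_weak_partial M j f f1" and f2: "has_weak_partial M j f f2"
  shows "AE x in lebesgue_on M. f1 x = f2 x"
proof -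
  have Ms: "M \<in> sets lebesgue"
    using M by simp
  have li: "locally_integrable M f1" "locally_integrable M f2"
    using f1 f2 by (auto simp: has_weak_partial_def)
  have "AE x in lebesgue_on M. 1 * f1 x + (-1) * f2 x = 0"
  proof (rule fundamental_lemma_calculus_of_variations[OF M locally_integrable_lincomb[OF li]])
    fix \<phi> :: "real^'n \<Rightarrow> real" assume \<phi>: "\<phi> \<in> test_functions M"
    have "(\<integral>x. f1 x * \<phi> x \<partial>lebesgue_on M) = (\<integral>x. f2 x * \<phi> x \<partial>lebesgue_on M)"
      using f1 f2 \<phi> by (auto simp: has_weak_partial_def)
    then show "(\<integral>x. (1 * f1 x + (-1) * f2 x) * \<phi> x \<partial>lebesgue_on M) = 0"
      using locally_integrable_times_test_function[OF Ms li(1) \<phi>]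
        locally_integrable_times_test_function[OF Ms li(2) \<phi>]
      by (simp add: algebra_simps)
  qed
  then show ?thesis
    by simp
qed

text \<open>The bridge from the unspecified choice in \<open>weak_partial\<close> to any weak
  derivative that is known explicitly.\<close>

lemma weak_partial_AE:
  fixes f :: "real^'n::finite \<Rightarrow> real"
  assumes "open M" and "has_weak_partial M j f f'"
  shows "AE x in lebesgue_on M. weak_partial M j f x = f' x"
  using assms(2) unfolding weak_partial_def
  by (intro has_weak_partial_unique[OF assms(1)]) (rule someI[of "has_weak_partial M j f"])

lemma has_weak_partial_lincomb:
  fixes f g :: "real^'n::finite \<Rightarrow> real"
  assumes Ms: "M \<in> sets lebesgue"
    and f: "has_weak_partial M j f f'" and g: "has_weak_partial M j g g'"
  shows "has_weak_partial M j (\<lambda>x. a * f x + b * g x) (\<lambda>x. a * f' x + b * g' x)"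
  unfolding has_weak_partial_def
proof (intro conjI ballI locally_integrable_lincomb)
  show li: "locally_integrable M f" "locally_integrable M g"
    "locally_integrable M f'" "locally_integrable M g'"
    using f g by (auto simp: has_weak_partial_def)
  fix \<phi> :: "real^'n \<Rightarrow> real" assume \<phi>: "\<phi> \<in> test_functions M"
  let ?d = "\<lambda>x. frechet_derivative \<phi> (at x) (axis j 1)"
  \<comment> \<open>Splitting the integrals requires each product to be integrable. Since the
    derivative is again a test function, the same integrability lemma covers both sides of the
    identity.\<close>
  have \<phi>': "?d \<in> test_functions M"
    by (rule test_functions_frechet_derivative[OF \<phi>])
  note i = li[THEN locally_integrable_times_test_function[OF Ms]]
  have "(\<integral>x. (a * f x + b * g x) * ?d x \<partial>lebesgue_on M) =
      a * (\<integral>x. f x * ?d x \<partial>lebesgue_on M) + b * (\<integral>x. g x * ?d x \<partial>lebesgue_on M)"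
    using i(1,2)[OF \<phi>'] by (simp add: distrib_right mult.assoc)
  also have "\<dots> = - (a * (\<integral>x. f' x * \<phi> x \<partial>lebesgue_on M) + b * (\<integral>x. g' x * \<phi> x \<partial>lebesgue_on M))"
    using f g \<phi> by (simp add: has_weak_partial_def)
  also have "\<dots> = - (\<integral>x. (a * f' x + b * g' x) * \<phi> x \<partial>lebesgue_on M)"
    using i(3,4)[OF \<phi>] by (simp add: distrib_right mult.assoc)
  finally show "(\<integral>x. (a * f x + b * g x) * ?d x \<partial>lebesgue_on M) =
      - (\<integral>x. (a * f' x + b * g' x) * \<phi> x \<partial>lebesgue_on M)" .
qed

subsection \<open>Square integrable functions\<close>

text \<open>Measurability is a separate condition, since integrability of the squared norm does not
  imply it. Values in an arbitrary Euclidean space let one notion serve functions, Jacobians and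
  pairs of both.\<close>

definition square_integrable :: "'a measure \<Rightarrow> ('a \<Rightarrow> 'b::euclidean_space) \<Rightarrow> bool" where
  "square_integrable \<mu> f \<longleftrightarrow> f \<in> borel_measurable \<mu> \<and> integrable \<mu> (\<lambda>x. (norm (f x))\<^sup>2)"

lemma square_integrableD [dest]:
  assumes "square_integrable \<mu> f"
  shows "f \<in> borel_measurable \<mu>" and "integrable \<mu> (\<lambda>x. (norm (f x))\<^sup>2)"
  using assms by (auto simp: square_integrable_def)

text \<open>The difference of the two sides is |a - b|^2. Integrated, this replaces the triangle
  inequality of L2, so that only squared norms ever have to be handled.\<close>

lemma norm_add_square_le:
  fixes a b :: "'a::real_inner"
  shows "(norm (a + b))\<^sup>2 \<le> 2 * (norm a)\<^sup>2 + 2 * (norm b)\<^sup>2"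
proof -
  have "0 \<le> (norm (a - b))\<^sup>2"
    by simp
  then show ?thesis
    unfolding power2_norm_eq_inner by (simp add: inner_diff inner_add inner_commute)
qed

lemma square_integrable_scaleR:
  assumes "square_integrable \<mu> f"
  shows "square_integrable \<mu> (\<lambda>x. a *\<^sub>R f x)"
  using assms unfolding square_integrable_def
  by (auto simp: power_mult_distrib intro: borel_measurable_scaleR)

lemma square_integrable_add:
  assumes "square_integrable \<mu> f" and "square_integrable \<mu> g"
  shows "square_integrable \<mu> (\<lambda>x. f x + g x)"
  unfolding square_integrable_def
proof
  note [measurable] = square_integrableD(1)[OF assms(1)] square_integrableD(1)[OF assms(2)]
  show m: "(\<lambda>x. f x + g x) \<in> borel_measurable \<mu>"
    by measurable
  show "integrable \<mu> (\<lambda>x. (norm (f x + g x))\<^sup>2)"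
  proof (rule Bochner_Integration.integrable_bound)
    show "integrable \<mu> (\<lambda>x. 2 * (norm (f x))\<^sup>2 + 2 * (norm (g x))\<^sup>2)"
      using assms by (intro Bochner_Integration.integrable_add integrable_mult_right) auto
    show "AE x in \<mu>. norm ((norm (f x + g x))\<^sup>2) \<le> norm (2 * (norm (f x))\<^sup>2 + 2 * (norm (g x))\<^sup>2)"
      by (intro AE_I2) (simp add: norm_add_square_le)
  qed measurable
qed

lemma square_integrable_lincomb:
  assumes "square_integrable \<mu> f" and "square_integrable \<mu> g"
  shows "square_integrable \<mu> (\<lambda>x. a *\<^sub>R f x + b *\<^sub>R g x)"
  by (rule square_integrable_add[OF square_integrable_scaleR[OF assms(1)]
        square_integrable_scaleR[OF assms(2)]])

lemma square_integrable_diff: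
  assumes "square_integrable \<mu> f" and "square_integrable \<mu> g"
  shows "square_integrable \<mu> (\<lambda>x. f x - g x)"
  using square_integrable_lincomb[OF assms, of 1 "-1"] by simp

lemma square_integrable_norm_bound:
  assumes "square_integrable \<mu> f" and "g \<in> borel_measurable \<mu>"
    and "AE x in \<mu>. norm (g x) \<le> norm (f x)"
  shows "square_integrable \<mu> g"
  unfolding square_integrable_def
proof
  note [measurable] = assms(2)
  show "integrable \<mu> (\<lambda>x. (norm (g x))\<^sup>2)"
  proof (rule Bochner_Integration.integrable_bound[OF square_integrableD(2)[OF assms(1)]])
    show "AE x in \<mu>. norm ((norm (g x))\<^sup>2) \<le> norm ((norm (f x))\<^sup>2)"
      using assms(3) by eventually_elim (simp add: power_mono)
  qed measurable
qed fact

lemma integral_norm_add_square_le: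
  assumes "square_integrable \<mu> f" and "square_integrable \<mu> g"
  shows "(\<integral>x. (norm (f x + g x))\<^sup>2 \<partial>\<mu>) \<le>
    2 * (\<integral>x. (norm (f x))\<^sup>2 \<partial>\<mu>) + 2 * (\<integral>x. (norm (g x))\<^sup>2 \<partial>\<mu>)"
proof -
  note i = square_integrableD(2)[OF assms(1)] square_integrableD(2)[OF assms(2)]
  have "(\<integral>x. (norm (f x + g x))\<^sup>2 \<partial>\<mu>) \<le> (\<integral>x. 2 * (norm (f x))\<^sup>2 + 2 * (norm (g x))\<^sup>2 \<partial>\<mu>)"
    using i square_integrable_add[OF assms] by (intro integral_mono) (auto simp: norm_add_square_le)
  with i show ?thesis
    by simp
qed

lemma integral_norm_diff_square_le:
  assumes "square_integrable \<mu> f" and "square_integrable \<mu> g"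
  shows "(\<integral>x. (norm (f x - g x))\<^sup>2 \<partial>\<mu>) \<le>
    2 * (\<integral>x. (norm (f x))\<^sup>2 \<partial>\<mu>) + 2 * (\<integral>x. (norm (g x))\<^sup>2 \<partial>\<mu>)"
  using integral_norm_add_square_le[OF assms(1) square_integrable_scaleR[OF assms(2), of "-1"]]
  by simp

lemma integral_norm_diff_square_triangle:
  assumes "square_integrable \<mu> f" and "square_integrable \<mu> g" and "square_integrable \<mu> h"
  shows "(\<integral>x. (norm (f x - h x))\<^sup>2 \<partial>\<mu>) \<le>
    2 * (\<integral>x. (norm (f x - g x))\<^sup>2 \<partial>\<mu>) + 2 * (\<integral>x. (norm (g x - h x))\<^sup>2 \<partial>\<mu>)"
  using integral_norm_add_square_le[OF square_integrable_diff[OF assms(1,2)]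
      square_integrable_diff[OF assms(2,3)]]
  by simp

text \<open>Polarization: the inner product is a combination of three integrable squared
  norms.\<close>

lemma integrable_inner_square_integrable:
  assumes "square_integrable \<mu> f" and "square_integrable \<mu> g"
  shows "integrable \<mu> (\<lambda>x. f x \<bullet> g x)"
proof -
  have "integrable \<mu> (\<lambda>x. ((norm (f x + g x))\<^sup>2 - (norm (f x))\<^sup>2 - (norm (g x))\<^sup>2) / 2)"
    by (intro Bochner_Integration.integrable_diff integrable_divide_zero square_integrableD(2)
        assms square_integrable_add[OF assms])
  moreover have "((norm (f x + g x))\<^sup>2 - (norm (f x))\<^sup>2 - (norm (g x))\<^sup>2) / 2 = f x \<bullet> g x" for x
    unfolding power2_norm_eq_inner by (simp add: inner_add inner_commute)
  ultimately show ?thesis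
    by simp
qed

text \<open>The integral of |f - t g|^2 is a quadratic polynomial in t that is nonnegative
  everywhere, which forces the discriminant condition.\<close>

lemma integral_Cauchy_Schwarz:
  assumes f: "square_integrable \<mu> f" and g: "square_integrable \<mu> g"
  shows "(\<integral>x. f x \<bullet> g x \<partial>\<mu>)\<^sup>2 \<le> (\<integral>x. (norm (f x))\<^sup>2 \<partial>\<mu>) * (\<integral>x. (norm (g x))\<^sup>2 \<partial>\<mu>)"
proof -
  define A where "A = (\<integral>x. (norm (f x))\<^sup>2 \<partial>\<mu>)"
  define B where "B = (\<integral>x. f x \<bullet> g x \<partial>\<mu>)"
  define C where "C = (\<integral>x. (norm (g x))\<^sup>2 \<partial>\<mu>)"
  note i = square_integrableD(2)[OF f] square_integrableD(2)[OF g]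
    integrable_inner_square_integrable[OF f g]
  have Q: "0 \<le> A - 2 * t * B + t\<^sup>2 * C" for t
  proof -
    have "0 \<le> (\<integral>x. (norm (f x - t *\<^sub>R g x))\<^sup>2 \<partial>\<mu>)"
      by simp
    also have "(\<lambda>x. (norm (f x - t *\<^sub>R g x))\<^sup>2) =
        (\<lambda>x. (norm (f x))\<^sup>2 - 2 * t * (f x \<bullet> g x) + t\<^sup>2 * (norm (g x))\<^sup>2)"
      unfolding power2_norm_eq_inner
      by (simp add: inner_diff inner_commute algebra_simps power2_eq_square)
    also have "(\<integral>x. (norm (f x))\<^sup>2 - 2 * t * (f x \<bullet> g x) + t\<^sup>2 * (norm (g x))\<^sup>2 \<partial>\<mu>) =
        A - 2 * t * B + t\<^sup>2 * C"
      using i by (simp add: A_def B_def C_def)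
    finally show ?thesis .
  qed
  have "B\<^sup>2 \<le> A * C"
  proof (cases "C = 0")
    case True
    have "B = 0"
    proof (rule ccontr)
      assume "B \<noteq> 0"
      \<comment> \<open>With \<open>C = 0\<close> the polynomial is affine; this \<open>t\<close>
        gives it the value -1.\<close>
      with True Q[of "(A + 1) / (2 * B)"] show False
        by simp
    qed
    with True show ?thesis
      by simp
  next
    case False
    then have "C > 0"
      by (simp add: C_def less_le)
    \<comment> \<open>The minimum of the quadratic is attained at \<open>B / C\<close>.\<close>
    with Q[of "B / C"] show ?thesis
      by (simp add: field_simps power2_eq_square)
  qed
  then show ?thesis
    by (simp add: A_def B_def C_def)
qed

lemma tendsto_integral_inner:
  assumes F: "\<And>k. square_integrable \<mu> (F k)" and f: "square_integrable \<mu> f"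
    and g: "square_integrable \<mu> g"
    and lim: "(\<lambda>k. \<integral>x. (norm (F k x - f x))\<^sup>2 \<partial>\<mu>) \<longlonglongrightarrow> 0"
  shows "(\<lambda>k. \<integral>x. F k x \<bullet> g x \<partial>\<mu>) \<longlonglongrightarrow> (\<integral>x. f x \<bullet> g x \<partial>\<mu>)"
proof -
  have *: "(\<integral>x. F k x \<bullet> g x \<partial>\<mu>) - (\<integral>x. f x \<bullet> g x \<partial>\<mu>) = (\<integral>x. (F k x - f x) \<bullet> g x \<partial>\<mu>)" for k
    using integrable_inner_square_integrable[OF F g] integrable_inner_square_integrable[OF f g]
    by (simp add: inner_diff_left)
  have "(\<lambda>k. ((\<integral>x. F k x \<bullet> g x \<partial>\<mu>) - (\<integral>x. f x \<bullet> g x \<partial>\<mu>))\<^sup>2) \<longlonglongrightarrow> 0"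
  proof (rule tendsto_sandwich[OF _ _ tendsto_const tendsto_mult_left_zero[OF lim]])
    show "\<forall>\<^sub>F k in sequentially. ((\<integral>x. F k x \<bullet> g x \<partial>\<mu>) - (\<integral>x. f x \<bullet> g x \<partial>\<mu>))\<^sup>2 \<le>
        (\<integral>x. (norm (F k x - f x))\<^sup>2 \<partial>\<mu>) * (\<integral>x. (norm (g x))\<^sup>2 \<partial>\<mu>)"
      unfolding * by (intro always_eventually allI integral_Cauchy_Schwarz square_integrable_diff F f g)
  qed simp
  then have "(\<lambda>k. (\<integral>x. F k x \<bullet> g x \<partial>\<mu>) - (\<integral>x. f x \<bullet> g x \<partial>\<mu>)) \<longlonglongrightarrow> 0"
    by simp
  then show ?thesis
    by (rule Lim_null[THEN iffD2])
qed

text \<open>Expand |F|^2 = |F - f|^2 + 2 F.f - f.f: the first term tends to zero by assumption and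
  the middle one converges because pairing with a fixed function is continuous.\<close>

lemma tendsto_integral_norm_square:
  assumes F: "\<And>k. square_integrable \<mu> (F k)" and f: "square_integrable \<mu> f"
    and lim: "(\<lambda>k. \<integral>x. (norm (F k x - f x))\<^sup>2 \<partial>\<mu>) \<longlonglongrightarrow> 0"
  shows "(\<lambda>k. \<integral>x. (norm (F k x))\<^sup>2 \<partial>\<mu>) \<longlonglongrightarrow> (\<integral>x. (norm (f x))\<^sup>2 \<partial>\<mu>)"
proof -
  have *: "(\<integral>x. (norm (F k x - f x))\<^sup>2 \<partial>\<mu>) + 2 * (\<integral>x. F k x \<bullet> f x \<partial>\<mu>) - (\<integral>x. f x \<bullet> f x \<partial>\<mu>) =
      (\<integral>x. (norm (F k x))\<^sup>2 \<partial>\<mu>)" for k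
  proof -
    have "(\<lambda>x. (norm (F k x))\<^sup>2) =
        (\<lambda>x. (norm (F k x - f x))\<^sup>2 + 2 * (F k x \<bullet> f x) - (f x \<bullet> f x))"
      unfolding power2_norm_eq_inner by (simp add: inner_diff inner_commute)
    then show ?thesis
      using square_integrableD(2)[OF square_integrable_diff[OF F f]]
        integrable_inner_square_integrable[OF F f] integrable_inner_square_integrable[OF f f]
      by simp
  qed
  have "(\<lambda>k. (\<integral>x. (norm (F k x - f x))\<^sup>2 \<partial>\<mu>) + 2 * (\<integral>x. F k x \<bullet> f x \<partial>\<mu>) - (\<integral>x. f x \<bullet> f x \<partial>\<mu>))
      \<longlonglongrightarrow> 0 + 2 * (\<integral>x. f x \<bullet> f x \<partial>\<mu>) - (\<integral>x. f x \<bullet> f x \<partial>\<mu>)"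
    by (intro tendsto_intros lim tendsto_integral_inner F f)
  then show ?thesis
    unfolding * by (simp add: power2_norm_eq_inner)
qed

section \<open>Completeness of L2\<close>

lemma square_integrable_nn_integral:
  assumes "square_integrable \<mu> f"
  shows "(\<integral>\<^sup>+x. ennreal ((norm (f x))\<^sup>2) \<partial>\<mu>) = ennreal (\<integral>x. (norm (f x))\<^sup>2 \<partial>\<mu>)"
  using assms by (intro nn_integral_eq_integral) auto

text \<open>Fatou's lemma delivers bounds on nonnegative integrals; this turns such a bound into
  square integrability together with a bound on the real integral.\<close>

lemma square_integrable_nn_integralI:
  assumes "f \<in> borel_measurable \<mu>" and "(\<integral>\<^sup>+x. ennreal ((norm (f x))\<^sup>2) \<partial>\<mu>) \<le> ennreal e" and "e \<ge> 0"
  shows "square_integrable \<mu> f" and "(\<integral>x. (norm (f x))\<^sup>2 \<partial>\<mu>) \<le> e"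
proof -
  note [measurable] = assms(1)
  show *: "square_integrable \<mu> f"
    unfolding square_integrable_def
    using order_le_less_trans[OF assms(2) ennreal_less_top]
    by (auto intro!: integrableI_bounded)
  show "(\<integral>x. (norm (f x))\<^sup>2 \<partial>\<mu>) \<le> e"
    using assms(2,3) unfolding square_integrable_nn_integral[OF *] by simp
qed

text \<open>Weighting the squared increments by \<open>2\<^sup>k\<close> makes them pointwise geometrically summable.\<close>

lemma AE_convergent_of_fast_L2_Cauchy:
  fixes G :: "nat \<Rightarrow> 'a \<Rightarrow> 'b::euclidean_space"
  assumes G: "\<And>k. square_integrable \<mu> (G k)"
    and fast: "\<And>k. (\<integral>x. (norm (G (Suc k) x - G k x))\<^sup>2 \<partial>\<mu>) \<le> (1/4) ^ k"
  shows "AE x in \<mu>. convergent (\<lambda>k. G k x)"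
proof -
  define D where "D k x = ennreal (2 ^ k * (norm (G (Suc k) x - G k x))\<^sup>2)" for k x
  note d = square_integrable_diff[OF G G]
  have [measurable]: "G k \<in> borel_measurable \<mu>" for k
    using G by auto
  have D_m [measurable]: "D k \<in> borel_measurable \<mu>" for k
    unfolding D_def by measurable
  have D_le: "(\<integral>\<^sup>+x. D k x \<partial>\<mu>) \<le> ennreal ((1/2) ^ k)" for k
  proof -
    have "(\<integral>\<^sup>+x. D k x \<partial>\<mu>) = ennreal (2 ^ k) * (\<integral>\<^sup>+x. ennreal ((norm (G (Suc k) x - G k x))\<^sup>2) \<partial>\<mu>)"
      unfolding D_def by (simp add: ennreal_mult nn_integral_cmult)
    also have "\<dots> = ennreal (2 ^ k * (\<integral>x. (norm (G (Suc k) x - G k x))\<^sup>2 \<partial>\<mu>))"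
      by (simp add: square_integrable_nn_integral[OF d] ennreal_mult)
    also have "\<dots> \<le> ennreal (2 ^ k * (1/4) ^ k)"
      using fast by (intro ennreal_leI mult_left_mono) auto
    finally show ?thesis
      by (simp add: power_mult_distrib[symmetric])
  qed
  have "(\<integral>\<^sup>+x. (\<Sum>k. D k x) \<partial>\<mu>) = (\<Sum>k. \<integral>\<^sup>+x. D k x \<partial>\<mu>)"
    by (rule nn_integral_suminf) measurable
  also have "\<dots> \<le> (\<Sum>k. ennreal ((1/2) ^ k))"
    by (intro suminf_le D_le summableI)
  also have "\<dots> = ennreal (1 / (1 - 1/2))"
    by (rule suminf_ennreal_eq[OF _ geometric_sums]) simp_all
  also have "\<dots> < \<infinity>"
    by simp
  finally have "(\<integral>\<^sup>+x. (\<Sum>k. D k x) \<partial>\<mu>) \<noteq> \<infinity>"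
    by (rule less_imp_neq)
  then have "AE x in \<mu>. (\<Sum>k. D k x) \<noteq> \<infinity>"
    by (rule nn_integral_PInf_AE[rotated]) measurable
  then show ?thesis
  proof eventually_elim
    case (elim x)
    then obtain c where c: "(\<Sum>k. D k x) = ennreal c" "c \<ge> 0"
      by (cases "\<Sum>k. D k x") auto
    have bound: "norm (G (Suc k) x - G k x) \<le> sqrt c * (sqrt (1/2)) ^ k" for k
    proof -
      have "D k x \<le> ennreal c"
        unfolding c(1)[symmetric] using sum_le_suminf[of "\<lambda>k. D k x" "{k}"] by simp
      then have "2 ^ k * (norm (G (Suc k) x - G k x))\<^sup>2 \<le> c"
        using c(2) by (simp add: D_def)
      then have "(norm (G (Suc k) x - G k x))\<^sup>2 \<le> c * (1/2) ^ k"
        by (simp add: field_simps power_one_over)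
      then have "norm (G (Suc k) x - G k x) \<le> sqrt (c * (1/2) ^ k)"
        by (rule real_le_rsqrt)
      then show ?thesis
        by (simp add: real_sqrt_mult real_sqrt_power)
    qed
    have "summable (\<lambda>k. sqrt c * (sqrt (1/2)) ^ k)"
      by (intro summable_mult summable_geometric) (simp add: real_sqrt_divide)
    then have "summable (\<lambda>k. G (Suc k) x - G k x)"
      by (rule summable_comparison_test'[where N = 0]) (rule bound)
    then have "convergent (\<lambda>n. \<Sum>k<n. G (Suc k) x - G k x)"
      by (simp add: summable_iff_convergent)
    then have "convergent (\<lambda>n. G n x - G 0 x)"
      by (subst (asm) sum_lessThan_telescope)
    then have "convergent (\<lambda>n. (G n x - G 0 x) + G 0 x)"
      by (intro convergent_add convergent_const)
    then show ?case
      by simp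
  qed
qed

text \<open>A rapidly converging subsequence has a limit almost everywhere, and Fatou's lemma
  transfers the Cauchy estimate to that limit. The subsequence is part of the conclusion because
  pointwise constraints pass to the limit only along it.\<close>

lemma L2_complete:
  fixes F :: "nat \<Rightarrow> 'a \<Rightarrow> 'b::euclidean_space"
  assumes F: "\<And>k. square_integrable \<mu> (F k)"
    and Cauchy: "\<And>e. e > 0 \<Longrightarrow> \<exists>N. \<forall>m\<ge>N. \<forall>n\<ge>N. (\<integral>x. (norm (F m x - F n x))\<^sup>2 \<partial>\<mu>) < e"
  obtains f r where "square_integrable \<mu> f" and "(\<lambda>k. \<integral>x. (norm (F k x - f x))\<^sup>2 \<partial>\<mu>) \<longlonglongrightarrow> 0"
    and "strict_mono (r :: nat \<Rightarrow> nat)" and "AE x in \<mu>. (\<lambda>k. F (r k) x) \<longlonglongrightarrow> f x"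
proof -
  have "\<forall>k. \<exists>N. \<forall>m\<ge>N. \<forall>n\<ge>N. (\<integral>x. (norm (F m x - F n x))\<^sup>2 \<partial>\<mu>) < (1/4) ^ k"
    using Cauchy by simp
  then obtain N where N: "\<And>k m n. m \<ge> N k \<Longrightarrow> n \<ge> N k \<Longrightarrow>
      (\<integral>x. (norm (F m x - F n x))\<^sup>2 \<partial>\<mu>) < (1/4) ^ k"
    by metis
  \<comment> \<open>The summand \<open>k\<close> makes \<open>r\<close> strictly increasing, and the
    sum dominates every threshold \<open>N i\<close> with \<open>i \<le> k\<close>.\<close>
  define r where "r k = k + (\<Sum>i\<le>k. N i)" for k
  have r: "strict_mono r"
    unfolding strict_mono_Suc_iff r_def by simp
  have rN: "N k \<le> r k" for k
    unfolding r_def by (rule trans_le_add2) (simp add: member_le_sum)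
  have [measurable]: "F k \<in> borel_measurable \<mu>" for k
    using F by auto
  \<comment> \<open>Where the subsequence diverges, \<open>lim\<close> still returns some value. The
    function is measurable regardless, and the exceptional points form a null set.\<close>
  define f where "f x = lim (\<lambda>k. F (r k) x)" for x
  have f_m [measurable]: "f \<in> borel_measurable \<mu>"
    unfolding f_def by (rule borel_measurable_lim_metric) measurable
  have "AE x in \<mu>. convergent (\<lambda>k. F (r k) x)"
  proof (rule AE_convergent_of_fast_L2_Cauchy[OF F])
    fix k
    have "N k \<le> r (Suc k)"
      using rN[of k] strict_monoD[OF r, of k "Suc k"] by simp
    then show "(\<integral>x. (norm (F (r (Suc k)) x - F (r k) x))\<^sup>2 \<partial>\<mu>) \<le> (1/4) ^ k"
      using N rN less_imp_le by blast
  qed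
  then have ae: "AE x in \<mu>. (\<lambda>k. F (r k) x) \<longlonglongrightarrow> f x"
    by eventually_elim (simp add: f_def convergent_LIMSEQ_iff)
  \<comment> \<open>Fatou's lemma along the subsequence. Integrability of the limit is part of the
    result, since only nonnegative integrals are compared.\<close>
  have key: "square_integrable \<mu> (\<lambda>x. F n x - f x) \<and> (\<integral>x. (norm (F n x - f x))\<^sup>2 \<partial>\<mu>) \<le> e"
    if e: "e > 0" and n: "\<And>m. m \<ge> K \<Longrightarrow> (\<integral>x. (norm (F n x - F m x))\<^sup>2 \<partial>\<mu>) < e" for e n K
  proof -
    have "(\<integral>\<^sup>+x. ennreal ((norm (F n x - f x))\<^sup>2) \<partial>\<mu>) =
        (\<integral>\<^sup>+x. liminf (\<lambda>k. ennreal ((norm (F n x - F (r k) x))\<^sup>2)) \<partial>\<mu>)"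
    proof (rule nn_integral_cong_AE, use ae in eventually_elim)
      case (elim x)
      then have "(\<lambda>k. ennreal ((norm (F n x - F (r k) x))\<^sup>2)) \<longlonglongrightarrow> ennreal ((norm (F n x - f x))\<^sup>2)"
        by (intro tendsto_intros tendsto_ennrealI)
      then show ?case
        by (intro lim_imp_Liminf[symmetric]) simp_all
    qed
    also have "\<dots> \<le> liminf (\<lambda>k. \<integral>\<^sup>+x. ennreal ((norm (F n x - F (r k) x))\<^sup>2) \<partial>\<mu>)"
      by (rule nn_integral_liminf) measurable
    also have "\<dots> \<le> ennreal e"
    proof (rule Liminf_le)
      show "\<forall>\<^sub>F k in sequentially. (\<integral>\<^sup>+x. ennreal ((norm (F n x - F (r k) x))\<^sup>2) \<partial>\<mu>) \<le> ennreal e"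
        using eventually_ge_at_top[of K]
      proof eventually_elim
        case (elim k)
        then have "K \<le> r k"
          using seq_suble[OF r, of k] by simp
        from n[OF this] show ?case
          unfolding square_integrable_nn_integral[OF square_integrable_diff[OF F F]]
          by (simp add: ennreal_leI)
      qed
    qed simp
    finally show ?thesis
      using e square_integrable_nn_integralI[of "\<lambda>x. F n x - f x" \<mu> e] by simp
  qed
  \<comment> \<open>At level 0 the threshold is (1/4)^0 = 1, so \<open>e = 1\<close> is admissible.
    One square integrable difference suffices to place \<open>f\<close> itself in L2.\<close>
  have "square_integrable \<mu> (\<lambda>x. F (N 0) x - f x)"
    using key[of 1 "N 0" "N 0"] N[of 0 "N 0"] by simp
  from square_integrable_diff[OF F[of "N 0"] this] have f_si: "square_integrable \<mu> f"
    by simp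
  have "(\<lambda>k. \<integral>x. (norm (F k x - f x))\<^sup>2 \<partial>\<mu>) \<longlonglongrightarrow> 0"
  proof (rule LIMSEQ_I)
    fix e :: real assume e: "e > 0"
    from Cauchy[of "e/2"] e obtain K where
      K: "\<And>m n. m \<ge> K \<Longrightarrow> n \<ge> K \<Longrightarrow> (\<integral>x. (norm (F m x - F n x))\<^sup>2 \<partial>\<mu>) < e/2"
      by auto
    have "norm ((\<integral>x. (norm (F n x - f x))\<^sup>2 \<partial>\<mu>) - 0) < e" if "n \<ge> K" for n
      using key[of "e/2" K n] K[OF that] e by simp
    then show "\<exists>K. \<forall>n\<ge>K. norm ((\<integral>x. (norm (F n x - f x))\<^sup>2 \<partial>\<mu>) - 0) < e"
      by blast
  qed
  with f_si r ae show ?thesis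
    by (intro that)
qed

subsection \<open>Integration of test functions\<close>

lemma continuous_compact_support_integrable:
  fixes f :: "'a::euclidean_space \<Rightarrow> 'b::euclidean_space"
  assumes f: "continuous_on UNIV f" and K: "compact K" and zero: "\<And>x. x \<notin> K \<Longrightarrow> f x = 0"
  shows "integrable lborel f"
proof -
  have "integrable lborel (\<lambda>x. indicator K x *\<^sub>R f x)"
    using K continuous_on_subset[OF f subset_UNIV] by (rule borel_integrable_compact)
  moreover have "(\<lambda>x. indicator K x *\<^sub>R f x) = f"
  proof
    show "indicator K x *\<^sub>R f x = f x" for x
      by (cases "x \<in> K") (simp_all add: zero[of x])
  qed
  ultimately show ?thesis
    by simp
qed

lemma test_functions_integrable:
  fixes \<phi> :: "'a::euclidean_space \<Rightarrow> 'b::euclidean_space"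
  assumes \<phi>: "\<phi> \<in> test_functions M"
  shows "integrable lborel \<phi>"
  by (rule continuous_compact_support_integrable[OF smooth_continuous_on[OF test_functionsD(1)[OF \<phi>]]
        test_functionsD(2)[OF \<phi>] not_in_closure_support[of _ \<phi>]])

lemma test_functions_square_integrable:
  fixes \<phi> :: "'a::euclidean_space \<Rightarrow> 'b::euclidean_space"
  assumes \<phi>: "\<phi> \<in> test_functions M"
  shows "square_integrable lborel \<phi>"
  unfolding square_integrable_def
proof
  have c: "continuous_on UNIV \<phi>"
    by (rule smooth_continuous_on[OF test_functionsD(1)[OF \<phi>]])
  then show "\<phi> \<in> borel_measurable lborel"
    by (simp add: borel_measurable_continuous_onI)
  show "integrable lborel (\<lambda>x. (norm (\<phi> x))\<^sup>2)"
  proof (rule continuous_compact_support_integrable[OF _ test_functionsD(2)[OF \<phi>]])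
    show "continuous_on UNIV (\<lambda>x. (norm (\<phi> x))\<^sup>2)"
      using c by (intro continuous_intros)
    show "(norm (\<phi> x))\<^sup>2 = 0" if "x \<notin> closure {x. \<phi> x \<noteq> 0}" for x
      using not_in_closure_support[OF that] by simp
  qed
qed

lemma square_integrable_lebesgue_on:
  fixes f :: "'a::euclidean_space \<Rightarrow> 'b::euclidean_space"
  assumes "square_integrable lborel f" and "M \<in> sets lebesgue"
  shows "square_integrable (lebesgue_on M) f"
  unfolding square_integrable_def
proof
  show "f \<in> borel_measurable (lebesgue_on M)"
    using square_integrableD(1)[OF assms(1)]
    by (intro measurable_restrict_space1 measurable_completion) simp
  have "integrable lebesgue (\<lambda>x. (norm (f x))\<^sup>2)"
    using square_integrableD[OF assms(1)] by (subst integrable_completion) auto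
  then have "integrable (lebesgue_on UNIV) (\<lambda>x. (norm (f x))\<^sup>2)"
    by (simp add: lebesgue_on_UNIV_eq)
  then show "integrable (lebesgue_on M) (\<lambda>x. (norm (f x))\<^sup>2)"
    by (rule integrable_lebesgue_on_subset) (use assms(2) in auto)
qed

text \<open>The function spaces live on \<open>lebesgue_on M\<close>, whereas translation invariance
  and Fubini are used on \<open>lborel\<close>. Functions vanishing off \<open>M\<close> can be
  moved between the two.\<close>

lemma integral_lebesgue_on_eq_lborel:
  fixes g :: "'a::euclidean_space \<Rightarrow> 'b::euclidean_space"
  assumes "M \<in> sets lebesgue" and "g \<in> borel_measurable borel" and "\<And>x. x \<notin> M \<Longrightarrow> g x = 0"
  shows "integral\<^sup>L (lebesgue_on M) g = integral\<^sup>L lborel g"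
  using integrable_lebesgue_on_support(2)[OF assms(1), of g] assms(2,3)
  by (simp add: integral_completion)

section \<open>Translation invariance and integration by parts\<close>

lemma nn_integral_lborel_translate:
  fixes f :: "'a::euclidean_space \<Rightarrow> ennreal"
  assumes [measurable]: "f \<in> borel_measurable borel"
  shows "(\<integral>\<^sup>+x. f (x + a) \<partial>lborel) = (\<integral>\<^sup>+x. f x \<partial>lborel)"
proof -
  have "(\<integral>\<^sup>+x. f x \<partial>lborel) = (\<integral>\<^sup>+x. f x \<partial>distr lborel borel ((+) a))"
    by (simp add: lborel_distr_plus)
  also have "\<dots> = (\<integral>\<^sup>+x. f (a + x) \<partial>lborel)"
    by (subst nn_integral_distr) simp_all
  finally show ?thesis
    by (simp add: add.commute)
qed

lemma integral_lborel_translate: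
  fixes f :: "'a::euclidean_space \<Rightarrow> 'b::euclidean_space"
  assumes [measurable]: "f \<in> borel_measurable borel"
  shows "(\<integral>x. f (x + a) \<partial>lborel) = (\<integral>x. f x \<partial>lborel)"
proof -
  have "(\<integral>x. f x \<partial>lborel) = (\<integral>x. f x \<partial>distr lborel borel ((+) a))"
    by (simp add: lborel_distr_plus)
  also have "\<dots> = (\<integral>x. f (a + x) \<partial>lborel)"
    by (subst integral_distr) simp_all
  finally show ?thesis
    by (simp add: add.commute)
qed

lemma integrable_lborel_translate:
  fixes f :: "'a::euclidean_space \<Rightarrow> 'b::euclidean_space"
  assumes f: "integrable lborel f"
  shows "integrable lborel (\<lambda>x. f (x + a))"
proof -
  have "integrable (distr lborel borel ((+) a)) f"
    using f by (simp add: lborel_distr_plus)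
  then have "integrable lborel (\<lambda>x. f (a + x))"
    by (rule integrable_distr[rotated]) simp
  then show ?thesis
    by (simp add: add.commute)
qed

text \<open>
  The integral of every difference quotient vanishes by translation invariance, and the quotients
  converge boundedly on a fixed compact set.
\<close>

lemma integral_directional_derivative_eq_0:
  fixes F :: "'a::euclidean_space \<Rightarrow> real"
  assumes F: "\<And>x. (F has_derivative F' x) (at x)"
    and cont: "continuous_on UNIV (\<lambda>x. F' x v)"
    and K: "compact K" and zero: "\<And>x. x \<notin> K \<Longrightarrow> F x = 0" "\<And>x. x \<notin> K \<Longrightarrow> F' x v = 0"
  shows "(\<integral>x. F' x v \<partial>lborel) = 0"
proof -
  have Fc: "continuous_on UNIV F"
    using F by (intro continuous_at_imp_continuous_on ballI has_derivative_continuous)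
  then have [measurable]: "F \<in> borel_measurable borel"
    by (rule borel_measurable_continuous_onI)
  have [measurable]: "(\<lambda>x. F' x v) \<in> borel_measurable borel"
    using cont by (rule borel_measurable_continuous_onI)
  have Fi: "integrable lborel F"
    by (rule continuous_compact_support_integrable[OF Fc K zero(1)])
  obtain B where B: "\<And>x. x \<in> K \<Longrightarrow> \<bar>F' x v\<bar> \<le> B"
    using compact_imp_bounded[OF compact_continuous_image[OF continuous_on_subset[OF cont subset_UNIV] K]]
    by (auto simp: bounded_iff)
  \<comment> \<open>The absolute value covers the case of an empty \<open>K\<close>, in which
    \<open>B\<close> could be negative.\<close>
  have B': "\<bar>F' x v\<bar> \<le> \<bar>B\<bar>" for x
    using B[of x] zero(2)[of x] by (cases "x \<in> K") auto
  \<comment> \<open>Steps have length at most |v|, so the difference quotients with factor t \<le> 1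
    all vanish off this enlargement of \<open>K\<close>. Its indicator times the bound on the
    derivative is the dominating function.\<close>
  define C where "C = {x + y |x y. x \<in> K \<and> y \<in> cball 0 (norm v)}"
  have C: "compact C"
    unfolding C_def by (intro compact_sums K compact_cball)
  define s where "s k x = real (Suc k) * (F (x + (1 / real (Suc k)) *\<^sub>R v) - F x)" for k x
  have dt: "((\<lambda>t. F (x + t *\<^sub>R v)) has_real_derivative F' (x + t *\<^sub>R v) v) (at t)" for x t
  proof -
    have "((\<lambda>t. x + t *\<^sub>R v) has_derivative (\<lambda>s. s *\<^sub>R v)) (at t)"
      by (auto intro!: derivative_eq_intros)
    from has_derivative_compose[OF this F]
    have "((\<lambda>t. F (x + t *\<^sub>R v)) has_derivative (\<lambda>s. F' (x + t *\<^sub>R v) (s *\<^sub>R v))) (at t)" .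
    moreover have "F' (x + t *\<^sub>R v) (s *\<^sub>R v) = F' (x + t *\<^sub>R v) v * s" for s
      using linear_scale[OF has_derivative_linear[OF F]] by simp
    ultimately show ?thesis
      by (simp add: has_field_derivative_def)
  qed
  have "(\<lambda>k. \<integral>x. s k x \<partial>lborel) \<longlonglongrightarrow> (\<integral>x. F' x v \<partial>lborel)"
  proof (rule integral_dominated_convergence)
    have "integrable lborel (\<lambda>x. indicator C x *\<^sub>R \<bar>B\<bar>)"
      by (rule borel_integrable_compact[OF C continuous_on_const])
    then show "integrable lborel (\<lambda>x. \<bar>B\<bar> * indicator C x)"
      by (simp add: mult.commute)
    show "s k \<in> borel_measurable lborel" for k
      unfolding s_def by measurable
    show "AE x in lborel. (\<lambda>k. s k x) \<longlonglongrightarrow> F' x v"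
    proof (rule AE_I2)
      fix x
      have "((\<lambda>h. (F (x + (0 + h) *\<^sub>R v) - F (x + 0 *\<^sub>R v)) / h) \<longlongrightarrow> F' x v) (at 0)"
        using dt[of x 0] by (simp add: DERIV_def)
      moreover have "filterlim (\<lambda>k. 1 / real (Suc k)) (at 0) sequentially"
        using LIMSEQ_inverse_real_of_nat by (simp add: filterlim_at divide_inverse)
      ultimately have "((\<lambda>k. (F (x + (0 + 1 / real (Suc k)) *\<^sub>R v) - F (x + 0 *\<^sub>R v)) / (1 / real (Suc k)))
          \<longlongrightarrow> F' x v) sequentially"
        by (rule filterlim_compose)
      then show "(\<lambda>k. s k x) \<longlonglongrightarrow> F' x v"
        by (simp add: s_def mult.commute del: of_nat_Suc)
    qed
    show "AE x in lborel. norm (s k x) \<le> \<bar>B\<bar> * indicator C x" for k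
    proof (rule AE_I2)
      fix x
      define t where "t = 1 / real (Suc k)"
      have t: "0 < t" "t \<le> 1"
        by (auto simp: t_def)
      show "norm (s k x) \<le> \<bar>B\<bar> * indicator C x"
      proof (cases "x \<in> C")
        case True
        \<comment> \<open>By the mean value theorem a difference quotient equals a value of the
          derivative, so it inherits the uniform bound.\<close>
        obtain z where "F (x + t *\<^sub>R v) - F (x + 0 *\<^sub>R v) = (t - 0) * F' (x + z *\<^sub>R v) v"
          using MVT2[OF t(1), of "\<lambda>t. F (x + t *\<^sub>R v)" "\<lambda>t. F' (x + t *\<^sub>R v) v"] dt by blast
        then have "s k x = F' (x + z *\<^sub>R v) v"
          by (simp add: s_def t_def[symmetric]) (simp add: t_def)
        with True B' show ?thesis
          by simp
      next
        case False
        have "x \<notin> K"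
          using False unfolding C_def by force
        moreover have "x + t *\<^sub>R v \<notin> K"
        proof
          assume "x + t *\<^sub>R v \<in> K"
          moreover have "- (t *\<^sub>R v) \<in> cball 0 (norm v)"
            using t by (simp add: mult_left_le_one_le)
          ultimately have "(x + t *\<^sub>R v) + - (t *\<^sub>R v) \<in> C"
            unfolding C_def by blast
          with False show False
            by simp
        qed
        ultimately show ?thesis
          using False zero(1) by (simp add: s_def t_def)
      qed
    qed
  qed simp
  moreover have "(\<integral>x. s k x \<partial>lborel) = 0" for k
    unfolding s_def using Fi integrable_lborel_translate[OF Fi] by (simp add: integral_lborel_translate)
  ultimately show ?thesis
    by (simp add: LIMSEQ_const_iff)
qed

lemma locally_integrable_lborel:
  fixes f :: "'a::euclidean_space \<Rightarrow> real"
  assumes f: "integrable lborel f"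
  shows "locally_integrable M f"
  unfolding locally_integrable_def
proof safe
  fix K :: "'a set" assume K: "compact K"
  have "integrable lebesgue f"
    using f by (subst integrable_completion) auto
  then have "integrable (lebesgue_on UNIV) f"
    by (simp add: lebesgue_on_UNIV_eq)
  then show "integrable (lebesgue_on K) f"
    by (rule integrable_lebesgue_on_subset) (use K in \<open>auto simp: lmeasurable_compact fmeasurableD\<close>)
qed

text \<open>Integration by parts: the derivative of \<phi>\<psi> in a coordinate direction has
  integral zero. Compact support of \<psi> removes any boundary term and allows the computation on
  the whole space.\<close>

lemma test_functions_has_weak_partial:
  fixes \<phi> :: "real^'n::finite \<Rightarrow> real"
  assumes M: "M \<in> sets lebesgue" and \<phi>: "\<phi> \<in> test_functions M"
  shows "has_weak_partial M j \<phi> (\<lambda>x. frechet_derivative \<phi> (at x) (axis j 1))"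
  unfolding has_weak_partial_def
proof (intro conjI ballI)
  let ?v = "axis j 1 :: real^'n"
  let ?d = "\<lambda>\<phi> x. frechet_derivative \<phi> (at x) ?v"
  note d\<phi> = test_functions_frechet_derivative[OF \<phi>, of ?v]
  show "locally_integrable M \<phi>" "locally_integrable M (?d \<phi>)"
    by (intro locally_integrable_lborel test_functions_integrable[OF \<phi>] test_functions_integrable[OF d\<phi>])+
  fix \<psi> :: "real^'n \<Rightarrow> real" assume \<psi>: "\<psi> \<in> test_functions M"
  note d\<psi> = test_functions_frechet_derivative[OF \<psi>, of ?v]
  have c: "continuous_on UNIV \<phi>" "continuous_on UNIV (?d \<phi>)"
    "continuous_on UNIV \<psi>" "continuous_on UNIV (?d \<psi>)"
    using \<phi> \<psi> d\<phi> d\<psi> by (auto intro: smooth_continuous_on dest: test_functionsD(1))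
  obtain K where K: "compact K" "K \<subseteq> M"
    and zero: "\<And>x. x \<notin> K \<Longrightarrow> \<psi> x = 0" "\<And>x v. x \<notin> K \<Longrightarrow> frechet_derivative \<psi> (at x) v = 0"
    using test_functions_support[OF \<psi>] by blast
  have zeroM: "\<psi> x = 0" "?d \<psi> x = 0" if "x \<notin> M" for x
  proof -
    have "x \<notin> K"
      using that K(2) by blast
    then show "\<psi> x = 0" "?d \<psi> x = 0"
      using zero by simp_all
  qed
  have i: "integrable lborel (\<lambda>x. \<phi> x * ?d \<psi> x)" "integrable lborel (\<lambda>x. ?d \<phi> x * \<psi> x)"
    using c zero by (auto intro!: continuous_compact_support_integrable[OF _ K(1)] continuous_intros)
  have "(\<integral>x. \<phi> x * ?d \<psi> x + ?d \<phi> x * \<psi> x \<partial>lborel) = 0"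
  proof (rule integral_directional_derivative_eq_0[where v = ?v and K = K
        and F = "\<lambda>x. \<phi> x * \<psi> x" and F' = "\<lambda>x v. \<phi> x * frechet_derivative \<psi> (at x) v + frechet_derivative \<phi> (at x) v * \<psi> x"])
    show "((\<lambda>x. \<phi> x * \<psi> x) has_derivative
        (\<lambda>v. \<phi> x * frechet_derivative \<psi> (at x) v + frechet_derivative \<phi> (at x) v * \<psi> x)) (at x)" for x
      by (rule has_derivative_mult[OF smooth_has_derivative[OF test_functionsD(1)[OF \<phi>]]
            smooth_has_derivative[OF test_functionsD(1)[OF \<psi>]]])
    show "continuous_on UNIV (\<lambda>x. \<phi> x * ?d \<psi> x + ?d \<phi> x * \<psi> x)"
      using c by (intro continuous_intros)
  qed (use K zero in auto)
  with i have "(\<integral>x. \<phi> x * ?d \<psi> x \<partial>lborel) = - (\<integral>x. ?d \<phi> x * \<psi> x \<partial>lborel)"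
    by simp
  moreover have "(\<integral>x. \<phi> x * ?d \<psi> x \<partial>lebesgue_on M) = (\<integral>x. \<phi> x * ?d \<psi> x \<partial>lborel)"
    "(\<integral>x. ?d \<phi> x * \<psi> x \<partial>lebesgue_on M) = (\<integral>x. ?d \<phi> x * \<psi> x \<partial>lborel)"
    using i zeroM by (auto intro!: integral_lebesgue_on_eq_lborel[OF M])
  ultimately show "(\<integral>x. \<phi> x * ?d \<psi> x \<partial>lebesgue_on M) = - (\<integral>x. ?d \<phi> x * \<psi> x \<partial>lebesgue_on M)"
    by simp
qed

subsection \<open>Gradient estimates\<close>

definition gradient_energy :: "(real^'n \<Rightarrow> real) \<Rightarrow> real" where
  "gradient_energy \<phi> =
     (\<integral>x. (\<Sum>j\<in>UNIV. (frechet_derivative \<phi> (at x) (axis j (1::real)))\<^sup>2) \<partial>lborel)"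

text \<open>The derivative in direction \<open>h\<close> is the inner product of \<open>h\<close>
  with the gradient \<open>p\<close>; the bound is Cauchy-Schwarz.\<close>

lemma frechet_derivative_square_le:
  fixes \<phi> :: "real^'n::finite \<Rightarrow> real"
  assumes "\<phi> differentiable (at x)"
  shows "(frechet_derivative \<phi> (at x) h)\<^sup>2 \<le>
    (norm h)\<^sup>2 * (\<Sum>j\<in>UNIV. (frechet_derivative \<phi> (at x) (axis j 1))\<^sup>2)"
proof -
  define p where "p = (\<chi> j. frechet_derivative \<phi> (at x) (axis j 1))"
  have l: "linear (frechet_derivative \<phi> (at x))"
    using assms by (simp add: linear_frechet_derivative)
  have "h = (\<Sum>j\<in>UNIV. h $ j *\<^sub>R axis j 1)"
    by (simp add: vec_eq_iff axis_def if_distrib[where f = "\<lambda>y. _ * y"] cong: if_cong)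
  then have "frechet_derivative \<phi> (at x) h = (\<Sum>j\<in>UNIV. h $ j * p $ j)"
    using linear_sum[OF l, of "\<lambda>j. h $ j *\<^sub>R axis j 1" UNIV] linear_scale[OF l]
    by (simp add: p_def)
  also have "\<dots> = h \<bullet> p"
    by (simp add: inner_vec_def)
  finally have "(frechet_derivative \<phi> (at x) h)\<^sup>2 \<le> (norm h)\<^sup>2 * (norm p)\<^sup>2"
    using Cauchy_Schwarz_ineq[of h p] by (simp add: power2_norm_eq_inner)
  also have "(norm p)\<^sup>2 = (\<Sum>j\<in>UNIV. (frechet_derivative \<phi> (at x) (axis j 1))\<^sup>2)"
    unfolding power2_norm_eq_inner by (simp add: inner_vec_def p_def power2_eq_square)
  finally show ?thesis .
qed

lemma gradient_integrable:
  fixes \<phi> :: "real^'n::finite \<Rightarrow> real"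
  assumes \<phi>: "\<phi> \<in> test_functions M"
  shows "integrable lborel (\<lambda>x. \<Sum>j\<in>UNIV. (frechet_derivative \<phi> (at x) (axis j 1))\<^sup>2)"
  using square_integrableD(2)[OF test_functions_square_integrable[OF
        test_functions_frechet_derivative[OF \<phi>]]]
  by (intro Bochner_Integration.integrable_sum) simp

text \<open>Cauchy-Schwarz against the constant 1 on \<open>B\<close>. It is used with an interval,
  for line segments, and with balls, for averages.\<close>

lemma integral_indicator_square_le:
  fixes q :: "'a::euclidean_space \<Rightarrow> real"
  assumes q: "continuous_on UNIV q" and B: "B \<in> sets borel" "bounded B"
  shows "integrable lborel (\<lambda>t. indicator B t * (q t)\<^sup>2)"
    and "(\<integral>t. indicator B t * q t \<partial>lborel)\<^sup>2 \<le>
      measure lborel B * (\<integral>t. indicator B t * (q t)\<^sup>2 \<partial>lborel)"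
proof -
  have [measurable]: "q \<in> borel_measurable borel"
    using q by (rule borel_measurable_continuous_onI)
  note [measurable] = B(1)
  have f: "emeasure lborel B < \<infinity>"
    using B(2) by (rule emeasure_bounded_finite)
  obtain C where C: "\<And>t. t \<in> B \<Longrightarrow> \<bar>q t\<bar> \<le> C"
  proof -
    have "compact (closure B)"
      using B(2) by simp
    then have "bounded (q ` closure B)"
      by (intro compact_imp_bounded compact_continuous_image continuous_on_subset[OF q]) auto
    then obtain C where C: "\<forall>x\<in>closure B. \<bar>q x\<bar> \<le> C"
      by (auto simp: bounded_iff)
    show ?thesis
      by (rule that[of C]) (use C closure_subset[of B] in blast)
  qed
  show i: "integrable lborel (\<lambda>t. indicator B t * (q t)\<^sup>2)"
  proof (rule Bochner_Integration.integrable_bound)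
    show "integrable lborel (\<lambda>t. C\<^sup>2 * indicator B t)"
      using f by simp
    show "AE t in lborel. norm (indicator B t * (q t)\<^sup>2) \<le> norm (C\<^sup>2 * indicator B t)"
    proof (rule AE_I2)
      show "norm (indicator B t * (q t)\<^sup>2) \<le> norm (C\<^sup>2 * indicator B t)" for t
        using C[of t] by (cases "t \<in> B") (auto simp: abs_le_square_iff[symmetric])
    qed
  qed measurable
  have ind: "(norm (indicator B t :: real))\<^sup>2 = indicator B t"
    "(norm (indicator B t * q t))\<^sup>2 = indicator B t * (q t)\<^sup>2"
    "(indicator B t * q t) \<bullet> indicator B t = indicator B t * q t" for t
    by (auto simp: indicator_def)
  have "square_integrable lborel (\<lambda>t. indicator B t * q t)"
    unfolding square_integrable_def ind using i by simp
  moreover have "square_integrable lborel (indicator B :: 'a \<Rightarrow> real)"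
    unfolding square_integrable_def ind using f by simp
  ultimately have "(\<integral>t. (indicator B t * q t) \<bullet> indicator B t \<partial>lborel)\<^sup>2 \<le>
      (\<integral>t. (norm (indicator B t * q t))\<^sup>2 \<partial>lborel) * (\<integral>t. (norm (indicator B t :: real))\<^sup>2 \<partial>lborel)"
    by (rule integral_Cauchy_Schwarz)
  then show "(\<integral>t. indicator B t * q t \<partial>lborel)\<^sup>2 \<le>
      measure lborel B * (\<integral>t. indicator B t * (q t)\<^sup>2 \<partial>lborel)"
    unfolding ind by (simp add: mult.commute)
qed

text \<open>The difference is the integral of the derivative along the segment from x to x + h.
  After Cauchy-Schwarz on [0,1] the order of integration is exchanged; each inner integral then is a
  translate of the gradient integral and does not depend on t.\<close>

lemma nn_integral_translation_difference:
  fixes \<phi> :: "real^'n::finite \<Rightarrow> real"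
  assumes \<phi>: "\<phi> \<in> test_functions M"
  shows "(\<integral>\<^sup>+x. ennreal ((\<phi> (x + h) - \<phi> x)\<^sup>2) \<partial>lborel) \<le> ennreal ((norm h)\<^sup>2 * gradient_energy \<phi>)"
proof -
  define N where "N x = (\<Sum>j\<in>UNIV. (frechet_derivative \<phi> (at x) (axis j 1))\<^sup>2)" for x
  have sm: "smooth \<phi>"
    by (rule test_functionsD(1)[OF \<phi>])
  have N0: "N x \<ge> 0" for x
    by (simp add: N_def sum_nonneg)
  have Nc: "continuous_on UNIV N"
    unfolding N_def by (intro continuous_intros smooth_continuous_on smooth_frechet_derivative sm)
  then have [measurable]: "N \<in> borel_measurable borel"
    by (rule borel_measurable_continuous_onI)
  have [measurable]: "\<phi> \<in> borel_measurable borel"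
    by (rule borel_measurable_continuous_onI[OF smooth_continuous_on[OF sm]])
  let ?I = "indicator {0..1::real} :: real \<Rightarrow> real"
  have pw: "ennreal ((\<phi> (x + h) - \<phi> x)\<^sup>2) \<le> (\<integral>\<^sup>+t. ennreal (?I t * ((norm h)\<^sup>2 * N (x + t *\<^sub>R h))) \<partial>lborel)" for x
  proof -
    define q where "q t = frechet_derivative \<phi> (at (x + t *\<^sub>R h)) h" for t
    have qc: "continuous_on UNIV q"
      unfolding q_def
      by (rule continuous_on_compose2[OF smooth_continuous_on[OF smooth_frechet_derivative[OF sm]]])
        (auto intro!: continuous_intros)
    have dq: "((\<lambda>t. \<phi> (x + t *\<^sub>R h)) has_vector_derivative q t) (at t within {0..1})" for t
    proof -
      have "((\<lambda>t. x + t *\<^sub>R h) has_derivative (\<lambda>s. s *\<^sub>R h)) (at t within {0..1})"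
        by (auto intro!: derivative_eq_intros)
      from has_derivative_compose[OF this smooth_has_derivative[OF sm]]
      have "((\<lambda>t. \<phi> (x + t *\<^sub>R h)) has_derivative (\<lambda>s. frechet_derivative \<phi> (at (x + t *\<^sub>R h)) (s *\<^sub>R h))) (at t within {0..1})" .
      then show ?thesis
        using linear_scale[OF linear_frechet_derivative[OF smooth_differentiable[OF sm]]]
        by (simp add: has_vector_derivative_def q_def)
    qed
    have "(\<integral>t. ?I t *\<^sub>R q t \<partial>lborel) = \<phi> (x + 1 *\<^sub>R h) - \<phi> (x + 0 *\<^sub>R h)"
      by (rule integral_FTC_atLeastAtMost[OF _ dq continuous_on_subset[OF qc]]) auto
    then have eq: "\<phi> (x + h) - \<phi> x = (\<integral>t. ?I t * q t \<partial>lborel)"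
      by simp
    note qi = integral_indicator_square_le[OF qc, of "{0..1}"]
    \<comment> \<open>The integrability lemma concerns squares of continuous functions, so it is
      applied to the square root of the nonnegative integrand.\<close>
    have cN: "continuous_on UNIV (\<lambda>t. sqrt ((norm h)\<^sup>2 * N (x + t *\<^sub>R h)))"
      by (intro continuous_intros continuous_on_compose2[OF Nc]) auto
    from integral_indicator_square_le(1)[OF this, of "{0..1}"]
    have Ni: "integrable lborel (\<lambda>t. ?I t * ((norm h)\<^sup>2 * N (x + t *\<^sub>R h)))"
      by (simp add: N0)
    have "(\<phi> (x + h) - \<phi> x)\<^sup>2 \<le> (\<integral>t. ?I t * (q t)\<^sup>2 \<partial>lborel)"
      using qi(2) by (simp add: eq)
    also have "\<dots> \<le> (\<integral>t. ?I t * ((norm h)\<^sup>2 * N (x + t *\<^sub>R h)) \<partial>lborel)"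
      using qi(1) Ni frechet_derivative_square_le[OF smooth_differentiable[OF sm]]
      by (intro integral_mono mult_left_mono) (auto simp: q_def N_def)
    finally have "ennreal ((\<phi> (x + h) - \<phi> x)\<^sup>2) \<le> ennreal (\<integral>t. ?I t * ((norm h)\<^sup>2 * N (x + t *\<^sub>R h)) \<partial>lborel)"
      by (rule ennreal_leI)
    also have "\<dots> = (\<integral>\<^sup>+t. ennreal (?I t * ((norm h)\<^sup>2 * N (x + t *\<^sub>R h))) \<partial>lborel)"
      using Ni N0 by (intro nn_integral_eq_integral[symmetric]) auto
    finally show ?thesis .
  qed
  have "(\<integral>\<^sup>+x. ennreal ((\<phi> (x + h) - \<phi> x)\<^sup>2) \<partial>lborel) \<le>
      (\<integral>\<^sup>+x. \<integral>\<^sup>+t. ennreal (?I t * ((norm h)\<^sup>2 * N (x + t *\<^sub>R h))) \<partial>lborel \<partial>lborel)"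
    by (intro nn_integral_mono pw)
  also have "\<dots> = (\<integral>\<^sup>+t. \<integral>\<^sup>+x. ennreal (?I t * ((norm h)\<^sup>2 * N (x + t *\<^sub>R h))) \<partial>lborel \<partial>lborel)"
    by (rule lborel_pair.Fubini') measurable
  also have "\<dots> = (\<integral>\<^sup>+t. ennreal (?I t * (norm h)\<^sup>2) * (\<integral>\<^sup>+x. ennreal (N (x + t *\<^sub>R h)) \<partial>lborel) \<partial>lborel)"
  proof (rule nn_integral_cong)
    fix t
    have "(\<integral>\<^sup>+x. ennreal (?I t * ((norm h)\<^sup>2 * N (x + t *\<^sub>R h))) \<partial>lborel) =
        (\<integral>\<^sup>+x. ennreal (?I t * (norm h)\<^sup>2) * ennreal (N (x + t *\<^sub>R h)) \<partial>lborel)"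
      by (intro nn_integral_cong) (simp add: mult.assoc flip: ennreal_mult')
    also have "\<dots> = ennreal (?I t * (norm h)\<^sup>2) * (\<integral>\<^sup>+x. ennreal (N (x + t *\<^sub>R h)) \<partial>lborel)"
      by (rule nn_integral_cmult) measurable
    finally show "(\<integral>\<^sup>+x. ennreal (?I t * ((norm h)\<^sup>2 * N (x + t *\<^sub>R h))) \<partial>lborel) =
        ennreal (?I t * (norm h)\<^sup>2) * (\<integral>\<^sup>+x. ennreal (N (x + t *\<^sub>R h)) \<partial>lborel)" .
  qed
  also have "\<dots> = (\<integral>\<^sup>+t. ennreal (?I t * (norm h)\<^sup>2) * (\<integral>\<^sup>+x. ennreal (N x) \<partial>lborel) \<partial>lborel)"
    by (simp add: nn_integral_lborel_translate[of "\<lambda>x. ennreal (N x)"])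
  also have "(\<integral>\<^sup>+x. ennreal (N x) \<partial>lborel) = ennreal (gradient_energy \<phi>)"
    unfolding gradient_energy_def N_def[symmetric]
    by (intro nn_integral_eq_integral) (use gradient_integrable[OF \<phi>] N0 in \<open>auto simp: N_def\<close>)
  also have "(\<integral>\<^sup>+t. ennreal (?I t * (norm h)\<^sup>2) * ennreal (gradient_energy \<phi>) \<partial>lborel) =
      ennreal ((norm h)\<^sup>2) * ennreal (gradient_energy \<phi>)"
    by (simp add: ennreal_mult nn_integral_multc ennreal_indicator)
  also have "\<dots> = ennreal ((norm h)\<^sup>2 * gradient_energy \<phi>)"
    by (simp add: ennreal_mult')
  finally show ?thesis .
qed


section \<open>Averages over balls\<close>

definition ball_integral :: "real \<Rightarrow> 'a::euclidean_space \<Rightarrow> ('a \<Rightarrow> 'b::euclidean_space) \<Rightarrow> 'b" where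
  "ball_integral \<delta> p f = (\<integral>y. indicator (ball p \<delta>) y *\<^sub>R f y \<partial>lborel)"

text \<open>Moves the centre from the domain of integration into the argument of
  \<open>\<phi>\<close>, so that integrals at different centres are compared over one fixed
  ball.\<close>

lemma ball_integral_shift:
  fixes \<phi> :: "'a::euclidean_space \<Rightarrow> real"
  assumes \<phi>: "continuous_on UNIV \<phi>"
  shows "ball_integral \<delta> p \<phi> = (\<integral>h. indicator (ball 0 \<delta>) h * \<phi> (p + h) \<partial>lborel)"
proof -
  have [measurable]: "\<phi> \<in> borel_measurable borel"
    by (rule borel_measurable_continuous_onI[OF \<phi>])
  have [measurable]: "ball p \<delta> \<in> sets borel"
    by simp
  have "ball_integral \<delta> p \<phi> = (\<integral>h. indicator (ball p \<delta>) (h + p) *\<^sub>R \<phi> (h + p) \<partial>lborel)"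
    unfolding ball_integral_def by (rule integral_lborel_translate[symmetric]) measurable
  also have "\<dots> = (\<integral>h. indicator (ball 0 \<delta>) h * \<phi> (p + h) \<partial>lborel)"
    by (rule Bochner_Integration.integral_cong) (auto simp: indicator_def dist_norm add.commute)
  finally show ?thesis .
qed

lemma integrable_indicator_continuous:
  fixes q :: "'a::euclidean_space \<Rightarrow> real"
  assumes q: "continuous_on UNIV q"
  shows "integrable lborel (\<lambda>h. indicator (ball p \<delta>) h * q h)"
proof -
  have "integrable lborel (\<lambda>h. indicator (cball p \<delta>) h *\<^sub>R q h)"
    by (rule borel_integrable_compact[OF compact_cball continuous_on_subset[OF q subset_UNIV]])
  then have "integrable lborel (\<lambda>h. indicator (ball p \<delta>) h *\<^sub>R (indicator (cball p \<delta>) h *\<^sub>R q h))"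
    by (rule integrable_mult_indicator[rotated]) simp
  moreover have "indicator (ball p \<delta>) h *\<^sub>R (indicator (cball p \<delta>) h *\<^sub>R q h) = indicator (ball p \<delta>) h * q h" for h
    by (auto simp: indicator_def)
  ultimately show ?thesis
    by (simp only:)
qed

lemma gradient_energy_nonneg: "0 \<le> gradient_energy \<phi>"
  by (simp add: gradient_energy_def sum_nonneg)

text \<open>\<open>ball_integral\<close> is not divided by the volume \<open>m\<close>, so
  \<open>\<phi> x\<close> is multiplied by it. Cauchy-Schwarz over the ball gives one factor
  \<open>m\<close>. Integrating the translation estimate over all h with |h| < \<delta> gives the
  other.\<close>

lemma nn_integral_ball_average_error:
  fixes \<phi> :: "real^'n::finite \<Rightarrow> real"
  assumes \<phi>: "\<phi> \<in> test_functions M" and \<delta>: "\<delta> > 0"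
  defines "m \<equiv> measure lborel (ball (0::real^'n) \<delta>)"
  shows "(\<integral>\<^sup>+x. ennreal ((m * \<phi> x - ball_integral \<delta> x \<phi>)\<^sup>2) \<partial>lborel) \<le>
    ennreal (m\<^sup>2 * \<delta>\<^sup>2 * gradient_energy \<phi>)"
proof -
  let ?B = "ball (0::real^'n) \<delta>"
  have c: "continuous_on UNIV \<phi>"
    by (rule smooth_continuous_on[OF test_functionsD(1)[OF \<phi>]])
  then have [measurable]: "\<phi> \<in> borel_measurable borel"
    by (rule borel_measurable_continuous_onI)
  have [measurable]: "?B \<in> sets borel"
    by simp
  have f: "emeasure lborel ?B < \<infinity>"
    by (rule emeasure_bounded_finite) simp
  have em: "emeasure lborel ?B = ennreal m"
    using f by (simp add: m_def emeasure_eq_ennreal_measure)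
  have m0: "m \<ge> 0"
    by (simp add: m_def)
  have pw: "ennreal ((m * \<phi> x - ball_integral \<delta> x \<phi>)\<^sup>2) \<le>
      ennreal m * (\<integral>\<^sup>+h. ennreal (indicator ?B h * (\<phi> (x + h) - \<phi> x)\<^sup>2) \<partial>lborel)" for x
  proof -
    have qc: "continuous_on UNIV (\<lambda>h. \<phi> (x + h))"
      by (rule continuous_on_compose2[OF c]) (auto intro!: continuous_intros)
    then have qc': "continuous_on UNIV (\<lambda>h. \<phi> (x + h) - \<phi> x)"
      by (intro continuous_intros)
    note qi = integral_indicator_square_le[OF qc' _ bounded_ball, of 0 \<delta>]
    have "(\<integral>h. indicator ?B h * (\<phi> (x + h) - \<phi> x) \<partial>lborel) =
        (\<integral>h. indicator ?B h * \<phi> (x + h) - indicator ?B h * \<phi> x \<partial>lborel)"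
      by (simp add: right_diff_distrib)
    also have "\<dots> = ball_integral \<delta> x \<phi> - m * \<phi> x"
      unfolding ball_integral_shift[OF c] using f
      by (subst Bochner_Integration.integral_diff[OF integrable_indicator_continuous[OF qc]])
        (auto simp: m_def)
    finally have "(m * \<phi> x - ball_integral \<delta> x \<phi>)\<^sup>2 \<le>
        m * (\<integral>h. indicator ?B h * (\<phi> (x + h) - \<phi> x)\<^sup>2 \<partial>lborel)"
      using qi(2) by (simp add: m_def power2_commute)
    then have "ennreal ((m * \<phi> x - ball_integral \<delta> x \<phi>)\<^sup>2) \<le>
        ennreal m * ennreal (\<integral>h. indicator ?B h * (\<phi> (x + h) - \<phi> x)\<^sup>2 \<partial>lborel)"
      using m0 by (simp add: ennreal_leI flip: ennreal_mult')
    also have "ennreal (\<integral>h. indicator ?B h * (\<phi> (x + h) - \<phi> x)\<^sup>2 \<partial>lborel) =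
        (\<integral>\<^sup>+h. ennreal (indicator ?B h * (\<phi> (x + h) - \<phi> x)\<^sup>2) \<partial>lborel)"
      using qi(1) by (intro nn_integral_eq_integral[symmetric]) auto
    finally show ?thesis .
  qed
  have inner: "(\<integral>\<^sup>+x. ennreal (indicator ?B h * (\<phi> (x + h) - \<phi> x)\<^sup>2) \<partial>lborel) \<le>
      indicator ?B h * ennreal (\<delta>\<^sup>2 * gradient_energy \<phi>)" for h
  proof (cases "h \<in> ?B")
    case True
    then have "(norm h)\<^sup>2 * gradient_energy \<phi> \<le> \<delta>\<^sup>2 * gradient_energy \<phi>"
      by (intro mult_right_mono power_mono gradient_energy_nonneg) auto
    then have "ennreal ((norm h)\<^sup>2 * gradient_energy \<phi>) \<le> ennreal (\<delta>\<^sup>2 * gradient_energy \<phi>)"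
      by (rule ennreal_leI)
    with nn_integral_translation_difference[OF \<phi>, of h] True show ?thesis
      by (simp add: order_trans)
  qed simp
  have "(\<integral>\<^sup>+x. ennreal ((m * \<phi> x - ball_integral \<delta> x \<phi>)\<^sup>2) \<partial>lborel) \<le>
      (\<integral>\<^sup>+x. ennreal m * (\<integral>\<^sup>+h. ennreal (indicator ?B h * (\<phi> (x + h) - \<phi> x)\<^sup>2) \<partial>lborel) \<partial>lborel)"
    by (intro nn_integral_mono pw)
  also have "\<dots> = ennreal m * (\<integral>\<^sup>+x. \<integral>\<^sup>+h. ennreal (indicator ?B h * (\<phi> (x + h) - \<phi> x)\<^sup>2) \<partial>lborel \<partial>lborel)"
    by (rule nn_integral_cmult) measurable
  also have "(\<integral>\<^sup>+x. \<integral>\<^sup>+h. ennreal (indicator ?B h * (\<phi> (x + h) - \<phi> x)\<^sup>2) \<partial>lborel \<partial>lborel) =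
      (\<integral>\<^sup>+h. \<integral>\<^sup>+x. ennreal (indicator ?B h * (\<phi> (x + h) - \<phi> x)\<^sup>2) \<partial>lborel \<partial>lborel)"
    by (rule lborel_pair.Fubini') measurable
  also have "\<dots> \<le> (\<integral>\<^sup>+h. indicator ?B h * ennreal (\<delta>\<^sup>2 * gradient_energy \<phi>) \<partial>lborel)"
    by (intro nn_integral_mono inner)
  also have "\<dots> = ennreal m * ennreal (\<delta>\<^sup>2 * gradient_energy \<phi>)"
    by (simp add: nn_integral_multc em)
  finally have "(\<integral>\<^sup>+x. ennreal ((m * \<phi> x - ball_integral \<delta> x \<phi>)\<^sup>2) \<partial>lborel) \<le>
      ennreal m * (ennreal m * ennreal (\<delta>\<^sup>2 * gradient_energy \<phi>))"
    by (simp add: mult_left_mono)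
  also have "\<dots> = ennreal (m\<^sup>2 * \<delta>\<^sup>2 * gradient_energy \<phi>)"
    using m0 gradient_energy_nonneg[of \<phi>]
    by (simp add: power2_eq_square mult.assoc flip: ennreal_mult')
  finally show ?thesis .
qed

text \<open>Cauchy-Schwarz produces the volume of the ball; then the indicator is dropped and what
  remains is the translation estimate for the shift x - y. This allows finitely many centres to
  control the integrals at all points of a bounded set.\<close>

lemma ball_integral_lipschitz:
  fixes \<phi> :: "real^'n::finite \<Rightarrow> real"
  assumes \<phi>: "\<phi> \<in> test_functions M"
  shows "(ball_integral \<delta> x \<phi> - ball_integral \<delta> y \<phi>)\<^sup>2 \<le>
    measure lborel (ball (0::real^'n) \<delta>) * ((norm (x - y))\<^sup>2 * gradient_energy \<phi>)"
proof -
  let ?B = "ball (0::real^'n) \<delta>"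
  have c: "continuous_on UNIV \<phi>"
    by (rule smooth_continuous_on[OF test_functionsD(1)[OF \<phi>]])
  then have [measurable]: "\<phi> \<in> borel_measurable borel"
    by (rule borel_measurable_continuous_onI)
  have qc: "continuous_on UNIV (\<lambda>h. \<phi> (z + h))" for z
    by (rule continuous_on_compose2[OF c]) (auto intro!: continuous_intros)
  then have qc': "continuous_on UNIV (\<lambda>h. \<phi> (x + h) - \<phi> (y + h))"
    by (intro continuous_intros)
  note qi = integral_indicator_square_le[OF qc' _ bounded_ball, of 0 \<delta>]
  have "ball_integral \<delta> x \<phi> - ball_integral \<delta> y \<phi> =
      (\<integral>h. indicator ?B h * (\<phi> (x + h) - \<phi> (y + h)) \<partial>lborel)"
    unfolding ball_integral_shift[OF c] right_diff_distrib
    by (rule Bochner_Integration.integral_diff[symmetric]; rule integrable_indicator_continuous[OF qc])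
  then have "(ball_integral \<delta> x \<phi> - ball_integral \<delta> y \<phi>)\<^sup>2 \<le>
      measure lborel ?B * (\<integral>h. indicator ?B h * (\<phi> (x + h) - \<phi> (y + h))\<^sup>2 \<partial>lborel)"
    using qi(2) by simp
  also have "(\<integral>h. indicator ?B h * (\<phi> (x + h) - \<phi> (y + h))\<^sup>2 \<partial>lborel) \<le> (norm (x - y))\<^sup>2 * gradient_energy \<phi>"
  proof -
    have "ennreal (\<integral>h. indicator ?B h * (\<phi> (x + h) - \<phi> (y + h))\<^sup>2 \<partial>lborel) =
        (\<integral>\<^sup>+h. ennreal (indicator ?B h * (\<phi> (x + h) - \<phi> (y + h))\<^sup>2) \<partial>lborel)"
      using qi(1) by (intro nn_integral_eq_integral[symmetric]) auto
    also have "\<dots> \<le> (\<integral>\<^sup>+h. ennreal ((\<phi> ((h + y) + (x - y)) - \<phi> (h + y))\<^sup>2) \<partial>lborel)"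
      by (intro nn_integral_mono ennreal_leI) (auto simp: indicator_def add.commute)
    also have "\<dots> = (\<integral>\<^sup>+z. ennreal ((\<phi> (z + (x - y)) - \<phi> z)\<^sup>2) \<partial>lborel)"
      by (rule nn_integral_lborel_translate[of "\<lambda>z. ennreal ((\<phi> (z + (x - y)) - \<phi> z)\<^sup>2)"]) measurable
    also have "\<dots> \<le> ennreal ((norm (x - y))\<^sup>2 * gradient_energy \<phi>)"
      by (rule nn_integral_translation_difference[OF \<phi>])
    finally show ?thesis
      by (simp add: gradient_energy_nonneg)
  qed
  finally show ?thesis
    by (simp add: mult_left_mono)
qed

text \<open>An inequality of Ehrling type: up to a small multiple of the gradient, the L2 norm is
  controlled by finitely many linear functionals that do not depend on \<phi>. Write m \<phi>(x) as
  its averaging error plus the ball integral at x, and replace the latter by its value at a nearby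
  point of a finite net.\<close>

lemma test_function_L2_le_gradient_plus_averages:
  fixes M :: "(real^'n::finite) set"
  assumes M: "open M" "bounded M" and \<epsilon>: "\<epsilon> > 0"
  obtains \<delta> X C where "\<delta> > 0" and "finite X" and "C \<ge> 0"
    and "\<And>\<phi>. \<phi> \<in> test_functions M \<Longrightarrow> (\<integral>x. (\<phi> x)\<^sup>2 \<partial>lborel) \<le>
        \<epsilon> * gradient_energy \<phi> + C * (\<Sum>p\<in>X. (ball_integral \<delta> p \<phi>)\<^sup>2)"
proof -
  \<comment> \<open>With \<open>\<delta>\<^sup>2 = \<epsilon> / 4\<close> the averaging error, which
    enters doubled, uses up half of the allowed \<epsilon>.\<close>
  define \<delta> where "\<delta> = sqrt \<epsilon> / 2"
  define m where "m = measure lborel (ball (0::real^'n) \<delta>)"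
  define L where "L = measure lborel M"
  \<comment> \<open>The mesh of the net: the replacement error contributes 4 m \<eta>^2 L times the
    gradient energy, which is then at most the other half. Dividing by \<open>L + 1\<close> rather
    than \<open>L\<close> also covers \<open>L = 0\<close>.\<close>
  define \<eta> where "\<eta> = sqrt (\<epsilon> * m / (8 * (L + 1)))"
  have \<delta>: "\<delta> > 0" "\<delta>\<^sup>2 = \<epsilon> / 4"
    using \<epsilon> by (auto simp: \<delta>_def power_divide)
  have L0: "L \<ge> 0"
    by (simp add: L_def)
  have eL: "emeasure lborel M = ennreal L"
    using emeasure_bounded_finite[OF M(2)] by (simp add: L_def emeasure_eq_ennreal_measure)
  have m: "m > 0"
    using content_ball_pos[OF \<delta>(1), of "0::real^'n"] by (simp add: m_def measure_completion)
  have \<eta>: "\<eta> > 0" "\<eta>\<^sup>2 = \<epsilon> * m / (8 * (L + 1))"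
    using \<epsilon> m L0 by (auto simp: \<eta>_def)
  have "seq_compact (closure M)"
    using M(2) by (simp add: compact_imp_seq_compact)
  then obtain X where X: "finite X" "closure M \<subseteq> (\<Union>p\<in>X. ball p \<eta>)"
    using seq_compact_imp_totally_bounded[of "closure M"] \<eta>(1) by blast
  define C where "C = 4 * L / m\<^sup>2"
  have "(\<integral>x. (\<phi> x)\<^sup>2 \<partial>lborel) \<le> \<epsilon> * gradient_energy \<phi> + C * (\<Sum>p\<in>X. (ball_integral \<delta> p \<phi>)\<^sup>2)"
    if \<phi>: "\<phi> \<in> test_functions M" for \<phi>
  proof -
    define D where "D = gradient_energy \<phi>"
    define I where "I x = ball_integral \<delta> x \<phi>" for x
    define S where "S = (\<Sum>p\<in>X. (I p)\<^sup>2)"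
    have D0: "D \<ge> 0"
      by (simp add: D_def gradient_energy_nonneg)
    have S0: "S \<ge> 0"
      by (simp add: S_def sum_nonneg)
    have [measurable]: "\<phi> \<in> borel_measurable borel"
      by (rule borel_measurable_continuous_onI[OF smooth_continuous_on[OF test_functionsD(1)[OF \<phi>]]])
    have [measurable]: "ball (0::real^'n) \<delta> \<in> sets borel"
      by simp
    have [measurable]: "I \<in> borel_measurable borel"
      unfolding I_def ball_integral_shift[OF smooth_continuous_on[OF test_functionsD(1)[OF \<phi>]]]
      by measurable
    have [measurable]: "M \<in> sets borel"
      using M(1) by simp
    \<comment> \<open>Two applications of (a + b)^2 \<le> 2 a^2 + 2 b^2 give the factors 2 and 4.
      The indicator reflects that \<phi> vanishes off \<open>M\<close> and makes the constant term
      integrable.\<close>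
    have pw: "m\<^sup>2 * (\<phi> x)\<^sup>2 \<le> 2 * (m * \<phi> x - I x)\<^sup>2 + (4 * S + 4 * m * \<eta>\<^sup>2 * D) * indicator M x" for x
    proof (cases "x \<in> M")
      case False
      then have "x \<notin> closure {x. \<phi> x \<noteq> 0}"
        using test_functionsD(3)[OF \<phi>] by (rule contra_subsetD[rotated])
      then have "\<phi> x = 0"
        by (rule not_in_closure_support)
      then show ?thesis
        using False by simp
    next
      case True
      then obtain p where p: "p \<in> X" "norm (x - p) < \<eta>"
        using X(2) closure_subset[of M] by (force simp: dist_norm norm_minus_commute)
      have sq: "(a + b)\<^sup>2 \<le> 2 * a\<^sup>2 + 2 * b\<^sup>2" for a b :: real
        using norm_add_square_le[of a b] by simp
      have "(I x - I p)\<^sup>2 \<le> m * ((norm (x - p))\<^sup>2 * D)"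
        unfolding I_def m_def D_def by (rule ball_integral_lipschitz[OF \<phi>])
      also have "\<dots> \<le> m * (\<eta>\<^sup>2 * D)"
        using p(2) m D0 by (intro mult_left_mono mult_right_mono power_mono) auto
      finally have 1: "(I x - I p)\<^sup>2 \<le> m * (\<eta>\<^sup>2 * D)" .
      have 2: "(I p)\<^sup>2 \<le> S"
        unfolding S_def using X(1) p(1) by (intro member_le_sum) auto
      have 3: "(I x)\<^sup>2 \<le> 2 * (I x - I p)\<^sup>2 + 2 * (I p)\<^sup>2"
        using sq[of "I x - I p" "I p"] by simp
      have "(m * \<phi> x)\<^sup>2 \<le> 2 * (m * \<phi> x - I x)\<^sup>2 + 2 * (I x)\<^sup>2"
        using sq[of "m * \<phi> x - I x" "I x"] by simp
      with 1 2 3 True show ?thesis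
        by (simp add: power_mult_distrib)
    qed
    have i: "integrable lborel (\<lambda>x. (\<phi> x)\<^sup>2)"
      using square_integrableD(2)[OF test_functions_square_integrable[OF \<phi>]] by simp
    have "ennreal (m\<^sup>2 * (\<integral>x. (\<phi> x)\<^sup>2 \<partial>lborel)) = ennreal (\<integral>x. m\<^sup>2 * (\<phi> x)\<^sup>2 \<partial>lborel)"
      by simp
    also have "\<dots> = (\<integral>\<^sup>+x. ennreal (m\<^sup>2 * (\<phi> x)\<^sup>2) \<partial>lborel)"
      using i by (intro nn_integral_eq_integral[symmetric]) auto
    also have "\<dots> \<le> (\<integral>\<^sup>+x. ennreal 2 * ennreal ((m * \<phi> x - I x)\<^sup>2) +
        ennreal (4 * S + 4 * m * \<eta>\<^sup>2 * D) * indicator M x \<partial>lborel)"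
    proof (rule nn_integral_mono)
      fix x
      have "ennreal (m\<^sup>2 * (\<phi> x)\<^sup>2) \<le> ennreal (2 * (m * \<phi> x - I x)\<^sup>2 + (4 * S + 4 * m * \<eta>\<^sup>2 * D) * indicator M x)"
        by (rule ennreal_leI[OF pw])
      also have "\<dots> = ennreal 2 * ennreal ((m * \<phi> x - I x)\<^sup>2) + ennreal (4 * S + 4 * m * \<eta>\<^sup>2 * D) * indicator M x"
        using S0 D0 m by (subst ennreal_plus) (auto simp: ennreal_mult' ennreal_indicator[symmetric])
      finally show "ennreal (m\<^sup>2 * (\<phi> x)\<^sup>2) \<le>
          ennreal 2 * ennreal ((m * \<phi> x - I x)\<^sup>2) + ennreal (4 * S + 4 * m * \<eta>\<^sup>2 * D) * indicator M x" .
    qed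
    also have "\<dots> = ennreal 2 * (\<integral>\<^sup>+x. ennreal ((m * \<phi> x - I x)\<^sup>2) \<partial>lborel) +
        ennreal (4 * S + 4 * m * \<eta>\<^sup>2 * D) * ennreal L"
      by (subst nn_integral_add) (auto simp: nn_integral_cmult eL)
    also have "\<dots> \<le> ennreal 2 * ennreal (m\<^sup>2 * \<delta>\<^sup>2 * D) + ennreal (4 * S + 4 * m * \<eta>\<^sup>2 * D) * ennreal L"
      unfolding I_def m_def D_def
      by (intro add_right_mono mult_left_mono nn_integral_ball_average_error[OF \<phi> \<delta>(1)]) auto
    also have "\<dots> = ennreal (2 * (m\<^sup>2 * \<delta>\<^sup>2 * D) + (4 * S + 4 * m * \<eta>\<^sup>2 * D) * L)"
      using S0 D0 m L0 by (subst ennreal_plus) (auto simp: ennreal_mult)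
    finally have "m\<^sup>2 * (\<integral>x. (\<phi> x)\<^sup>2 \<partial>lborel) \<le> 2 * (m\<^sup>2 * \<delta>\<^sup>2 * D) + (4 * S + 4 * m * \<eta>\<^sup>2 * D) * L"
      using S0 D0 m L0 by (subst (asm) ennreal_le_iff) auto
    also have "\<dots> = m\<^sup>2 * (\<epsilon> / 2 * D) + 4 * L * S + m\<^sup>2 * (\<epsilon> / 2 * D) * (L / (L + 1))"
      using L0 unfolding \<delta>(2) \<eta>(2) by (simp add: field_simps power2_eq_square)
    also have "\<dots> \<le> m\<^sup>2 * (\<epsilon> / 2 * D) + 4 * L * S + m\<^sup>2 * (\<epsilon> / 2 * D) * 1"
      using L0 \<epsilon> D0 by (intro add_left_mono mult_left_mono) auto
    also have "\<dots> = m\<^sup>2 * (\<epsilon> * D + C * S)"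
      using m by (simp add: C_def algebra_simps)
    finally show ?thesis
      using m by (simp add: D_def S_def I_def)
  qed
  moreover have "C \<ge> 0"
    using L0 by (simp add: C_def)
  ultimately show ?thesis
    using \<delta>(1) X(1) by (intro that) auto
qed

subsection \<open>The Sobolev space\<close>

lemma borel_measurable_vec:
  fixes F :: "'a \<Rightarrow> 'b::euclidean_space^'c::finite"
  assumes "\<And>i. (\<lambda>x. F x $ i) \<in> borel_measurable \<mu>"
  shows "F \<in> borel_measurable \<mu>"
  unfolding borel_measurable_euclidean_space[of F]
proof
  fix b :: "'b^'c" assume "b \<in> Basis"
  then obtain i u where b: "b = axis i u"
    by (auto simp: Basis_vec_def)
  show "(\<lambda>x. F x \<bullet> b) \<in> borel_measurable \<mu>"
    unfolding b inner_axis by (intro borel_measurable_inner assms borel_measurable_const)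
qed

lemma norm_vec_square: "(norm (x :: 'b::euclidean_space^'c::finite))\<^sup>2 = (\<Sum>i\<in>UNIV. (norm (x $ i))\<^sup>2)"
  unfolding power2_norm_eq_inner by (simp add: inner_vec_def)

lemma square_integrable_vec:
  fixes F :: "'a \<Rightarrow> 'b::euclidean_space^'c::finite"
  assumes "\<And>i. square_integrable \<mu> (\<lambda>x. F x $ i)"
  shows "square_integrable \<mu> F"
  unfolding square_integrable_def norm_vec_square
  by (intro conjI borel_measurable_vec Bochner_Integration.integrable_sum square_integrableD assms)

lemma square_integrable_vec_nth:
  fixes F :: "'a \<Rightarrow> 'b::euclidean_space^'c::finite"
  assumes F: "square_integrable \<mu> F"
  shows "square_integrable \<mu> (\<lambda>x. F x $ i)"
proof (rule square_integrable_norm_bound[OF F])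
  show "(\<lambda>x. F x $ i) \<in> borel_measurable \<mu>"
    by (rule measurable_compose[OF square_integrableD(1)[OF F]])
      (intro borel_measurable_continuous_onI continuous_intros)
  show "AE x in \<mu>. norm (F x $ i) \<le> norm (F x)"
    by (intro AE_I2 Finite_Cartesian_Product.norm_nth_le)
qed

lemma square_integrable_Pair:
  assumes F: "square_integrable \<mu> F" and G: "square_integrable \<mu> G"
  shows "square_integrable \<mu> (\<lambda>x. (F x, G x))"
  unfolding square_integrable_def
proof
  show "(\<lambda>x. (F x, G x)) \<in> borel_measurable \<mu>"
    by (intro borel_measurable_Pair square_integrableD(1)[OF F] square_integrableD(1)[OF G])
  have "(norm (F x, G x))\<^sup>2 = (norm (F x))\<^sup>2 + (norm (G x))\<^sup>2" for x
    by (simp add: norm_Pair)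
  then show "integrable \<mu> (\<lambda>x. (norm (F x, G x))\<^sup>2)"
    using square_integrableD(2)[OF F] square_integrableD(2)[OF G] by simp
qed

lemma norm_fst_le_norm: "norm (fst p) \<le> norm p"
  and norm_snd_le_norm: "norm (snd p) \<le> norm p"
  unfolding norm_prod_def by (rule real_le_rsqrt, simp)+

lemma square_integrable_fst:
  assumes F: "square_integrable \<mu> F"
  shows "square_integrable \<mu> (\<lambda>x. fst (F x))"
proof (rule square_integrable_norm_bound[OF F])
  show "(\<lambda>x. fst (F x)) \<in> borel_measurable \<mu>"
    by (rule measurable_compose[OF square_integrableD(1)[OF F]])
      (intro borel_measurable_continuous_onI continuous_intros)
  show "AE x in \<mu>. norm (fst (F x)) \<le> norm (F x)"
    by (intro AE_I2 norm_fst_le_norm)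
qed

lemma square_integrable_snd:
  assumes F: "square_integrable \<mu> F"
  shows "square_integrable \<mu> (\<lambda>x. snd (F x))"
proof (rule square_integrable_norm_bound[OF F])
  show "(\<lambda>x. snd (F x)) \<in> borel_measurable \<mu>"
    by (rule measurable_compose[OF square_integrableD(1)[OF F]])
      (intro borel_measurable_continuous_onI continuous_intros)
  show "AE x in \<mu>. norm (snd (F x)) \<le> norm (F x)"
    by (intro AE_I2 norm_snd_le_norm)
qed

lemma integral_norm_fst_snd_square:
  assumes F: "square_integrable \<mu> F"
  shows "(\<integral>x. (norm (F x))\<^sup>2 \<partial>\<mu>) = (\<integral>x. (norm (fst (F x)))\<^sup>2 \<partial>\<mu>) + (\<integral>x. (norm (snd (F x)))\<^sup>2 \<partial>\<mu>)"
proof -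
  have "(norm (F x))\<^sup>2 = (norm (fst (F x)))\<^sup>2 + (norm (snd (F x)))\<^sup>2" for x
    by (simp add: norm_prod_def)
  then show ?thesis
    using square_integrableD(2)[OF square_integrable_fst[OF F]]
      square_integrableD(2)[OF square_integrable_snd[OF F]]
    by simp
qed

text \<open>Completeness of Lebesgue measure, applied to the extensions by zero. It is needed
  because a chosen weak derivative is only known to agree almost everywhere with a measurable
  one.\<close>

lemma borel_measurable_AE_lebesgue_on:
  fixes f :: "'a::euclidean_space \<Rightarrow> 'b::euclidean_space"
  assumes f: "f \<in> borel_measurable (lebesgue_on M)" and ae: "AE x in lebesgue_on M. f x = g x"
    and M: "M \<in> sets lebesgue"
  shows "g \<in> borel_measurable (lebesgue_on M)"
proof -
  have "(\<lambda>x. if x \<in> M then f x else 0) \<in> borel_measurable lebesgue"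
    using f M by (simp add: borel_measurable_if)
  moreover have "AE x in lebesgue. (if x \<in> M then f x else 0) = (if x \<in> M then g x else 0)"
    using ae M by (auto simp: AE_restrict_space_iff)
  ultimately have "(\<lambda>x. if x \<in> M then g x else 0) \<in> borel_measurable lebesgue"
    by (rule borel_measurable_AE)
  then show ?thesis
    using M by (simp add: borel_measurable_if)
qed

lemma square_integrable_AE_lebesgue_on:
  fixes f :: "'a::euclidean_space \<Rightarrow> 'b::euclidean_space"
  assumes f: "square_integrable (lebesgue_on M) f" and ae: "AE x in lebesgue_on M. f x = g x"
    and M: "M \<in> sets lebesgue"
  shows "square_integrable (lebesgue_on M) g"
  by (rule square_integrable_norm_bound[OF f
        borel_measurable_AE_lebesgue_on[OF square_integrableD(1)[OF f] ae M]])
    (use ae in eventually_elim, simp)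

lemma L2_iff_square_integrable: "f \<in> L2 M \<longleftrightarrow> square_integrable (lebesgue_on M) f"
  by (simp add: L2_def square_integrable_def)

lemma finite_measure_lebesgue_on_bounded:
  fixes M :: "'a::euclidean_space set"
  assumes "open M" and "bounded M"
  shows "finite_measure (lebesgue_on M)"
  using assms by (intro finite_measure_lebesgue_on lmeasurable_open)

text \<open>On a set of finite measure L2 functions are integrable, by pairing with the constant
  1.\<close>

lemma square_integrable_locally_integrable:
  fixes f :: "'a::euclidean_space \<Rightarrow> real"
  assumes M: "open M" "bounded M" and f: "square_integrable (lebesgue_on M) f"
  shows "locally_integrable M f"
  unfolding locally_integrable_def
proof safe
  fix K assume K: "compact K" "K \<subseteq> M"
  interpret finite_measure "lebesgue_on M"
    by (rule finite_measure_lebesgue_on_bounded[OF M])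
  have "square_integrable (lebesgue_on M) (\<lambda>x. 1::real)"
    by (simp add: square_integrable_def)
  from integrable_inner_square_integrable[OF f this] have "integrable (lebesgue_on M) f"
    by simp
  then show "integrable (lebesgue_on K) f"
    using K(2) by (rule integrable_lebesgue_on_subset)
      (use M K in \<open>auto simp: lmeasurable_compact fmeasurableD\<close>)
qed

lemma integral_norm_square_cong_AE:
  assumes "AE x in \<mu>. f x = g x" and "square_integrable \<mu> f" and "square_integrable \<mu> g"
  shows "(\<integral>x. (norm (f x))\<^sup>2 \<partial>\<mu>) = (\<integral>x. (norm (g x))\<^sup>2 \<partial>\<mu>)"
proof (rule integral_cong_AE)
  show "AE x in \<mu>. (norm (f x))\<^sup>2 = (norm (g x))\<^sup>2"
    using assms(1) by eventually_elim simp
qed (use square_integrableD(2)[OF assms(2)] square_integrableD(2)[OF assms(3)] in auto)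

text \<open>Bundles a function with its weak Jacobian, so that the \<open>H1\<close> norm is the L2
  norm of one function and every L2 result applies to it directly.\<close>

definition jet :: "(real^'n::finite) set \<Rightarrow> (real^'n \<Rightarrow> real^'c::finite) \<Rightarrow> real^'n \<Rightarrow> (real^'c) \<times> (real^'n^'c)" where
  "jet M S x = (S x, weak_jacobian M S x)"

lemma fst_jet [simp]: "fst (jet M S x) = S x"
  and snd_jet [simp]: "snd (jet M S x) = weak_jacobian M S x"
  by (simp_all add: jet_def)

lemma H1_norm_jet: "H1_norm M S = sqrt (\<integral>x. (norm (jet M S x))\<^sup>2 \<partial>lebesgue_on M)"
  by (simp add: H1_norm_def jet_def norm_Pair)

lemma weak_jacobian_has_weak_partial:
  assumes "S \<in> H1 M"
  shows "has_weak_partial M j (\<lambda>x. S x $ i) (\<lambda>x. weak_jacobian M S x $ i $ j)"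
proof -
  obtain f' where "has_weak_partial M j (\<lambda>x. S x $ i) f'"
    using assms by (auto simp: H1_def H1_scalar_def)
  then have "has_weak_partial M j (\<lambda>x. S x $ i) (weak_partial M j (\<lambda>x. S x $ i))"
    unfolding weak_partial_def by (rule someI[of "has_weak_partial M j (\<lambda>x. S x $ i)"])
  then show ?thesis
    by (simp add: weak_jacobian_def)
qed

text \<open>Membership in \<open>H1\<close> provides some square integrable weak derivative for each
  entry. The entry picked by choice agrees with it almost everywhere and so inherits the
  property.\<close>

lemma weak_jacobian_square_integrable:
  fixes S :: "real^'n::finite \<Rightarrow> real^'c::finite"
  assumes M: "open M" and S: "S \<in> H1 M"
  shows "square_integrable (lebesgue_on M) (weak_jacobian M S)"
proof (intro square_integrable_vec)
  fix i j
  obtain f' where f': "f' \<in> L2 M" "has_weak_partial M j (\<lambda>x. S x $ i) f'"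
    using S unfolding H1_def H1_scalar_def by blast
  show "square_integrable (lebesgue_on M) (\<lambda>x. weak_jacobian M S x $ i $ j)"
  proof (rule square_integrable_AE_lebesgue_on)
    show "square_integrable (lebesgue_on M) f'"
      using f'(1) by (simp add: L2_iff_square_integrable)
    show "AE x in lebesgue_on M. f' x = weak_jacobian M S x $ i $ j"
      by (rule has_weak_partial_unique[OF M f'(2) weak_jacobian_has_weak_partial[OF S]])
  qed (use M in simp)
qed

lemma jet_square_integrable:
  fixes S :: "real^'n::finite \<Rightarrow> real^'c::finite"
  assumes M: "open M" and S: "S \<in> H1 M"
  shows "square_integrable (lebesgue_on M) (jet M S)"
proof -
  have "square_integrable (lebesgue_on M) S"
    using S by (intro square_integrable_vec) (auto simp: H1_def H1_scalar_def L2_iff_square_integrable)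
  from square_integrable_Pair[OF this weak_jacobian_square_integrable[OF M S]] show ?thesis
    by (simp add: jet_def[abs_def])
qed

text \<open>Identifies the jet once a weak derivative \<open>G\<close> is exhibited; linear
  combinations, test functions and limits all pass through here. There are finitely many entries, so
  their exceptional sets form one null set.\<close>

lemma H1I:
  fixes S :: "real^'n::finite \<Rightarrow> real^'c::finite"
  assumes M: "open M" and S: "square_integrable (lebesgue_on M) S"
    and G: "square_integrable (lebesgue_on M) G"
    and weak: "\<And>i j. has_weak_partial M j (\<lambda>x. S x $ i) (\<lambda>x. G x $ i $ j)"
  shows "S \<in> H1 M" and "AE x in lebesgue_on M. jet M S x = (S x, G x)"
proof -
  have l2: "(\<lambda>x. S x $ i) \<in> L2 M" "(\<lambda>x. G x $ i $ j) \<in> L2 M" for i j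
    unfolding L2_iff_square_integrable by (intro square_integrable_vec_nth S G)+
  show "S \<in> H1 M"
    unfolding H1_def H1_scalar_def mem_Collect_eq
    by (intro allI conjI l2(1)) (rule bexI, rule weak, rule l2(2))
  have "AE x in lebesgue_on M. weak_partial M j (\<lambda>x. S x $ i) x = G x $ i $ j" for i j
    by (rule weak_partial_AE[OF M weak])
  then have "AE x in lebesgue_on M. \<forall>i j. weak_partial M j (\<lambda>x. S x $ i) x = G x $ i $ j"
    by (simp only: AE_all_countable) blast
  then show "AE x in lebesgue_on M. jet M S x = (S x, G x)"
  proof eventually_elim
    case (elim x)
    then have "weak_jacobian M S x $ i $ j = G x $ i $ j" for i j
      unfolding weak_jacobian_def by simp
    then show ?case
      unfolding jet_def by (simp add: vec_eq_iff)
  qed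
qed

lemma H1_lincomb:
  fixes S T :: "real^'n::finite \<Rightarrow> real^'c::finite"
  assumes M: "open M" and S: "S \<in> H1 M" and T: "T \<in> H1 M"
  shows "(\<lambda>x. a *\<^sub>R S x + b *\<^sub>R T x) \<in> H1 M"
    and "AE x in lebesgue_on M. jet M (\<lambda>x. a *\<^sub>R S x + b *\<^sub>R T x) x = a *\<^sub>R jet M S x + b *\<^sub>R jet M T x"
proof -
  let ?G = "\<lambda>x. a *\<^sub>R weak_jacobian M S x + b *\<^sub>R weak_jacobian M T x"
  have s: "square_integrable (lebesgue_on M) S" "square_integrable (lebesgue_on M) T"
    using square_integrable_fst[OF jet_square_integrable[OF M S]]
      square_integrable_fst[OF jet_square_integrable[OF M T]] by simp_all
  have weak: "has_weak_partial M j (\<lambda>x. (a *\<^sub>R S x + b *\<^sub>R T x) $ i) (\<lambda>x. ?G x $ i $ j)" for i j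
  proof -
    have "has_weak_partial M j (\<lambda>x. a * S x $ i + b * T x $ i)
        (\<lambda>x. a * weak_jacobian M S x $ i $ j + b * weak_jacobian M T x $ i $ j)"
      by (rule has_weak_partial_lincomb[OF _ weak_jacobian_has_weak_partial[OF S]
            weak_jacobian_has_weak_partial[OF T]]) (use M in simp)
    then show ?thesis
      by simp
  qed
  note * = H1I[OF M square_integrable_lincomb[OF s]
      square_integrable_lincomb[OF weak_jacobian_square_integrable[OF M S]
        weak_jacobian_square_integrable[OF M T]] weak]
  show "(\<lambda>x. a *\<^sub>R S x + b *\<^sub>R T x) \<in> H1 M"
    by (rule *(1))
  show "AE x in lebesgue_on M. jet M (\<lambda>x. a *\<^sub>R S x + b *\<^sub>R T x) x = a *\<^sub>R jet M S x + b *\<^sub>R jet M T x"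
    using *(2) by eventually_elim (simp add: jet_def)
qed

lemma H1_diff:
  fixes S T :: "real^'n::finite \<Rightarrow> real^'c::finite"
  assumes M: "open M" and S: "S \<in> H1 M" and T: "T \<in> H1 M"
  shows "(\<lambda>x. S x - T x) \<in> H1 M"
    and "AE x in lebesgue_on M. jet M (\<lambda>x. S x - T x) x = jet M S x - jet M T x"
  using H1_lincomb[OF assms, of 1 "-1"] by simp_all

definition classical_jacobian :: "(real^'n::finite \<Rightarrow> real^'c::finite) \<Rightarrow> real^'n \<Rightarrow> real^'n^'c" where
  "classical_jacobian \<phi> x = (\<chi> i j. frechet_derivative (\<lambda>y. \<phi> y $ i) (at x) (axis j 1))"

text \<open>The second claim rewrites the \<open>H1\<close> norm through integrals over the whole
  space, the form in which the gradient estimates are stated.\<close>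

lemma test_functions_H1:
  fixes \<phi> :: "real^'n::finite \<Rightarrow> real^'c::finite"
  assumes M: "open M" and \<phi>: "\<phi> \<in> test_functions M"
  shows "\<phi> \<in> H1 M"
    and "(\<integral>x. (norm (jet M \<phi> x))\<^sup>2 \<partial>lebesgue_on M) =
      (\<integral>x. (norm (\<phi> x))\<^sup>2 \<partial>lborel) + (\<Sum>i\<in>UNIV. gradient_energy (\<lambda>x. \<phi> x $ i))"
proof -
  have Ms: "M \<in> sets lebesgue"
    using M by simp
  have c: "(\<lambda>x. \<phi> x $ i) \<in> test_functions M" for i
    by (rule test_functions_bounded_linear[OF bounded_linear_vec_nth \<phi>])
  have s: "square_integrable lborel \<phi>"
    by (rule test_functions_square_integrable[OF \<phi>])
  have dc: "(\<lambda>x. classical_jacobian \<phi> x $ i $ j) \<in> test_functions M" for i j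
    using test_functions_frechet_derivative[OF c] by (simp add: classical_jacobian_def)
  have G: "square_integrable lborel (classical_jacobian \<phi>)"
    by (intro square_integrable_vec test_functions_square_integrable[OF dc])
  have weak: "has_weak_partial M j (\<lambda>x. \<phi> x $ i) (\<lambda>x. classical_jacobian \<phi> x $ i $ j)" for i j
    using test_functions_has_weak_partial[OF Ms c] by (simp add: classical_jacobian_def)
  note * = H1I[OF M square_integrable_lebesgue_on[OF s Ms] square_integrable_lebesgue_on[OF G Ms] weak]
  show H: "\<phi> \<in> H1 M"
    by (rule *(1))
  have p: "square_integrable lborel (\<lambda>x. (\<phi> x, classical_jacobian \<phi> x))"
    by (rule square_integrable_Pair[OF s G])
  have zero: "(\<phi> x, classical_jacobian \<phi> x) = 0" if "x \<notin> M" for x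
  proof -
    have out: "\<psi> x = 0" if "\<psi> \<in> test_functions M" for \<psi> :: "real^'n \<Rightarrow> 'z::real_normed_vector"
      using test_functionsD(3)[OF that] \<open>x \<notin> M\<close> by (intro not_in_closure_support[of x \<psi>]) blast
    from out[OF \<phi>] out[OF dc] show ?thesis
      by (simp add: vec_eq_iff prod_eq_iff)
  qed
  have "(\<integral>x. (norm (jet M \<phi> x))\<^sup>2 \<partial>lebesgue_on M) =
      (\<integral>x. (norm (\<phi> x, classical_jacobian \<phi> x))\<^sup>2 \<partial>lebesgue_on M)"
    by (rule integral_norm_square_cong_AE[OF *(2) jet_square_integrable[OF M H]
          square_integrable_lebesgue_on[OF p Ms]])
  also have "\<dots> = (\<integral>x. (norm (\<phi> x, classical_jacobian \<phi> x))\<^sup>2 \<partial>lborel)"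
    using square_integrableD(2)[OF p] zero by (intro integral_lebesgue_on_eq_lborel[OF Ms]) auto
  also have "\<dots> = (\<integral>x. (norm (\<phi> x))\<^sup>2 \<partial>lborel) + (\<integral>x. (norm (classical_jacobian \<phi> x))\<^sup>2 \<partial>lborel)"
    using integral_norm_fst_snd_square[OF p] by simp
  also have "(\<integral>x. (norm (classical_jacobian \<phi> x))\<^sup>2 \<partial>lborel) =
      (\<integral>x. (\<Sum>i\<in>UNIV. \<Sum>j\<in>UNIV. (frechet_derivative (\<lambda>y. \<phi> y $ i) (at x) (axis j 1))\<^sup>2) \<partial>lborel)"
    by (simp add: norm_vec_square classical_jacobian_def)
  also have "\<dots> = (\<Sum>i\<in>UNIV. gradient_energy (\<lambda>x. \<phi> x $ i))"
    unfolding gradient_energy_def by (intro Bochner_Integration.integral_sum gradient_integrable[OF c])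
  finally show "(\<integral>x. (norm (jet M \<phi> x))\<^sup>2 \<partial>lebesgue_on M) =
      (\<integral>x. (norm (\<phi> x))\<^sup>2 \<partial>lborel) + (\<Sum>i\<in>UNIV. gradient_energy (\<lambda>x. \<phi> x $ i))" .
qed

lemma test_functions_integral_lebesgue_on:
  fixes \<phi> :: "real^'n::finite \<Rightarrow> real^'c::finite"
  assumes M: "open M" and \<phi>: "\<phi> \<in> test_functions M"
  shows "(\<integral>x. (norm (\<phi> x))\<^sup>2 \<partial>lebesgue_on M) = (\<integral>x. (norm (\<phi> x))\<^sup>2 \<partial>lborel)"
proof (rule integral_lebesgue_on_eq_lborel)
  show "(\<lambda>x. (norm (\<phi> x))\<^sup>2) \<in> borel_measurable borel"
    using square_integrableD(2)[OF test_functions_square_integrable[OF \<phi>]] by auto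
  show "(norm (\<phi> x))\<^sup>2 = 0" if "x \<notin> M" for x
  proof -
    have "\<phi> x = 0"
      using test_functionsD(3)[OF \<phi>] that by (intro not_in_closure_support[of x \<phi>]) blast
    then show ?thesis
      by simp
  qed
qed (use M in simp)

text \<open>Both sides of the defining identity are inner products with fixed square integrable
  functions, hence continuous under L2 convergence.\<close>

lemma has_weak_partial_L2_limit:
  fixes f :: "real^'n::finite \<Rightarrow> real"
  assumes M: "open M" "bounded M"
    and weak: "\<And>k. has_weak_partial M j (F k) (F' k)"
    and F: "\<And>k. square_integrable (lebesgue_on M) (F k)" "\<And>k. square_integrable (lebesgue_on M) (F' k)"
    and f: "square_integrable (lebesgue_on M) f" "square_integrable (lebesgue_on M) f'"
    and lim: "(\<lambda>k. \<integral>x. (norm (F k x - f x))\<^sup>2 \<partial>lebesgue_on M) \<longlonglongrightarrow> 0"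
      "(\<lambda>k. \<integral>x. (norm (F' k x - f' x))\<^sup>2 \<partial>lebesgue_on M) \<longlonglongrightarrow> 0"
  shows "has_weak_partial M j f f'"
  unfolding has_weak_partial_def
proof (intro conjI ballI square_integrable_locally_integrable[OF M] f)
  fix \<phi> :: "real^'n \<Rightarrow> real" assume \<phi>: "\<phi> \<in> test_functions M"
  have Ms: "M \<in> sets lebesgue"
    using M by simp
  let ?d = "\<lambda>x. frechet_derivative \<phi> (at x) (axis j 1)"
  have s: "square_integrable (lebesgue_on M) \<phi>" "square_integrable (lebesgue_on M) ?d"
    by (intro square_integrable_lebesgue_on test_functions_square_integrable[OF \<phi>]
        test_functions_square_integrable[OF test_functions_frechet_derivative[OF \<phi>]] Ms)+
  have "(\<lambda>k. \<integral>x. F k x * ?d x \<partial>lebesgue_on M) \<longlonglongrightarrow> (\<integral>x. f x * ?d x \<partial>lebesgue_on M)"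
    using tendsto_integral_inner[OF F(1) f(1) s(2) lim(1)] by simp
  moreover have "(\<lambda>k. - (\<integral>x. F' k x * \<phi> x \<partial>lebesgue_on M)) \<longlonglongrightarrow> - (\<integral>x. f' x * \<phi> x \<partial>lebesgue_on M)"
    using tendsto_minus[OF tendsto_integral_inner[OF F(2) f(2) s(1) lim(2)]] by simp
  moreover have "(\<integral>x. F k x * ?d x \<partial>lebesgue_on M) = - (\<integral>x. F' k x * \<phi> x \<partial>lebesgue_on M)" for k
    using weak \<phi> by (simp add: has_weak_partial_def)
  ultimately show "(\<integral>x. f x * ?d x \<partial>lebesgue_on M) = - (\<integral>x. f' x * \<phi> x \<partial>lebesgue_on M)"
    using LIMSEQ_unique by simp
qed

lemma tendsto_integral_norm_le:
  fixes F :: "nat \<Rightarrow> 'a \<Rightarrow> 'b::euclidean_space" and G :: "nat \<Rightarrow> 'a \<Rightarrow> 'c::euclidean_space"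
  assumes F: "\<And>k. square_integrable \<mu> (F k)" and G: "\<And>k. square_integrable \<mu> (G k)"
    and le: "\<And>k x. norm (F k x) \<le> norm (G k x)"
    and lim: "(\<lambda>k. \<integral>x. (norm (G k x))\<^sup>2 \<partial>\<mu>) \<longlonglongrightarrow> 0"
  shows "(\<lambda>k. \<integral>x. (norm (F k x))\<^sup>2 \<partial>\<mu>) \<longlonglongrightarrow> 0"
proof (rule tendsto_sandwich[OF _ _ tendsto_const lim])
  show "\<forall>\<^sub>F k in sequentially. (\<integral>x. (norm (F k x))\<^sup>2 \<partial>\<mu>) \<le> (\<integral>x. (norm (G k x))\<^sup>2 \<partial>\<mu>)"
    using F G le
    by (intro always_eventually allI integral_mono square_integrableD(2) power_mono) auto
qed simp

text \<open>An L2 limit of jets is again a jet, because each weak derivative identity survives the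
  limit. Together with completeness of L2 this makes \<open>H1 M\<close> complete.\<close>

lemma H1_closed:
  fixes S :: "nat \<Rightarrow> real^'n::finite \<Rightarrow> real^'c::finite"
  assumes M: "open M" "bounded M" and S: "\<And>k. S k \<in> H1 M"
    and F: "square_integrable (lebesgue_on M) F"
    and lim: "(\<lambda>k. \<integral>x. (norm (jet M (S k) x - F x))\<^sup>2 \<partial>lebesgue_on M) \<longlonglongrightarrow> 0"
  shows "(\<lambda>x. fst (F x)) \<in> H1 M" and "AE x in lebesgue_on M. jet M (\<lambda>x. fst (F x)) x = F x"
proof -
  note js = jet_square_integrable[OF M(1) S]
  note d = square_integrable_diff[OF js F]
  note f = square_integrable_fst[OF F] and g = square_integrable_snd[OF F]
  have weak: "has_weak_partial M j (\<lambda>x. fst (F x) $ i) (\<lambda>x. snd (F x) $ i $ j)" for i j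
  proof (rule has_weak_partial_L2_limit[OF M weak_jacobian_has_weak_partial[OF S]])
    show "square_integrable (lebesgue_on M) (\<lambda>x. S k x $ i)" for k
      using square_integrable_vec_nth[OF square_integrable_fst[OF js]] by simp
    show "square_integrable (lebesgue_on M) (\<lambda>x. weak_jacobian M (S k) x $ i $ j)" for k
      by (intro square_integrable_vec_nth weak_jacobian_square_integrable M S)
    show "square_integrable (lebesgue_on M) (\<lambda>x. fst (F x) $ i)"
      "square_integrable (lebesgue_on M) (\<lambda>x. snd (F x) $ i $ j)"
      by (intro square_integrable_vec_nth f g)+
    have 1: "norm (S k x $ i - fst (F x) $ i) \<le> norm (jet M (S k) x - F x)" for k x
    proof -
      have "norm (S k x $ i - fst (F x) $ i) \<le> norm (fst (jet M (S k) x - F x))"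
        using Finite_Cartesian_Product.norm_nth_le[of "fst (jet M (S k) x - F x)" i] by simp
      also have "\<dots> \<le> norm (jet M (S k) x - F x)"
        by (rule norm_fst_le_norm)
      finally show ?thesis .
    qed
    have 2: "norm (weak_jacobian M (S k) x $ i $ j - snd (F x) $ i $ j) \<le> norm (jet M (S k) x - F x)" for k x
    proof -
      have "norm (weak_jacobian M (S k) x $ i $ j - snd (F x) $ i $ j) \<le> norm (snd (jet M (S k) x - F x) $ i)"
        using Finite_Cartesian_Product.norm_nth_le[of "snd (jet M (S k) x - F x) $ i" j] by simp
      also have "\<dots> \<le> norm (snd (jet M (S k) x - F x))"
        by (rule Finite_Cartesian_Product.norm_nth_le)
      also have "\<dots> \<le> norm (jet M (S k) x - F x)"
        by (rule norm_snd_le_norm)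
      finally show ?thesis .
    qed
    show "(\<lambda>k. \<integral>x. (norm (S k x $ i - fst (F x) $ i))\<^sup>2 \<partial>lebesgue_on M) \<longlonglongrightarrow> 0"
      by (rule tendsto_integral_norm_le[OF _ d 1 lim])
        (use square_integrable_vec_nth[OF square_integrable_fst[OF d]] in simp)
    show "(\<lambda>k. \<integral>x. (norm (weak_jacobian M (S k) x $ i $ j - snd (F x) $ i $ j))\<^sup>2 \<partial>lebesgue_on M) \<longlonglongrightarrow> 0"
      by (rule tendsto_integral_norm_le[OF _ d 2 lim])
        (use square_integrable_vec_nth[OF square_integrable_vec_nth[OF square_integrable_snd[OF d]]] in simp)
  qed
  show "(\<lambda>x. fst (F x)) \<in> H1 M" "AE x in lebesgue_on M. jet M (\<lambda>x. fst (F x)) x = F x"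
    using H1I[OF M(1) f g weak] by simp_all
qed

lemma integral_jet_diff:
  fixes S T :: "real^'n::finite \<Rightarrow> real^'c::finite"
  assumes M: "open M" and S: "S \<in> H1 M" and T: "T \<in> H1 M"
  shows "(\<integral>x. (norm (jet M (\<lambda>x. S x - T x) x))\<^sup>2 \<partial>lebesgue_on M) =
    (\<integral>x. (norm (jet M S x - jet M T x))\<^sup>2 \<partial>lebesgue_on M)"
  by (rule integral_norm_square_cong_AE[OF H1_diff(2)[OF assms] jet_square_integrable[OF M H1_diff(1)[OF assms]]
        square_integrable_diff[OF jet_square_integrable[OF M S] jet_square_integrable[OF M T]]])

section \<open>The closure of the test functions\<close>

lemma all_pos_sqrt_less_iff:
  "(\<forall>e>0. \<exists>\<phi>\<in>T. sqrt (Q \<phi>) < e) \<longleftrightarrow> (\<forall>e>0. \<exists>\<phi>\<in>T. Q \<phi> < e)"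
proof
  assume L: "\<forall>e>0. \<exists>\<phi>\<in>T. sqrt (Q \<phi>) < e"
  show "\<forall>e>0. \<exists>\<phi>\<in>T. Q \<phi> < e"
  proof (intro allI impI)
    fix e :: real assume "e > 0"
    then have "\<exists>\<phi>\<in>T. sqrt (Q \<phi>) < sqrt e"
      by (intro L[rule_format]) simp
    then show "\<exists>\<phi>\<in>T. Q \<phi> < e"
      by simp
  qed
next
  assume R: "\<forall>e>0. \<exists>\<phi>\<in>T. Q \<phi> < e"
  show "\<forall>e>0. \<exists>\<phi>\<in>T. sqrt (Q \<phi>) < e"
  proof (intro allI impI)
    fix e :: real assume e: "e > 0"
    then obtain \<phi> where "\<phi> \<in> T" "Q \<phi> < e\<^sup>2"
      using R zero_less_power[of e 2] by blast
    with e show "\<exists>\<phi>\<in>T. sqrt (Q \<phi>) < e"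
      using real_less_lsqrt[of e "Q \<phi>"] by auto
  qed
qed

text \<open>The working form of the definition: squared norms without roots, and a difference of
  jets in place of the jet of a difference.\<close>

lemma H1_0_iff:
  fixes S :: "real^'n::finite \<Rightarrow> real^'c::finite"
  assumes M: "open M"
  shows "S \<in> H1_0 M \<longleftrightarrow> S \<in> H1 M \<and>
    (\<forall>e>0. \<exists>\<phi>\<in>test_functions M. (\<integral>x. (norm (jet M \<phi> x - jet M S x))\<^sup>2 \<partial>lebesgue_on M) < e)"
proof -
  have "H1_norm M (\<lambda>x. \<phi> x - S x) = sqrt (\<integral>x. (norm (jet M \<phi> x - jet M S x))\<^sup>2 \<partial>lebesgue_on M)"
    if "S \<in> H1 M" "\<phi> \<in> test_functions M" for \<phi>
    using that by (simp add: H1_norm_jet integral_jet_diff[OF M test_functions_H1(1)[OF M]])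
  then have "S \<in> H1_0 M \<longleftrightarrow> S \<in> H1 M \<and> (\<forall>e>0. \<exists>\<phi>\<in>test_functions M.
      sqrt (\<integral>x. (norm (jet M \<phi> x - jet M S x))\<^sup>2 \<partial>lebesgue_on M) < e)"
    unfolding H1_0_def by (auto cong: bex_cong)
  also have "\<dots> \<longleftrightarrow> S \<in> H1 M \<and> (\<forall>e>0. \<exists>\<phi>\<in>test_functions M.
      (\<integral>x. (norm (jet M \<phi> x - jet M S x))\<^sup>2 \<partial>lebesgue_on M) < e)"
    by (subst all_pos_sqrt_less_iff) (rule refl)
  finally show ?thesis .
qed

lemma H1_0_lincomb:
  fixes S T :: "real^'n::finite \<Rightarrow> real^'c::finite"
  assumes M: "open M" and S: "S \<in> H1_0 M" and T: "T \<in> H1_0 M"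
  shows "(\<lambda>x. a *\<^sub>R S x + b *\<^sub>R T x) \<in> H1_0 M"
  unfolding H1_0_iff[OF M]
proof (intro conjI allI impI)
  have H: "S \<in> H1 M" "T \<in> H1 M"
    using S T by (auto simp: H1_0_iff[OF M])
  show HST: "(\<lambda>x. a *\<^sub>R S x + b *\<^sub>R T x) \<in> H1 M"
    by (rule H1_lincomb(1)[OF M H])
  fix e :: real assume e: "e > 0"
  \<comment> \<open>The squared error of the combination is at most (2 a^2 + 2 b^2) e'. The
    \<open>+ 1\<close> makes the final bound strict and covers a = b = 0.\<close>
  define e' where "e' = e / (2 * a\<^sup>2 + 2 * b\<^sup>2 + 1)"
  have p: "2 * a\<^sup>2 + 2 * b\<^sup>2 + 1 > 0"
    using zero_le_power2[of a] zero_le_power2[of b] by linarith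
  with e have e': "e' > 0"
    by (simp add: e'_def)
  obtain \<phi> where \<phi>: "\<phi> \<in> test_functions M" "(\<integral>x. (norm (jet M \<phi> x - jet M S x))\<^sup>2 \<partial>lebesgue_on M) < e'"
    using S e' unfolding H1_0_iff[OF M] by blast
  obtain \<psi> where \<psi>: "\<psi> \<in> test_functions M" "(\<integral>x. (norm (jet M \<psi> x - jet M T x))\<^sup>2 \<partial>lebesgue_on M) < e'"
    using T e' unfolding H1_0_iff[OF M] by blast
  let ?\<chi> = "\<lambda>x. a *\<^sub>R \<phi> x + b *\<^sub>R \<psi> x" and ?U = "\<lambda>x. a *\<^sub>R S x + b *\<^sub>R T x"
  have \<chi>: "?\<chi> \<in> test_functions M"
    by (rule test_functions_lincomb[OF \<phi>(1) \<psi>(1)])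
  note h = test_functions_H1(1)[OF M \<phi>(1)] test_functions_H1(1)[OF M \<psi>(1)]
  have A: "square_integrable (lebesgue_on M) (\<lambda>x. jet M \<phi> x - jet M S x)"
    "square_integrable (lebesgue_on M) (\<lambda>x. jet M \<psi> x - jet M T x)"
    by (intro square_integrable_diff jet_square_integrable M h H)+
  let ?V = "\<lambda>x. a *\<^sub>R (jet M \<phi> x - jet M S x) + b *\<^sub>R (jet M \<psi> x - jet M T x)"
  have ae: "AE x in lebesgue_on M. jet M ?\<chi> x - jet M ?U x = ?V x"
    using H1_lincomb(2)[OF M h, of a b] H1_lincomb(2)[OF M H, of a b]
    by eventually_elim (simp add: scaleR_diff_right)
  have "(\<integral>x. (norm (jet M ?\<chi> x - jet M ?U x))\<^sup>2 \<partial>lebesgue_on M) = (\<integral>x. (norm (?V x))\<^sup>2 \<partial>lebesgue_on M)"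
    by (rule integral_norm_square_cong_AE[OF ae])
      (intro square_integrable_diff jet_square_integrable M test_functions_H1(1)[OF M \<chi>] HST
        square_integrable_lincomb A)+
  also have "\<dots> \<le> 2 * (\<integral>x. (norm (a *\<^sub>R (jet M \<phi> x - jet M S x)))\<^sup>2 \<partial>lebesgue_on M) +
      2 * (\<integral>x. (norm (b *\<^sub>R (jet M \<psi> x - jet M T x)))\<^sup>2 \<partial>lebesgue_on M)"
    by (intro integral_norm_add_square_le square_integrable_scaleR A)
  also have "\<dots> = 2 * a\<^sup>2 * (\<integral>x. (norm (jet M \<phi> x - jet M S x))\<^sup>2 \<partial>lebesgue_on M) +
      2 * b\<^sup>2 * (\<integral>x. (norm (jet M \<psi> x - jet M T x))\<^sup>2 \<partial>lebesgue_on M)"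
    by (simp add: power_mult_distrib)
  also have "\<dots> \<le> 2 * a\<^sup>2 * e' + 2 * b\<^sup>2 * e'"
    using \<phi>(2) \<psi>(2) by (intro add_mono mult_left_mono) auto
  also have "\<dots> < (2 * a\<^sup>2 + 2 * b\<^sup>2 + 1) * e'"
    using e' by (simp add: algebra_simps)
  also have "\<dots> = e"
    using p by (simp add: e'_def)
  finally show "\<exists>\<phi>\<in>test_functions M. (\<integral>x. (norm (jet M \<phi> x - jet M ?U x))\<^sup>2 \<partial>lebesgue_on M) < e"
    using \<chi> by blast
qed

lemma H1_0_closed:
  fixes S :: "nat \<Rightarrow> real^'n::finite \<Rightarrow> real^'c::finite"
  assumes M: "open M" and S: "\<And>k. S k \<in> H1_0 M" and T: "T \<in> H1 M"
    and lim: "(\<lambda>k. \<integral>x. (norm (jet M (S k) x - jet M T x))\<^sup>2 \<partial>lebesgue_on M) \<longlonglongrightarrow> 0"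
  shows "T \<in> H1_0 M"
  unfolding H1_0_iff[OF M]
proof (intro conjI allI impI T)
  have H: "S k \<in> H1 M" for k
    using S by (auto simp: H1_0_iff[OF M])
  fix e :: real assume e: "e > 0"
  \<comment> \<open>Each of the two distances enters with a factor 2 in the squared triangle
    inequality, hence \<open>e / 4\<close>.\<close>
  then obtain k where k: "(\<integral>x. (norm (jet M (S k) x - jet M T x))\<^sup>2 \<partial>lebesgue_on M) < e / 4"
    using order_tendstoD(2)[OF lim, of "e / 4"] by (auto simp: eventually_sequentially)
  obtain \<phi> where \<phi>: "\<phi> \<in> test_functions M" "(\<integral>x. (norm (jet M \<phi> x - jet M (S k) x))\<^sup>2 \<partial>lebesgue_on M) < e / 4"
    using S[of k] e unfolding H1_0_iff[OF M] by (meson divide_pos_pos zero_less_numeral)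
  have "(\<integral>x. (norm (jet M \<phi> x - jet M T x))\<^sup>2 \<partial>lebesgue_on M) < e"
    using integral_norm_diff_square_triangle[OF jet_square_integrable[OF M test_functions_H1(1)[OF M \<phi>(1)]]
        jet_square_integrable[OF M H[of k]] jet_square_integrable[OF M T]] k \<phi>(2)
    by linarith
  with \<phi>(1) show "\<exists>\<phi>\<in>test_functions M. (\<integral>x. (norm (jet M \<phi> x - jet M T x))\<^sup>2 \<partial>lebesgue_on M) < e"
    by blast
qed

subsection \<open>Rellich compactness\<close>

lemma ball_integral_nth:
  fixes f :: "'a::euclidean_space \<Rightarrow> real^'c::finite"
  assumes "integrable lborel f"
  shows "ball_integral \<delta> p (\<lambda>x. f x $ i) = ball_integral \<delta> p f $ i"
proof -
  have "integrable lborel (\<lambda>y. indicator (ball p \<delta>) y *\<^sub>R f y)"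
    using assms by (rule integrable_mult_indicator[rotated]) simp
  from integral_bounded_linear[OF bounded_linear_vec_nth[of i] this] show ?thesis
    by (simp add: ball_integral_def)
qed

lemma ball_integral_diff:
  fixes f g :: "'a::euclidean_space \<Rightarrow> 'b::euclidean_space"
  assumes f: "integrable lborel f" and g: "integrable lborel g"
  shows "ball_integral \<delta> p (\<lambda>x. f x - g x) = ball_integral \<delta> p f - ball_integral \<delta> p g"
proof -
  have "integrable lborel (\<lambda>y. indicator (ball p \<delta>) y *\<^sub>R f y)"
    "integrable lborel (\<lambda>y. indicator (ball p \<delta>) y *\<^sub>R g y)"
    using f g by (auto intro!: integrable_mult_indicator)
  then show ?thesis
    by (simp add: ball_integral_def scaleR_diff_right)
qed

text \<open>From t \<le> 1 + t^2 on \<open>M\<close>, with \<phi> zero elsewhere. The bound is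
  uniform in the centre and the radius, which is what the extraction of a convergent subsequence
  requires.\<close>

lemma norm_ball_integral_le:
  fixes \<phi> :: "real^'n::finite \<Rightarrow> real^'c::finite"
  assumes M: "open M" "bounded M" and \<phi>: "\<phi> \<in> test_functions M"
  shows "norm (ball_integral \<delta> p \<phi>) \<le> measure lborel M + (\<integral>x. (norm (\<phi> x))\<^sup>2 \<partial>lborel)"
proof -
  have f: "emeasure lborel M < \<infinity>"
    by (rule emeasure_bounded_finite[OF M(2)])
  have i: "integrable lborel (\<lambda>x. (norm (\<phi> x))\<^sup>2)"
    by (rule square_integrableD(2)[OF test_functions_square_integrable[OF \<phi>]])
  have iM: "integrable lborel (indicator M :: real^'n \<Rightarrow> real)"
    using f M(1) by simp
  have "norm (ball_integral \<delta> p \<phi>) \<le> (\<integral>x. indicator M x + (norm (\<phi> x))\<^sup>2 \<partial>lborel)"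
    unfolding ball_integral_def
  proof (rule Bochner_Integration.integral_norm_bound_integral)
    show "integrable lborel (\<lambda>y. indicator (ball p \<delta>) y *\<^sub>R \<phi> y)"
      using test_functions_integrable[OF \<phi>] by (rule integrable_mult_indicator[rotated]) simp
    show "integrable lborel (\<lambda>x. indicator M x + (norm (\<phi> x))\<^sup>2)"
      using i iM by (rule Bochner_Integration.integrable_add[rotated])
    fix x
    have t: "t \<le> 1 + t\<^sup>2" for t :: real
      using sum_squares_bound[of t 1] zero_le_power2[of t]
      by (simp only: power_one mult_1_right)
    show "norm (indicator (ball p \<delta>) x *\<^sub>R \<phi> x) \<le> indicator M x + (norm (\<phi> x))\<^sup>2"
    proof (cases "x \<in> M")
      case True
      have "norm (indicator (ball p \<delta>) x *\<^sub>R \<phi> x) \<le> norm (\<phi> x)"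
        by (simp add: indicator_def)
      also have "\<dots> \<le> indicator M x + (norm (\<phi> x))\<^sup>2"
        using t True by simp
      finally show ?thesis .
    next
      case False
      then have "x \<notin> closure {x. \<phi> x \<noteq> 0}"
        using test_functionsD(3)[OF \<phi>] by (rule contra_subsetD[rotated])
      then have "\<phi> x = 0"
        by (rule not_in_closure_support)
      then show ?thesis
        by simp
    qed
  qed
  also have "\<dots> = measure lborel M + (\<integral>x. (norm (\<phi> x))\<^sup>2 \<partial>lborel)"
    using i iM by simp
  finally show ?thesis .
qed

text \<open>The scalar estimate is summed over the components. Its data \<delta>, X and C do not
  depend on the function, so one choice serves all components.\<close>

lemma test_function_L2_le_jet_plus_averages:
  fixes M :: "(real^'n::finite) set"
  assumes M: "open M" "bounded M" and \<epsilon>: "\<epsilon> > 0"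
  obtains \<delta> X C where "finite X" and "C \<ge> 0"
    and "\<And>\<phi> :: real^'n \<Rightarrow> real^'c::finite. \<phi> \<in> test_functions M \<Longrightarrow>
        (\<integral>x. (norm (\<phi> x))\<^sup>2 \<partial>lebesgue_on M) \<le>
        \<epsilon> * (\<integral>x. (norm (jet M \<phi> x))\<^sup>2 \<partial>lebesgue_on M) + C * (\<Sum>p\<in>X. (norm (ball_integral \<delta> p \<phi>))\<^sup>2)"
proof -
  obtain \<delta> X C where X: "\<delta> > 0" "finite X" "C \<ge> 0"
    and ineq: "\<And>\<phi>. \<phi> \<in> test_functions M \<Longrightarrow> (\<integral>x. (\<phi> x)\<^sup>2 \<partial>lborel) \<le>
        \<epsilon> * gradient_energy \<phi> + C * (\<Sum>p\<in>X. (ball_integral \<delta> p \<phi>)\<^sup>2)"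
    using test_function_L2_le_gradient_plus_averages[OF M \<epsilon>] by blast
  have "(\<integral>x. (norm (\<phi> x))\<^sup>2 \<partial>lebesgue_on M) \<le>
      \<epsilon> * (\<integral>x. (norm (jet M \<phi> x))\<^sup>2 \<partial>lebesgue_on M) + C * (\<Sum>p\<in>X. (norm (ball_integral \<delta> p \<phi>))\<^sup>2)"
    if \<phi>: "\<phi> \<in> test_functions M" for \<phi> :: "real^'n \<Rightarrow> real^'c"
  proof -
    have c: "(\<lambda>x. \<phi> x $ i) \<in> test_functions M" for i
      by (rule test_functions_bounded_linear[OF bounded_linear_vec_nth \<phi>])
    have i: "integrable lborel (\<lambda>x. (\<phi> x $ i)\<^sup>2)" for i
      using square_integrableD(2)[OF test_functions_square_integrable[OF c]] by simp
    have "(\<integral>x. (norm (\<phi> x))\<^sup>2 \<partial>lebesgue_on M) = (\<integral>x. (norm (\<phi> x))\<^sup>2 \<partial>lborel)"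
      by (rule test_functions_integral_lebesgue_on[OF M(1) \<phi>])
    also have "\<dots> = (\<Sum>i\<in>UNIV. \<integral>x. (\<phi> x $ i)\<^sup>2 \<partial>lborel)"
      using i by (simp add: norm_vec_square)
    also have "\<dots> \<le> (\<Sum>i\<in>UNIV. \<epsilon> * gradient_energy (\<lambda>x. \<phi> x $ i) +
        C * (\<Sum>p\<in>X. (ball_integral \<delta> p (\<lambda>x. \<phi> x $ i))\<^sup>2))"
      by (intro sum_mono ineq c)
    also have "\<dots> = \<epsilon> * (\<Sum>i\<in>UNIV. gradient_energy (\<lambda>x. \<phi> x $ i)) +
        C * (\<Sum>p\<in>X. \<Sum>i\<in>UNIV. (ball_integral \<delta> p \<phi> $ i)\<^sup>2)"
      unfolding ball_integral_nth[OF test_functions_integrable[OF \<phi>]]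
      by (simp only: sum.distrib sum_distrib_left sum.swap[of _ X])
    also have "(\<Sum>p\<in>X. \<Sum>i\<in>UNIV. (ball_integral \<delta> p \<phi> $ i)\<^sup>2) = (\<Sum>p\<in>X. (norm (ball_integral \<delta> p \<phi>))\<^sup>2)"
      by (simp add: norm_vec_square)
    also have "\<epsilon> * (\<Sum>i\<in>UNIV. gradient_energy (\<lambda>x. \<phi> x $ i)) \<le>
        \<epsilon> * (\<integral>x. (norm (jet M \<phi> x))\<^sup>2 \<partial>lebesgue_on M)"
      unfolding test_functions_H1(2)[OF M(1) \<phi>] using \<epsilon> by (intro mult_left_mono) auto
    finally show ?thesis
      by simp
  qed
  with X(2,3) show ?thesis
    by (rule that)
qed

text \<open>The estimate at \<epsilon> = 1/(n+1) for all n involves only countably many ball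
  integrals. Along a diagonal subsequence they all converge, and the estimate applied to differences
  turns this into the L2 Cauchy property.\<close>

theorem Rellich_test_functions:
  fixes \<phi> :: "nat \<Rightarrow> real^'n::finite \<Rightarrow> real^'c::finite"
  assumes M: "open M" "bounded M" and \<phi>: "\<And>k. \<phi> k \<in> test_functions M"
    and K: "\<And>k. (\<integral>x. (norm (jet M (\<phi> k) x))\<^sup>2 \<partial>lebesgue_on M) \<le> K"
  shows "\<exists>r :: nat \<Rightarrow> nat. strict_mono r \<and> (\<forall>e>0. \<exists>N. \<forall>m\<ge>N. \<forall>n\<ge>N.
    (\<integral>x. (norm (\<phi> (r m) x - \<phi> (r n) x))\<^sup>2 \<partial>lebesgue_on M) < e)"
proof -
  define Q where "Q n \<delta> X C \<longleftrightarrow> finite X \<and> C \<ge> 0 \<and> (\<forall>\<phi> :: real^'n \<Rightarrow> real^'c. \<phi> \<in> test_functions M \<longrightarrow>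
      (\<integral>x. (norm (\<phi> x))\<^sup>2 \<partial>lebesgue_on M) \<le>
      1 / real (Suc n) * (\<integral>x. (norm (jet M \<phi> x))\<^sup>2 \<partial>lebesgue_on M) +
      C * (\<Sum>p\<in>X. (norm (ball_integral \<delta> p \<phi>))\<^sup>2))" for n \<delta> X C
  have "\<exists>\<delta> X C. Q n \<delta> X C" for n
  proof -
    have "1 / real (Suc n) > 0"
      by simp
    from test_function_L2_le_jet_plus_averages[OF M this, where 'c = 'c] show ?thesis
      unfolding Q_def by metis
  qed
  then obtain \<delta> X C where Q: "\<And>n. Q n (\<delta> n) (X n) (C n)"
    by metis
  have fin: "finite (X n)" and C: "C n \<ge> 0" for n
    using Q[of n] by (simp_all add: Q_def)
  \<comment> \<open>Radius and centre together index a functional, since the radius varies with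
    \<open>n\<close>.\<close>
  define A where "A = (\<Union>n. (\<lambda>p. (\<delta> n, p)) ` X n)"
  define f where "f k = (\<lambda>(d, p). ball_integral d p (\<phi> k))" for k
  have cA: "countable A"
    unfolding A_def by (rule countable_UN) (simp_all add: countable_finite fin)
  have fb: "norm (f k a) \<le> measure lborel M + K" for k a
  proof -
    have "(\<integral>x. (norm (\<phi> k x))\<^sup>2 \<partial>lborel) \<le> (\<integral>x. (norm (jet M (\<phi> k) x))\<^sup>2 \<partial>lebesgue_on M)"
      unfolding test_functions_H1(2)[OF M(1) \<phi>] by (simp add: sum_nonneg gradient_energy_nonneg)
    with K[of k] norm_ball_integral_le[OF M \<phi>[of k], of "fst a" "snd a"] show ?thesis
      by (simp add: f_def split_beta)
  qed
  have "\<exists>r. strict_mono r \<and> (\<forall>a\<in>A. \<exists>l. (\<lambda>k. f (r k) a) \<longlonglongrightarrow> l)"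
  proof (rule function_convergent_subsequence[OF cA fb])
    fix r assume "strict_mono (r :: nat \<Rightarrow> nat)" "\<And>a. a \<in> A \<Longrightarrow> \<exists>l. (\<lambda>k. f (r k) a) \<longlonglongrightarrow> l"
    then show ?thesis
      by (intro exI[of _ r]) simp
  qed
  then obtain r where r: "strict_mono r" "\<forall>a\<in>A. \<exists>l. (\<lambda>k. f (r k) a) \<longlonglongrightarrow> l"
    by (elim exE conjE)
  have "\<exists>N. \<forall>a\<ge>N. \<forall>b\<ge>N. (\<integral>x. (norm (\<phi> (r a) x - \<phi> (r b) x))\<^sup>2 \<partial>lebesgue_on M) < e"
    if e: "e > 0" for e
  proof -
    have K0: "K \<ge> 0"
      using K[of 0] by (rule order_trans[rotated]) simp
    \<comment> \<open>Jets of differences have squared norm at most \<open>4 * K\<close>, so the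
      gradient term stays below \<open>e / 2\<close> for this \<open>n\<close>.\<close>
    obtain n where n: "4 * K / e * 2 < real (Suc n)"
      using reals_Archimedean2 by (metis less_Suc_eq_le of_nat_less_iff order_less_trans lessI)
    have small: "1 / real (Suc n) * (4 * K) < e / 2"
      using n e by (simp add: field_simps)
    obtain l where l: "\<And>p. p \<in> X n \<Longrightarrow> (\<lambda>k. f (r k) (\<delta> n, p)) \<longlonglongrightarrow> l p"
    proof -
      have "\<forall>p\<in>X n. \<exists>l. (\<lambda>k. f (r k) (\<delta> n, p)) \<longlonglongrightarrow> l"
        using r(2) by (auto simp: A_def)
      then show ?thesis
        using that by metis
    qed
    \<comment> \<open>The functionals of a difference are compared with their limits, so the
      averaging term is at most \<open>h a + h b\<close>, each below \<open>e / 4\<close>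
      eventually.\<close>
    define h where "h k = C n * (\<Sum>p\<in>X n. 2 * (norm (f (r k) (\<delta> n, p) - l p))\<^sup>2)" for k
    have "h \<longlonglongrightarrow> C n * (\<Sum>p\<in>X n. 2 * (norm (l p - l p))\<^sup>2)"
      unfolding h_def by (intro tendsto_intros l)
    then have "h \<longlonglongrightarrow> 0"
      by simp
    then obtain N where N: "\<And>k. k \<ge> N \<Longrightarrow> h k < e / 4"
      using order_tendstoD(2)[of h 0 sequentially "e / 4"] e by (auto simp: eventually_sequentially)
    have "(\<integral>x. (norm (\<phi> (r a) x - \<phi> (r b) x))\<^sup>2 \<partial>lebesgue_on M) < e" if ab: "a \<ge> N" "b \<ge> N" for a b
    proof -
      let ?\<psi> = "\<lambda>x. \<phi> (r a) x - \<phi> (r b) x"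
      have \<psi>: "?\<psi> \<in> test_functions M"
        using test_functions_lincomb[OF \<phi> \<phi>, of 1 "r a" "-1" "r b"] by simp
      have H: "\<phi> k \<in> H1 M" for k
        by (rule test_functions_H1(1)[OF M(1) \<phi>])
      have "(\<integral>x. (norm (jet M ?\<psi> x))\<^sup>2 \<partial>lebesgue_on M) =
          (\<integral>x. (norm (jet M (\<phi> (r a)) x - jet M (\<phi> (r b)) x))\<^sup>2 \<partial>lebesgue_on M)"
        by (rule integral_jet_diff[OF M(1) H H])
      also have "\<dots> \<le> 2 * (\<integral>x. (norm (jet M (\<phi> (r a)) x))\<^sup>2 \<partial>lebesgue_on M) +
          2 * (\<integral>x. (norm (jet M (\<phi> (r b)) x))\<^sup>2 \<partial>lebesgue_on M)"
        by (rule integral_norm_diff_square_le[OF jet_square_integrable[OF M(1) H] jet_square_integrable[OF M(1) H]])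
      also have "\<dots> \<le> 4 * K"
        using K[of "r a"] K[of "r b"] by linarith
      finally have J: "1 / real (Suc n) * (\<integral>x. (norm (jet M ?\<psi> x))\<^sup>2 \<partial>lebesgue_on M) \<le> 1 / real (Suc n) * (4 * K)"
        by (rule mult_left_mono) simp
      have "(norm (ball_integral (\<delta> n) p ?\<psi>))\<^sup>2 \<le>
          2 * (norm (f (r a) (\<delta> n, p) - l p))\<^sup>2 + 2 * (norm (f (r b) (\<delta> n, p) - l p))\<^sup>2" for p
      proof -
        have "ball_integral (\<delta> n) p ?\<psi> = (f (r a) (\<delta> n, p) - l p) + (l p - f (r b) (\<delta> n, p))"
          by (simp add: f_def ball_integral_diff test_functions_integrable[OF \<phi>])
        then show ?thesis
          using norm_add_square_le[of "f (r a) (\<delta> n, p) - l p" "l p - f (r b) (\<delta> n, p)"]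
          by (simp add: norm_minus_commute)
      qed
      then have "C n * (\<Sum>p\<in>X n. (norm (ball_integral (\<delta> n) p ?\<psi>))\<^sup>2) \<le>
          C n * (\<Sum>p\<in>X n. 2 * (norm (f (r a) (\<delta> n, p) - l p))\<^sup>2 + 2 * (norm (f (r b) (\<delta> n, p) - l p))\<^sup>2)"
        using C by (intro mult_left_mono sum_mono) auto
      also have "\<dots> = h a + h b"
        by (simp add: h_def sum.distrib distrib_left)
      finally have B: "C n * (\<Sum>p\<in>X n. (norm (ball_integral (\<delta> n) p ?\<psi>))\<^sup>2) \<le> h a + h b" .
      have "(\<integral>x. (norm (?\<psi> x))\<^sup>2 \<partial>lebesgue_on M) \<le>
          1 / real (Suc n) * (\<integral>x. (norm (jet M ?\<psi> x))\<^sup>2 \<partial>lebesgue_on M) +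
          C n * (\<Sum>p\<in>X n. (norm (ball_integral (\<delta> n) p ?\<psi>))\<^sup>2)"
        using Q[of n, unfolded Q_def, THEN conjunct2, THEN conjunct2, rule_format, OF \<psi>] .
      then show ?thesis
        using J B small N[OF ab(1)] N[OF ab(2)] by linarith
    qed
    then show ?thesis
      by blast
  qed
  with r(1) show ?thesis
    by (intro exI[of _ r]) simp
qed

subsection \<open>Minimization of the energy\<close>

lemma prob_simplex_norm_le_1:
  assumes "p \<in> prob_simplex"
  shows "norm p \<le> 1"
proof -
  have "norm p \<le> (\<Sum>j\<in>UNIV. \<bar>p $ j\<bar>)"
    by (rule norm_le_l1_cart)
  also have "\<dots> = 1"
    using assms by (simp add: prob_simplex_def)
  finally show ?thesis .
qed

lemma closed_prob_simplex: "closed (prob_simplex :: (real^'c::finite) set)"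
  unfolding prob_simplex_def
  by (intro closed_Collect_conj closed_Collect_all closed_Collect_le closed_Collect_eq continuous_intros)

lemma convex_prob_simplex: "convex (prob_simplex :: (real^'c::finite) set)"
  unfolding convex_def prob_simplex_def
  by (auto simp: sum.distrib simp flip: sum_distrib_left)

lemma H1_square_integrable:
  fixes S :: "real^'n::finite \<Rightarrow> real^'c::finite"
  assumes "open M" and "S \<in> H1 M"
  shows "square_integrable (lebesgue_on M) S"
  using square_integrable_fst[OF jet_square_integrable[OF assms]] by simp

lemma energy_eq:
  fixes S :: "real^'n::finite \<Rightarrow> real^'c::finite"
  assumes M: "open M" and S: "S \<in> H1 M"
  shows "energy M \<alpha> S = (\<integral>x. (norm (weak_jacobian M S x))\<^sup>2 \<partial>lebesgue_on M) -
    \<alpha> * (\<integral>x. (norm (S x))\<^sup>2 \<partial>lebesgue_on M)"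
  using square_integrableD(2)[OF weak_jacobian_square_integrable[OF M S]]
    square_integrableD(2)[OF H1_square_integrable[OF M S]]
  by (simp add: energy_def)

text \<open>Bounds on the energy and on the L2 norm, the latter coming from the simplex constraint,
  combine to a bound in \<open>H1\<close>.\<close>

lemma integral_jet_eq:
  fixes S :: "real^'n::finite \<Rightarrow> real^'c::finite"
  assumes M: "open M" and S: "S \<in> H1 M"
  shows "(\<integral>x. (norm (jet M S x))\<^sup>2 \<partial>lebesgue_on M) =
    energy M \<alpha> S + (\<alpha> + 1) * (\<integral>x. (norm (S x))\<^sup>2 \<partial>lebesgue_on M)"
  using integral_norm_fst_snd_square[OF jet_square_integrable[OF M S]]
  by (simp add: energy_eq[OF M S] algebra_simps)

text \<open>The parallelogram law is used twice, for the Jacobians and for the functions. The second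
  instance enters the energies with factor -\<alpha> and is moved to the right hand side.\<close>

lemma energy_midpoint:
  fixes S T :: "real^'n::finite \<Rightarrow> real^'c::finite"
  assumes M: "open M" and S: "S \<in> H1 M" and T: "T \<in> H1 M"
  shows "(\<integral>x. (norm (weak_jacobian M S x - weak_jacobian M T x))\<^sup>2 \<partial>lebesgue_on M) =
    2 * energy M \<alpha> S + 2 * energy M \<alpha> T - 4 * energy M \<alpha> (\<lambda>x. (1/2) *\<^sub>R S x + (1/2) *\<^sub>R T x) +
    \<alpha> * (\<integral>x. (norm (S x - T x))\<^sup>2 \<partial>lebesgue_on M)"
proof -
  let ?U = "\<lambda>x. (1/2) *\<^sub>R S x + (1/2) *\<^sub>R T x"
  have par: "(\<integral>x. (norm (f x - g x))\<^sup>2 \<partial>\<mu>) = 2 * (\<integral>x. (norm (f x))\<^sup>2 \<partial>\<mu>) + 2 * (\<integral>x. (norm (g x))\<^sup>2 \<partial>\<mu>) -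
      4 * (\<integral>x. (norm ((1/2) *\<^sub>R f x + (1/2) *\<^sub>R g x))\<^sup>2 \<partial>\<mu>)"
    if "square_integrable \<mu> f" "square_integrable \<mu> g"
    for \<mu> :: "(real^'n) measure" and f g :: "real^'n \<Rightarrow> 'z::euclidean_space"
  proof -
    have "(norm (f x - g x))\<^sup>2 = 2 * (norm (f x))\<^sup>2 + 2 * (norm (g x))\<^sup>2 -
        4 * (norm ((1/2) *\<^sub>R f x + (1/2) *\<^sub>R g x))\<^sup>2" for x
      unfolding power2_norm_eq_inner
      by (simp add: inner_diff inner_add inner_commute algebra_simps)
    then show ?thesis
      using square_integrableD(2)[OF that(1)] square_integrableD(2)[OF that(2)]
        square_integrableD(2)[OF square_integrable_lincomb[OF that, of "1/2" "1/2"]]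
      by simp
  qed
  have U: "?U \<in> H1 M"
    by (rule H1_lincomb(1)[OF M S T])
  have "AE x in lebesgue_on M. weak_jacobian M ?U x =
      (1/2) *\<^sub>R weak_jacobian M S x + (1/2) *\<^sub>R weak_jacobian M T x"
    using H1_lincomb(2)[OF M S T, of "1/2" "1/2"] by eventually_elim (simp add: jet_def)
  then have "(\<integral>x. (norm (weak_jacobian M ?U x))\<^sup>2 \<partial>lebesgue_on M) =
      (\<integral>x. (norm ((1/2) *\<^sub>R weak_jacobian M S x + (1/2) *\<^sub>R weak_jacobian M T x))\<^sup>2 \<partial>lebesgue_on M)"
    by (rule integral_norm_square_cong_AE[OF _ weak_jacobian_square_integrable[OF M U]
          square_integrable_lincomb[OF weak_jacobian_square_integrable[OF M S]
            weak_jacobian_square_integrable[OF M T]]])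
  then show ?thesis
    unfolding energy_eq[OF M S] energy_eq[OF M T] energy_eq[OF M U]
      par[OF weak_jacobian_square_integrable[OF M S] weak_jacobian_square_integrable[OF M T]]
      par[OF H1_square_integrable[OF M S] H1_square_integrable[OF M T]]
    by (simp add: algebra_simps)
qed

lemma simplex_valued_integral_le:
  fixes S :: "real^'n::finite \<Rightarrow> real^'c::finite"
  assumes M: "open M" "bounded M" and S: "S \<in> simplex_valued M"
  shows "(\<integral>x. (norm (S x))\<^sup>2 \<partial>lebesgue_on M) \<le> measure (lebesgue_on M) M"
proof -
  interpret finite_measure "lebesgue_on M"
    by (rule finite_measure_lebesgue_on_bounded[OF M])
  have H: "S \<in> H1 M" and ae: "AE x in lebesgue_on M. S x \<in> prob_simplex"
    using S by (auto simp: simplex_valued_def)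
  have "(\<integral>x. (norm (S x))\<^sup>2 \<partial>lebesgue_on M) \<le> (\<integral>x. 1 \<partial>lebesgue_on M)"
  proof (rule integral_mono_AE)
    show "integrable (lebesgue_on M) (\<lambda>x. (norm (S x))\<^sup>2)"
      by (rule square_integrableD(2)[OF H1_square_integrable[OF M(1) H]])
    show "AE x in lebesgue_on M. (norm (S x))\<^sup>2 \<le> 1"
      using ae by eventually_elim (simp add: prob_simplex_norm_le_1 power_le_one)
  qed simp
  then show ?thesis
    by simp
qed

text \<open>The simplex is convex, and the boundary condition is affine: subtracting
  \<open>g\<close> from the midpoint gives the midpoint of two elements of
  \<open>H1_0 M\<close>.\<close>

lemma feasible_midpoint:
  fixes S T g :: "real^'n::finite \<Rightarrow> real^'c::finite"
  assumes M: "open M" and S: "S \<in> feasible M g" and T: "T \<in> feasible M g"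
  shows "(\<lambda>x. (1/2) *\<^sub>R S x + (1/2) *\<^sub>R T x) \<in> feasible M g"
proof -
  let ?U = "\<lambda>x. (1/2) *\<^sub>R S x + (1/2) *\<^sub>R T x"
  have H: "S \<in> H1 M" "T \<in> H1 M" and ae: "AE x in lebesgue_on M. S x \<in> prob_simplex"
    "AE x in lebesgue_on M. T x \<in> prob_simplex"
    and b: "(\<lambda>x. S x - g x) \<in> H1_0 M" "(\<lambda>x. T x - g x) \<in> H1_0 M"
    using S T by (auto simp: feasible_def simplex_valued_def)
  have "AE x in lebesgue_on M. ?U x \<in> prob_simplex"
    using ae by eventually_elim (intro convexD[OF convex_prob_simplex], auto)
  moreover have "(1/2) *\<^sub>R (S x - g x) + (1/2) *\<^sub>R (T x - g x) = ?U x - g x" for x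
    by (simp add: vec_eq_iff field_simps)
  then have "(\<lambda>x. ?U x - g x) \<in> H1_0 M"
    using H1_0_lincomb[OF M b, of "1/2" "1/2"] by simp
  ultimately show ?thesis
    using H1_lincomb(1)[OF M H, of "1/2" "1/2"] by (simp add: feasible_def simplex_valued_def)
qed

text \<open>The two modes of convergence serve the two constraints: pointwise convergence along
  \<open>r\<close> the values in the closed simplex, convergence of jets the boundary
  condition.\<close>

lemma feasible_closed:
  fixes S :: "nat \<Rightarrow> real^'n::finite \<Rightarrow> real^'c::finite"
  assumes M: "open M" and g: "g \<in> H1 M" and S: "\<And>k. S k \<in> feasible M g" and T: "T \<in> H1 M"
    and lim: "(\<lambda>k. \<integral>x. (norm (jet M (S k) x - jet M T x))\<^sup>2 \<partial>lebesgue_on M) \<longlonglongrightarrow> 0"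
    and ae: "AE x in lebesgue_on M. (\<lambda>k. S (r k) x) \<longlonglongrightarrow> T x"
  shows "T \<in> feasible M g"
proof -
  have H: "S k \<in> H1 M" and aeS: "AE x in lebesgue_on M. S k x \<in> prob_simplex"
    and b: "(\<lambda>x. S k x - g x) \<in> H1_0 M" for k
    using S by (auto simp: feasible_def simplex_valued_def)
  have "AE x in lebesgue_on M. \<forall>k. S k x \<in> prob_simplex"
    using aeS by (simp add: AE_all_countable)
  with ae have "AE x in lebesgue_on M. T x \<in> prob_simplex"
    by eventually_elim (rule closed_sequentially[OF closed_prob_simplex], auto)
  moreover have "(\<lambda>x. T x - g x) \<in> H1_0 M"
  proof (rule H1_0_closed[where S = "\<lambda>k x. S k x - g x", OF M b H1_diff(1)[OF M T g]])
    have "(\<integral>x. (norm (jet M (\<lambda>x. S k x - g x) x - jet M (\<lambda>x. T x - g x) x))\<^sup>2 \<partial>lebesgue_on M) =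
        (\<integral>x. (norm (jet M (S k) x - jet M T x))\<^sup>2 \<partial>lebesgue_on M)" for k
    proof (rule integral_norm_square_cong_AE)
      show "AE x in lebesgue_on M. jet M (\<lambda>x. S k x - g x) x - jet M (\<lambda>x. T x - g x) x =
          jet M (S k) x - jet M T x"
        using H1_diff(2)[OF M H[of k] g] H1_diff(2)[OF M T g] by eventually_elim simp
    qed (intro square_integrable_diff jet_square_integrable M H1_diff(1)[OF M H g] H1_diff(1)[OF M T g] H T)+
    then show "(\<lambda>k. \<integral>x. (norm (jet M (\<lambda>x. S k x - g x) x - jet M (\<lambda>x. T x - g x) x))\<^sup>2 \<partial>lebesgue_on M) \<longlonglongrightarrow> 0"
      using lim by simp
  qed
  ultimately show ?thesis
    using T by (simp add: feasible_def simplex_valued_def)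
qed

text \<open>The compactness is inherited from test functions approximating \<open>S k - g\<close>.\<close>

lemma feasible_L2_compact:
  fixes S :: "nat \<Rightarrow> real^'n::finite \<Rightarrow> real^'c::finite"
  assumes M: "open M" "bounded M" and g: "g \<in> H1 M" and S: "\<And>k. S k \<in> feasible M g"
    and K: "\<And>k. (\<integral>x. (norm (jet M (S k) x))\<^sup>2 \<partial>lebesgue_on M) \<le> K"
  shows "\<exists>r :: nat \<Rightarrow> nat. strict_mono r \<and> (\<forall>e>0. \<exists>N. \<forall>m\<ge>N. \<forall>n\<ge>N.
    (\<integral>x. (norm (S (r m) x - S (r n) x))\<^sup>2 \<partial>lebesgue_on M) < e)"
proof -
  define u where "u k x = S k x - g x" for k x
  have H: "S k \<in> H1 M" and b: "u k \<in> H1_0 M" for k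
    using S by (auto simp: feasible_def simplex_valued_def u_def[abs_def])
  have uH: "u k \<in> H1 M" for k
    using b by (auto simp: H1_0_iff[OF M(1)])
  define G where "G = (\<integral>x. (norm (jet M g x))\<^sup>2 \<partial>lebesgue_on M)"
  have ub: "(\<integral>x. (norm (jet M (u k) x))\<^sup>2 \<partial>lebesgue_on M) \<le> 2 * K + 2 * G" for k
  proof -
    have "(\<integral>x. (norm (jet M (u k) x))\<^sup>2 \<partial>lebesgue_on M) =
        (\<integral>x. (norm (jet M (S k) x - jet M g x))\<^sup>2 \<partial>lebesgue_on M)"
      unfolding u_def[abs_def] by (rule integral_jet_diff[OF M(1) H g])
    then show ?thesis
      using integral_norm_diff_square_le[OF jet_square_integrable[OF M(1) H[of k]] jet_square_integrable[OF M(1) g]]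
        K[of k] by (simp add: G_def)
  qed
  have "\<forall>k. \<exists>\<phi>. \<phi> \<in> test_functions M \<and>
      (\<integral>x. (norm (jet M \<phi> x - jet M (u k) x))\<^sup>2 \<partial>lebesgue_on M) < inverse (real (Suc k))"
    using b by (simp add: H1_0_iff[OF M(1)] Bex_def)
  from choice[OF this] obtain \<phi> where *: "\<forall>k. \<phi> k \<in> test_functions M \<and>
      (\<integral>x. (norm (jet M (\<phi> k) x - jet M (u k) x))\<^sup>2 \<partial>lebesgue_on M) < inverse (real (Suc k))"
    by (elim exE)
  have \<phi>: "\<phi> k \<in> test_functions M"
    and close: "(\<integral>x. (norm (jet M (\<phi> k) x - jet M (u k) x))\<^sup>2 \<partial>lebesgue_on M) < inverse (real (Suc k))" for k
    using *[rule_format, of k] by simp_all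
  have \<phi>H: "\<phi> k \<in> H1 M" for k
    by (rule test_functions_H1(1)[OF M(1) \<phi>])
  note js = jet_square_integrable[OF M(1)]
  \<comment> \<open>Write the jet of \<open>\<phi> k\<close> as its deviation from that of
    \<open>u k\<close>, of squared norm at most 1, plus the jet of \<open>u k\<close>.\<close>
  have "(\<integral>x. (norm (jet M (\<phi> k) x))\<^sup>2 \<partial>lebesgue_on M) \<le> 2 + 2 * (2 * K + 2 * G)" for k
  proof -
    have "inverse (real (Suc k)) \<le> 1"
      by (simp add: inverse_le_1_iff)
    then show ?thesis
      using integral_norm_add_square_le[OF square_integrable_diff[OF js[OF \<phi>H[of k]] js[OF uH[of k]]] js[OF uH[of k]]]
        close[of k] ub[of k] by simp
  qed
  from Rellich_test_functions[where \<phi> = \<phi>, OF M \<phi> this] obtain r where r: "strict_mono (r :: nat \<Rightarrow> nat)"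
    and Cauchy: "\<forall>e>0. \<exists>N. \<forall>m\<ge>N. \<forall>n\<ge>N.
        (\<integral>x. (norm (\<phi> (r m) x - \<phi> (r n) x))\<^sup>2 \<partial>lebesgue_on M) < e"
    by (elim exE conjE)
  have c2: "(\<integral>x. (norm (\<phi> k x - u k x))\<^sup>2 \<partial>lebesgue_on M) < inverse (real (Suc k))" for k
  proof -
    have "(\<integral>x. (norm (\<phi> k x - u k x))\<^sup>2 \<partial>lebesgue_on M) \<le>
        (\<integral>x. (norm (jet M (\<phi> k) x - jet M (u k) x))\<^sup>2 \<partial>lebesgue_on M)"
      using integral_norm_fst_snd_square[OF square_integrable_diff[OF js[OF \<phi>H[of k]] js[OF uH[of k]]]]
      by simp
    with close[of k] show ?thesis
      by simp
  qed
  note sq = H1_square_integrable[OF M(1)]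
  have "\<exists>N. \<forall>m\<ge>N. \<forall>n\<ge>N. (\<integral>x. (norm (S (r m) x - S (r n) x))\<^sup>2 \<partial>lebesgue_on M) < e" if e: "e > 0" for e
  proof -
    \<comment> \<open>Two squared triangle inequalities give the weights 2, 4 and 4 on three terms
      below \<open>e / 16\<close>, in total less than \<open>e\<close>.\<close>
    obtain N where N: "\<And>m n. m \<ge> N \<Longrightarrow> n \<ge> N \<Longrightarrow>
        (\<integral>x. (norm (\<phi> (r m) x - \<phi> (r n) x))\<^sup>2 \<partial>lebesgue_on M) < e / 16"
      using Cauchy[rule_format, of "e / 16"] e by auto
    obtain L where L: "inverse (real (Suc L)) < e / 16"
      using reals_Archimedean[of "e / 16"] e by auto
    have "(\<integral>x. (norm (S (r m) x - S (r n) x))\<^sup>2 \<partial>lebesgue_on M) < e"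
      if mn: "m \<ge> max N L" "n \<ge> max N L" for m n
    proof -
      have small: "(\<integral>x. (norm (\<phi> (r k) x - u (r k) x))\<^sup>2 \<partial>lebesgue_on M) < e / 16" if "k \<ge> L" for k
      proof -
        have "L \<le> r k"
          using that seq_suble[OF r, of k] by simp
        then have "inverse (real (Suc (r k))) \<le> inverse (real (Suc L))"
          by (intro le_imp_inverse_le) auto
        with c2[of "r k"] L show ?thesis
          by linarith
      qed
      have "(\<integral>x. (norm (S (r m) x - S (r n) x))\<^sup>2 \<partial>lebesgue_on M) =
          (\<integral>x. (norm (u (r m) x - u (r n) x))\<^sup>2 \<partial>lebesgue_on M)"
        by (simp add: u_def)
      also have "\<dots> \<le> 2 * (\<integral>x. (norm (u (r m) x - \<phi> (r m) x))\<^sup>2 \<partial>lebesgue_on M) +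
          2 * (\<integral>x. (norm (\<phi> (r m) x - u (r n) x))\<^sup>2 \<partial>lebesgue_on M)"
        by (rule integral_norm_diff_square_triangle[OF sq[OF uH] sq[OF \<phi>H] sq[OF uH]])
      also have "(\<integral>x. (norm (\<phi> (r m) x - u (r n) x))\<^sup>2 \<partial>lebesgue_on M) \<le>
          2 * (\<integral>x. (norm (\<phi> (r m) x - \<phi> (r n) x))\<^sup>2 \<partial>lebesgue_on M) +
          2 * (\<integral>x. (norm (\<phi> (r n) x - u (r n) x))\<^sup>2 \<partial>lebesgue_on M)"
        by (rule integral_norm_diff_square_triangle[OF sq[OF \<phi>H] sq[OF \<phi>H] sq[OF uH]])
      finally show ?thesis
        using small[of m] small[of n] N[of m n] mn e by (simp add: norm_minus_commute)
    qed
    then show ?thesis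
      by blast
  qed
  with r show ?thesis
    by (intro exI[of _ r]) simp
qed

theorem energy_minimizer_exists:
  fixes M :: "(real^'n::finite) set" and g :: "real^'n \<Rightarrow> real^'c::finite"
  assumes M: "open M" "bounded M" and g: "g \<in> H1 M"
    and nonempty: "feasible M g \<noteq> {}" and \<alpha>: "\<alpha> > 0"
  shows "\<exists>S0\<in>feasible M g. \<forall>S\<in>feasible M g. energy M \<alpha> S0 \<le> energy M \<alpha> S"
proof -
  define V where "V = measure (lebesgue_on M) M"
  define m where "m = Inf (energy M \<alpha> ` feasible M g)"
  have H: "S \<in> H1 M" and V: "(\<integral>x. (norm (S x))\<^sup>2 \<partial>lebesgue_on M) \<le> V" if "S \<in> feasible M g" for S
    using that simplex_valued_integral_le[OF M] by (auto simp: feasible_def simplex_valued_def V_def)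
  \<comment> \<open>Without a lower bound \<open>Inf\<close> would carry no information. The
    Dirichlet part is nonnegative and simplex values bound the L2 part.\<close>
  have lower: "- \<alpha> * V \<le> energy M \<alpha> S" if S: "S \<in> feasible M g" for S
  proof -
    have "\<alpha> * (\<integral>x. (norm (S x))\<^sup>2 \<partial>lebesgue_on M) \<le> \<alpha> * V"
      using V[OF S] \<alpha> by (intro mult_left_mono) auto
    moreover have "0 \<le> (\<integral>x. (norm (weak_jacobian M S x))\<^sup>2 \<partial>lebesgue_on M)"
      by simp
    ultimately show ?thesis
      unfolding energy_eq[OF M(1) H[OF S]] by linarith
  qed
  have bdd: "bdd_below (energy M \<alpha> ` feasible M g)"
    using lower by (intro bdd_belowI2[of _ "- \<alpha> * V"])
  have m: "m \<le> energy M \<alpha> S" if "S \<in> feasible M g" for S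
    unfolding m_def using bdd that by (intro cInf_lower) auto
  have "\<exists>S\<in>feasible M g. energy M \<alpha> S < m + inverse (real (Suc k))" for k
    using cInf_lessD[of "energy M \<alpha> ` feasible M g" "m + inverse (real (Suc k))"] nonempty
    by (auto simp: m_def)
  then have "\<forall>k. \<exists>S. S \<in> feasible M g \<and> energy M \<alpha> S < m + inverse (real (Suc k))"
    by blast
  from choice[OF this] obtain S where
    *: "\<forall>k. S k \<in> feasible M g \<and> energy M \<alpha> (S k) < m + inverse (real (Suc k))"
    by (elim exE)
  have S: "S k \<in> feasible M g" and min: "energy M \<alpha> (S k) < m + inverse (real (Suc k))" for k
    using *[rule_format, of k] by simp_all
  have "(\<integral>x. (norm (jet M (S k) x))\<^sup>2 \<partial>lebesgue_on M) \<le> m + 1 + (\<alpha> + 1) * V" for k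
  proof -
    have "inverse (real (Suc k)) \<le> 1"
      by (simp add: inverse_le_1_iff)
    moreover have "(\<alpha> + 1) * (\<integral>x. (norm (S k x))\<^sup>2 \<partial>lebesgue_on M) \<le> (\<alpha> + 1) * V"
      using V[OF S] \<alpha> by (intro mult_left_mono) auto
    ultimately show ?thesis
      using min[of k] unfolding integral_jet_eq[OF M(1) H[OF S], of k \<alpha>] by linarith
  qed
  from feasible_L2_compact[where S = S, OF M g S this] obtain r where r: "strict_mono (r :: nat \<Rightarrow> nat)"
    and L2: "\<forall>e>0. \<exists>N. \<forall>m\<ge>N. \<forall>n\<ge>N.
        (\<integral>x. (norm (S (r m) x - S (r n) x))\<^sup>2 \<partial>lebesgue_on M) < e"
    by (elim exE conjE)
  define T where "T k = S (r k)" for k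
  have T: "T k \<in> feasible M g" for k
    unfolding T_def by (rule S)
  note HT = H[OF T]
  have Tmin: "energy M \<alpha> (T k) < m + inverse (real (Suc k))" for k
  proof -
    have "inverse (real (Suc (r k))) \<le> inverse (real (Suc k))"
      using seq_suble[OF r, of k] by (intro le_imp_inverse_le) auto
    with min[of "r k"] show ?thesis
      unfolding T_def by linarith
  qed
  have E_lim: "(\<lambda>k. energy M \<alpha> (T k)) \<longlonglongrightarrow> m"
  proof (rule tendsto_sandwich[OF _ _ tendsto_const])
    show "(\<lambda>k. m + inverse (real (Suc k))) \<longlonglongrightarrow> m"
      using tendsto_add[OF tendsto_const LIMSEQ_inverse_real_of_nat, of m] by simp
    show "\<forall>\<^sub>F k in sequentially. m \<le> energy M \<alpha> (T k)"
      by (intro always_eventually allI m T)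
    show "\<forall>\<^sub>F k in sequentially. energy M \<alpha> (T k) \<le> m + inverse (real (Suc k))"
      by (intro always_eventually allI less_imp_le Tmin)
  qed
  have Cauchy: "\<exists>N. \<forall>a\<ge>N. \<forall>b\<ge>N. (\<integral>x. (norm (jet M (T a) x - jet M (T b) x))\<^sup>2 \<partial>lebesgue_on M) < e"
    if e: "e > 0" for e
  proof -
    \<comment> \<open>The squared L2 distance occurs with weight 1 from the function part of the jet
      and \<alpha> from the midpoint identity. The energies contribute at most 2 (m + e/8) + 2 (m +
      e/8) - 4 m = e/2, so \<open>e / 2\<close> is left for it.\<close>
    have "e / (2 * (\<alpha> + 1)) > 0"
      using e \<alpha> by simp
    with L2 obtain N where N: "\<forall>a\<ge>N. \<forall>b\<ge>N.
        (\<integral>x. (norm (T a x - T b x))\<^sup>2 \<partial>lebesgue_on M) < e / (2 * (\<alpha> + 1))"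
      unfolding T_def by blast
    obtain L where L: "inverse (real (Suc L)) < e / 8"
      using reals_Archimedean[of "e / 8"] e by auto
    have "(\<integral>x. (norm (jet M (T a) x - jet M (T b) x))\<^sup>2 \<partial>lebesgue_on M) < e"
      if ab: "a \<ge> max N L" "b \<ge> max N L" for a b
    proof -
      let ?d = "\<integral>x. (norm (T a x - T b x))\<^sup>2 \<partial>lebesgue_on M"
      have near: "energy M \<alpha> (T k) < m + e / 8" if "k \<ge> L" for k
      proof -
        have "inverse (real (Suc k)) \<le> inverse (real (Suc L))"
          using that by (intro le_imp_inverse_le) auto
        with Tmin[of k] L show ?thesis
          by linarith
      qed
      have "(\<alpha> + 1) * ?d < e / 2"
        using N[rule_format, of a b] ab \<alpha> by (simp add: pos_less_divide_eq mult.commute[of "\<alpha> + 1"] algebra_simps)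
      moreover have "m \<le> energy M \<alpha> (\<lambda>x. (1/2) *\<^sub>R T a x + (1/2) *\<^sub>R T b x)"
        by (intro m feasible_midpoint M T)
      moreover have "(\<integral>x. (norm (jet M (T a) x - jet M (T b) x))\<^sup>2 \<partial>lebesgue_on M) =
          ?d + (\<integral>x. (norm (weak_jacobian M (T a) x - weak_jacobian M (T b) x))\<^sup>2 \<partial>lebesgue_on M)"
        using integral_norm_fst_snd_square[OF square_integrable_diff[OF jet_square_integrable[OF M(1) HT[of a]]
              jet_square_integrable[OF M(1) HT[of b]]]] by simp
      ultimately show ?thesis
        using near[of a] near[of b] ab energy_midpoint[OF M(1) HT[of a] HT[of b], of \<alpha>]
        by (simp add: distrib_right)
    qed
    then show ?thesis
      by blast
  qed
  \<comment> \<open>Completeness is applied to jets, so the limit carries a candidate function and a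
    candidate Jacobian together.\<close>
  obtain F q where F: "square_integrable (lebesgue_on M) F"
    and lim: "(\<lambda>k. \<integral>x. (norm (jet M (T k) x - F x))\<^sup>2 \<partial>lebesgue_on M) \<longlonglongrightarrow> 0"
    and ae: "AE x in lebesgue_on M. (\<lambda>k. jet M (T (q k)) x) \<longlonglongrightarrow> F x"
    by (rule L2_complete[where F = "\<lambda>k. jet M (T k)", OF jet_square_integrable[OF M(1) HT] Cauchy]) blast
  define S0 where "S0 x = fst (F x)" for x
  have S0: "S0 \<in> H1 M" and jet_S0: "AE x in lebesgue_on M. jet M S0 x = F x"
    using H1_closed[where S = T, OF M HT F lim] by (simp_all add: S0_def[abs_def])
  have eq: "(\<integral>x. (norm (jet M (T k) x - jet M S0 x))\<^sup>2 \<partial>lebesgue_on M) =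
      (\<integral>x. (norm (jet M (T k) x - F x))\<^sup>2 \<partial>lebesgue_on M)" for k
  proof (rule integral_norm_square_cong_AE)
    show "AE x in lebesgue_on M. jet M (T k) x - jet M S0 x = jet M (T k) x - F x"
      using jet_S0 by eventually_elim simp
  qed (intro square_integrable_diff jet_square_integrable M HT S0 F)+
  have lim0: "(\<lambda>k. \<integral>x. (norm (jet M (T k) x - jet M S0 x))\<^sup>2 \<partial>lebesgue_on M) \<longlonglongrightarrow> 0"
    using lim by (simp add: eq)
  have "AE x in lebesgue_on M. (\<lambda>k. T (q k) x) \<longlonglongrightarrow> S0 x"
    using ae
  proof eventually_elim
    case (elim x)
    then show ?case
      using tendsto_fst[OF elim] by (simp add: S0_def)
  qed
  from feasible_closed[where S = T and r = q, OF M(1) g T S0 lim0 this] have feas: "S0 \<in> feasible M g" .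
  note d = square_integrable_diff[OF jet_square_integrable[OF M(1) HT] jet_square_integrable[OF M(1) S0]]
  have l1: "(\<lambda>k. \<integral>x. (norm (T k x))\<^sup>2 \<partial>lebesgue_on M) \<longlonglongrightarrow> (\<integral>x. (norm (S0 x))\<^sup>2 \<partial>lebesgue_on M)"
  proof (rule tendsto_integral_norm_square[OF H1_square_integrable[OF M(1) HT] H1_square_integrable[OF M(1) S0]])
    show "(\<lambda>k. \<integral>x. (norm (T k x - S0 x))\<^sup>2 \<partial>lebesgue_on M) \<longlonglongrightarrow> 0"
    proof (rule tendsto_integral_norm_le[OF _ d _ lim0])
      show "square_integrable (lebesgue_on M) (\<lambda>x. T k x - S0 x)" for k
        by (intro square_integrable_diff H1_square_integrable M HT S0)
      show "norm (T k x - S0 x) \<le> norm (jet M (T k) x - jet M S0 x)" for k x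
        using norm_fst_le_norm[of "jet M (T k) x - jet M S0 x"] by simp
    qed
  qed
  have l2: "(\<lambda>k. \<integral>x. (norm (weak_jacobian M (T k) x))\<^sup>2 \<partial>lebesgue_on M) \<longlonglongrightarrow>
      (\<integral>x. (norm (weak_jacobian M S0 x))\<^sup>2 \<partial>lebesgue_on M)"
  proof (rule tendsto_integral_norm_square[OF weak_jacobian_square_integrable[OF M(1) HT]
        weak_jacobian_square_integrable[OF M(1) S0]])
    show "(\<lambda>k. \<integral>x. (norm (weak_jacobian M (T k) x - weak_jacobian M S0 x))\<^sup>2 \<partial>lebesgue_on M) \<longlonglongrightarrow> 0"
    proof (rule tendsto_integral_norm_le[OF _ d _ lim0])
      show "square_integrable (lebesgue_on M) (\<lambda>x. weak_jacobian M (T k) x - weak_jacobian M S0 x)" for k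
        by (intro square_integrable_diff weak_jacobian_square_integrable M HT S0)
      show "norm (weak_jacobian M (T k) x - weak_jacobian M S0 x) \<le> norm (jet M (T k) x - jet M S0 x)" for k x
        using norm_snd_le_norm[of "jet M (T k) x - jet M S0 x"] by simp
    qed
  qed
  have "(\<lambda>k. energy M \<alpha> (T k)) \<longlonglongrightarrow> energy M \<alpha> S0"
    unfolding energy_eq[OF M(1) HT] energy_eq[OF M(1) S0] by (intro tendsto_intros l1 l2)
  with E_lim have "energy M \<alpha> S0 = m"
    by (rule LIMSEQ_unique[rotated])
  with feas m show ?thesis
    by auto
qed

theorem theorem4p4:
  fixes M :: "(real^2) set" and g :: "real^2 \<Rightarrow> real^'c::finite" and \<alpha> :: real
  assumes "open M" and "bounded M" and "simply_connected M"
    and "CARD('c) \<ge> 2"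
    and "g \<in> H1 M"
    and "\<exists>h\<in>simplex_valued M. (\<lambda>x. g x - h x) \<in> H1_0 M"
    and "\<alpha> > 0"
  shows "\<exists>S0\<in>feasible M g. ereal (energy M \<alpha> S0) = (INF S\<in>feasible M g. ereal (energy M \<alpha> S))"
proof -
  obtain h where h: "h \<in> simplex_valued M" "(\<lambda>x. g x - h x) \<in> H1_0 M"
    using assms(6) by blast
  \<comment> \<open>The trace condition is stated for g - h; its negative shows that
    \<open>h\<close> itself is a competitor.\<close>
  have "(\<lambda>x. h x - g x) \<in> H1_0 M"
    using H1_0_lincomb[OF assms(1) h(2) h(2), of "-1" 0] by simp
  with h(1) have "feasible M g \<noteq> {}"
    unfolding feasible_def by blast
  from energy_minimizer_exists[OF assms(1,2,5) this assms(7)] obtain S0 where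
    S0: "S0 \<in> feasible M g" "\<And>S. S \<in> feasible M g \<Longrightarrow> energy M \<alpha> S0 \<le> energy M \<alpha> S"
    by blast
  \<comment> \<open>In \<open>ereal\<close> the infimum is always a true greatest lower bound, so
    attainment by \<open>S0\<close> is all that has to be checked.\<close>
  have "ereal (energy M \<alpha> S0) = (INF S\<in>feasible M g. ereal (energy M \<alpha> S))"
    by (rule antisym[OF INF_greatest INF_lower[OF S0(1)]]) (simp add: S0(2))
  with S0(1) show ?thesis
    by (intro bexI[of _ S0])
qed

end
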